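(* Let $p(z)=z^m(z^n-1)$ with integers $m\ge 0$ and $n\ge 2$, and let $h\in\mathbb{C}$ with $|h-1|<1$. If the Julia set $\mathcal{J}(N_{h,p})$ of the relaxed Newton map $N_{h,p}(z)=z-h\,p(z)/p'(z)$ is not a line, then $\Sigma p=\Sigma N_{h,p}$.
   Context: For a rational map (or polynomial) $R$ of degree at least two with Julia set $\mathcal{J}(R)$, the symmetry group of $R$ is $\Sigma R=\{\sigma(z)=az+b:\ |a|=1,\ \sigma(\mathcal{J}(R))=\mathcal{J}(R)\}$, the group of Euclidean isometries preserving the Julia set. $N_{h,p}$ is viewed as a rational map of the Riemann sphere. *)

theory Defs
  imports "HOL-Analysis.Analysis" "HOL-Computational_Algebra.Polynomial_Factorial" "HOL-Computational_Algebra.Field_as_Ring"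
begin

text \<open>The Riemann sphere is modelled as complex option, None being the point at infinity.
  It carries the chordal metric, realised via stereographic projection onto the unit
  sphere of R^3 (Euclidean distance there equals the chordal distance).\<close>

definition stereo :: "complex option \<Rightarrow> real \<times> real \<times> real" where
  "stereo w = (case w of
      None \<Rightarrow> (0, 0, 1)
    | Some z \<Rightarrow> (2 * Re z / (1 + (cmod z)^2), 2 * Im z / (1 + (cmod z)^2),
                 ((cmod z)^2 - 1) / (1 + (cmod z)^2)))"

definition chordal :: "complex option \<Rightarrow> complex option \<Rightarrow> real" where
  "chordal z w = dist (stereo z) (stereo w)"

definition sphere_open :: "complex option set \<Rightarrow> bool" where
  "sphere_open U \<longleftrightarrow> (\<forall>z\<in>U. \<exists>r>0. \<forall>w. chordal z w < r \<longrightarrow> w \<in> U)"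

definition sphere_compact :: "complex option set \<Rightarrow> bool" where
  "sphere_compact K \<longleftrightarrow> compact (stereo ` K)"

definition iterates_normal_on :: "(complex option \<Rightarrow> complex option) \<Rightarrow> complex option set \<Rightarrow> bool" where
  "iterates_normal_on f U \<longleftrightarrow>
     (\<forall>k :: nat \<Rightarrow> nat. \<exists>r g. strict_mono r \<and>
        (\<forall>K. K \<subseteq> U \<and> sphere_compact K \<longrightarrow>
           (\<forall>\<epsilon>>0. \<forall>\<^sub>F j in sequentially. \<forall>z\<in>K. chordal ((f ^^ k (r j)) z) (g z) < \<epsilon>)))"

definition fatou :: "(complex option \<Rightarrow> complex option) \<Rightarrow> complex option set" where
  "fatou f = {z. \<exists>U. sphere_open U \<and> z \<in> U \<and> iterates_normal_on f U}"

definition julia :: "(complex option \<Rightarrow> complex option) \<Rightarrow> complex option set" where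
  "julia f = UNIV - fatou f"

text \<open>The map of the sphere induced by P/Q (P, Q assumed coprime).\<close>

definition rat_sphere :: "complex poly \<Rightarrow> complex poly \<Rightarrow> complex option \<Rightarrow> complex option" where
  "rat_sphere P Q w = (case w of
      Some z \<Rightarrow> (if poly Q z = 0 then None else Some (poly P z / poly Q z))
    | None \<Rightarrow> (if degree P > degree Q then None
               else Some (if degree P = degree Q then lead_coeff P / lead_coeff Q else 0)))"

definition poly_sphere :: "complex poly \<Rightarrow> complex option \<Rightarrow> complex option" where
  "poly_sphere p = rat_sphere p 1"

text \<open>Relaxed Newton map N_{h,p}(z) = z - h p(z)/p'(z) = (z p' - h p)/p', reduced to lowest terms.\<close>

definition relaxed_newton :: "complex \<Rightarrow> complex poly \<Rightarrow> complex option \<Rightarrow> complex option" where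
  "relaxed_newton h p =
     (let num = [:0, 1:] * pderiv p - smult h p; den = pderiv p; g = gcd num den
      in rat_sphere (num div g) (den div g))"

definition pmn :: "nat \<Rightarrow> nat \<Rightarrow> complex poly" where
  "pmn m n = monom 1 m * (monom 1 n - 1)"

definition ext_aff :: "(complex \<Rightarrow> complex) \<Rightarrow> complex option \<Rightarrow> complex option" where
  "ext_aff \<sigma> = map_option \<sigma>"

definition sym_group :: "complex option set \<Rightarrow> (complex \<Rightarrow> complex) set" where
  "sym_group J = {\<sigma>. \<exists>a b. cmod a = 1 \<and> \<sigma> = (\<lambda>z. a * z + b) \<and> ext_aff \<sigma> ` J = J}"

definition is_line :: "complex option set \<Rightarrow> bool" where
  "is_line J \<longleftrightarrow> (\<exists>a b. b \<noteq> 0 \<and> Some -` J = {a + of_real t * b | t. True})"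

end

theory Submission
  imports Defs "HOL-Complex_Analysis.Complex_Analysis" "HOL-Computational_Algebra.Fundamental_Theorem_Algebra"
begin

text \<open>
  Both groups consist of the rotations \<open>z \<mapsto> a z\<close> with \<open>a\<^sup>n = 1\<close>.

  For the polynomial \<open>p\<close>, rotation invariance forces every symmetry to fix the centre 0 of the smallest
  disc containing the Julia set. If \<open>z \<mapsto> a z\<close> is a symmetry, then \<open>q(z) = a\<^sup>-\<^sup>d p(a z) = p(z) + \<gamma> z\<^sup>m\<close>
  with \<open>d = m + n\<close> maps the Julia set into that disc. Averaging \<open>q\<close> over the fibres of \<open>p\<close>, as in the
  theory of Chebyshev polynomials, gives \<open>\<gamma> = 0\<close>.

  The Newton map \<open>N\<close> is asymptotic to \<open>z \<mapsto> \<mu> z\<close> with \<open>\<mu> = 1 - h/d\<close>, \<open>0 < |\<mu>| < 1\<close>, so infinity is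
  repelling. The translations preserving its Julia set form a closed group that is stable under
  multiplication by \<open>\<mu>\<close>; if it is nontrivial, it contains a line, and then the Julia set is a line.
  Hence all symmetries fix 0. In the coordinate \<open>x = z\<^sup>n\<close> the Newton map becomes a map \<open>M\<close> with
  \<open>M(x) = \<Lambda> x + (1 - \<Lambda>) x\<^sub>0 + O(1/x)\<close>, whose linearisation at infinity is centred at \<open>x\<^sub>0 \<noteq> 0\<close>. A further
  rotational symmetry about 0 composed with its linear part is almost a translation; rescaling by
  powers of \<open>\<Lambda>\<close>, the Julia set is invariant under a translation flow in the linearising coordinate.
  By Picard's theorem this coordinate reaches a multiple preimage of infinity, near which the Julia
  set contains arcs in several directions. Together with the flow they fill an open set, whereas
  the Julia set has empty interior.
\<close>

section \<open>The chordal metric in homogeneous coordinates\<close>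

definition quot_point :: "complex \<Rightarrow> complex \<Rightarrow> complex option" where
  "quot_point a b = (if b = 0 then None else Some (a / b))"

lemma Some_quot_point: "Some z = quot_point z 1"
  by (simp add: quot_point_def)

lemma None_quot_point: "None = quot_point 1 0"
  by (simp add: quot_point_def)

lemma quot_point_cases:
  obtains a b where "w = quot_point a b" "a \<noteq> 0 \<or> b \<noteq> 0"
  by (cases w) (use Some_quot_point None_quot_point in \<open>metis zero_neq_one\<close>)+

definition hom_vector :: "complex \<Rightarrow> complex \<Rightarrow> real \<times> real \<times> real" where
  "hom_vector a b = (2 * Re (a * cnj b), 2 * Im (a * cnj b), (cmod a)^2 - (cmod b)^2)"

lemma hom_norm_pos:
  assumes "a \<noteq> 0 \<or> b \<noteq> 0"
  shows "(cmod a)^2 + (cmod b)^2 > 0"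
  using assms by (auto simp: add_pos_nonneg add_nonneg_pos)

lemma inner_hom_vector:
  "hom_vector a b \<bullet> hom_vector c e =
    ((cmod a)^2 + (cmod b)^2) * ((cmod c)^2 + (cmod e)^2) - 2 * (cmod (a * e - b * c))^2"
  by (simp add: hom_vector_def cmod_power2) (simp add: power2_eq_square algebra_simps)

lemma stereo_quot_point:
  assumes "a \<noteq> 0 \<or> b \<noteq> 0"
  shows "stereo (quot_point a b) = hom_vector a b /\<^sub>R ((cmod a)^2 + (cmod b)^2)"
proof (cases "b = 0")
  case True
  with assms show ?thesis by (simp add: stereo_def quot_point_def hom_vector_def)
next
  case False
  define B where "B = (cmod b)^2"
  have B: "B > 0" "(cmod a)^2 + B > 0" using False hom_norm_pos[OF assms] by (simp_all add: B_def)
  have norm_quot: "(cmod (a / b))^2 = (cmod a)^2 / B"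
    by (simp add: norm_divide power_divide B_def)
  have denominator: "1 + (cmod a)^2 / B = ((cmod a)^2 + B) / B" using B by (simp add: field_simps)
  have quot: "a / b = a * cnj b / of_real B"
    using False complex_div_cnj[of a b] by (simp add: B_def)
  have Re_quot: "Re (a / b) = Re (a * cnj b) / B" and Im_quot: "Im (a / b) = Im (a * cnj b) / B"
    unfolding quot by (simp_all only: Re_divide_of_real Im_divide_of_real)
  have "stereo (quot_point a b) = (2 * Re (a / b) / (1 + (cmod (a / b))^2),
      2 * Im (a / b) / (1 + (cmod (a / b))^2), ((cmod (a / b))^2 - 1) / (1 + (cmod (a / b))^2))"
    using False by (simp add: stereo_def quot_point_def)
  also have "\<dots> = hom_vector a b /\<^sub>R ((cmod a)^2 + B)"
    unfolding Re_quot Im_quot norm_quot denominator hom_vector_def B_def[symmetric]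
    using B by (simp add: divide_inverse mult_ac) (simp add: field_simps)
  finally show ?thesis by (simp add: B_def)
qed

lemma norm_stereo: "norm (stereo w) = 1"
proof -
  obtain a b where w: "w = quot_point a b" and ab: "a \<noteq> 0 \<or> b \<noteq> 0" by (rule quot_point_cases)
  define S where "S = (cmod a)^2 + (cmod b)^2"
  have "S > 0" unfolding S_def by (rule hom_norm_pos[OF ab])
  moreover have "norm (hom_vector a b) = \<bar>S\<bar>"
    unfolding norm_eq_sqrt_inner inner_hom_vector S_def by (simp add: mult.commute)
  ultimately show ?thesis unfolding w stereo_quot_point[OF ab] by (simp flip: S_def)
qed

lemma range_stereo: "range stereo = sphere 0 1"
proof
  show "range stereo \<subseteq> sphere 0 1" by (auto simp: norm_stereo)
  show "sphere 0 1 \<subseteq> range stereo"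
  proof
    fix v :: "real \<times> real \<times> real" assume "v \<in> sphere 0 1"
    moreover obtain x y z where v: "v = (x, y, z)" by (metis prod_cases3)
    ultimately have xyz: "x^2 + y^2 + z^2 = 1" by (simp add: norm_Pair)
    show "v \<in> range stereo"
    proof (cases "z = 1")
      case True
      then have "stereo None = v" using xyz by (simp add: v stereo_def sum_power2_eq_zero_iff)
      then show ?thesis by (metis rangeI)
    next
      case False
      have xy: "x^2 + y^2 = (1 - z) * (1 + z)" using xyz by (simp add: algebra_simps power2_eq_square)
      have norms: "(cmod (Complex x y))^2 = (1 - z) * (1 + z)" "(cmod (complex_of_real (1 - z)))^2 = (1 - z)^2"
        using xy by (simp_all add: cmod_power2 del: of_real_diff)
      have "Complex x y \<noteq> 0 \<or> complex_of_real (1 - z) \<noteq> 0" using False by auto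
      from stereo_quot_point[OF this] have "stereo (quot_point (Complex x y) (of_real (1 - z))) = v"
        unfolding norms hom_vector_def using False by (simp add: v power2_eq_square field_simps)
      then show ?thesis by (metis rangeI)
    qed
  qed
qed

lemma chordal_quot_point:
  assumes ab: "a \<noteq> 0 \<or> b \<noteq> 0" and ce: "c \<noteq> 0 \<or> e \<noteq> 0"
  shows "chordal (quot_point a b) (quot_point c e) =
    2 * cmod (a * e - b * c) / (sqrt ((cmod a)^2 + (cmod b)^2) * sqrt ((cmod c)^2 + (cmod e)^2))"
proof -
  define S T where "S = (cmod a)^2 + (cmod b)^2" and "T = (cmod c)^2 + (cmod e)^2"
  have S: "S > 0" and T: "T > 0" using hom_norm_pos ab ce by (auto simp: S_def T_def)
  let ?u = "stereo (quot_point a b)" and ?v = "stereo (quot_point c e)"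
  have "(dist ?u ?v)^2 = (norm ?u)^2 + (norm ?v)^2 - 2 * (?u \<bullet> ?v)"
    by (simp add: dist_norm power2_norm_eq_inner inner_diff inner_commute)
  also have "\<dots> = 2 - 2 * ((S * T - 2 * (cmod (a * e - b * c))^2) / (S * T))"
    unfolding norm_stereo unfolding stereo_quot_point[OF ab] stereo_quot_point[OF ce]
    by (simp add: inner_hom_vector S_def T_def field_simps)
  also have "\<dots> = (2 * cmod (a * e - b * c) / (sqrt S * sqrt T))^2"
    using S T by (simp add: power_divide power_mult_distrib field_simps)
  finally show ?thesis
    using S T by (simp add: chordal_def S_def T_def power2_eq_iff_nonneg)
qed

lemma chordal_commute: "chordal x y = chordal y x"
  by (simp add: chordal_def dist_commute)

lemma chordal_triangle: "chordal x z \<le> chordal x y + chordal y z"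
  by (simp add: chordal_def dist_triangle)

lemma chordal_refl [simp]: "chordal x x = 0"
  by (simp add: chordal_def)

lemma chordal_Some_Some:
  "chordal (Some z) (Some w) = 2 * cmod (z - w) / (sqrt (1 + (cmod z)^2) * sqrt (1 + (cmod w)^2))"
  using chordal_quot_point[of z 1 w 1] by (simp add: Some_quot_point add.commute)

lemma chordal_None_Some: "chordal None (Some z) = 2 / sqrt (1 + (cmod z)^2)"
  using chordal_quot_point[of 1 0 z 1] by (simp add: Some_quot_point None_quot_point add.commute)

lemma sqrt_one_plus_square_le: "sqrt (1 + x^2) \<le> 1 + \<bar>x\<bar>" for x :: real
proof (rule real_le_lsqrt)
  show "1 + x^2 \<le> (1 + \<bar>x\<bar>)^2" by (simp add: power2_sum)
qed auto

lemma chordal_Some_le: "chordal (Some z) (Some w) \<le> 2 * cmod (z - w)"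
proof -
  have "1 * 1 \<le> sqrt (1 + (cmod z)^2) * sqrt (1 + (cmod w)^2)"
    by (intro mult_mono) auto
  then show ?thesis unfolding chordal_Some_Some
    by (simp add: divide_le_eq mult_le_cancel_left1 mult_left_le)
qed

lemma chordal_Some_ge:
  "chordal (Some z) (Some w) \<ge> 2 * dist w z / ((1 + cmod z) * (1 + cmod z + dist w z))"
proof -
  have "cmod w \<le> cmod z + dist w z" using norm_triangle_ineq2[of w z] by (simp add: dist_norm)
  then have "sqrt (1 + (cmod w)^2) \<le> 1 + cmod z + dist w z"
    using sqrt_one_plus_square_le[of "cmod w"] by simp
  then show ?thesis unfolding chordal_Some_Some dist_norm norm_minus_commute[of w z]
    using sqrt_one_plus_square_le[of "cmod z"]
    by (intro divide_left_mono mult_mono mult_pos_pos) (auto simp: add_pos_nonneg)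
qed

lemma chordal_None_le: "cmod z > 0 \<Longrightarrow> chordal None (Some z) \<le> 2 / cmod z"
  unfolding chordal_None_Some
  by (intro divide_left_mono real_le_rsqrt mult_pos_pos) (auto simp: add_pos_nonneg)

lemma chordal_None_ge: "chordal None (Some z) \<ge> 2 / (1 + cmod z)"
  unfolding chordal_None_Some using sqrt_one_plus_square_le[of "cmod z"]
  by (intro divide_left_mono mult_pos_pos) (auto simp: add_pos_nonneg)

lemma chordal_rotate:
  assumes "cmod a = 1"
  shows "chordal (ext_aff (\<lambda>z. a * z) x) (ext_aff (\<lambda>z. a * z) y) = chordal x y"
proof -
  have "cmod (a * z - a * w) = cmod (z - w)" for z w
    using assms by (metis norm_mult mult_1 right_diff_distrib)
  then show ?thesis
    using assms
    by (cases x; cases y)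
       (simp_all add: ext_aff_def chordal_Some_Some chordal_None_Some chordal_commute[of _ None] norm_mult)
qed

lemma continuous_on_stereo_quot_point:
  assumes "continuous_on S a" "continuous_on S b" "\<And>z. z \<in> S \<Longrightarrow> a z \<noteq> 0 \<or> b z \<noteq> 0"
  shows "continuous_on S (\<lambda>z. stereo (quot_point (a z) (b z)))"
proof -
  have "continuous_on S (\<lambda>z. hom_vector (a z) (b z) /\<^sub>R ((cmod (a z))^2 + (cmod (b z))^2))"
    unfolding hom_vector_def using hom_norm_pos assms(3)
    by (intro continuous_intros assms(1,2)) (metis less_irrefl)
  then show ?thesis
    by (rule continuous_on_eq) (use stereo_quot_point assms(3) in auto)
qed

lemma continuous_on_stereo_Some: "continuous_on S (\<lambda>z. stereo (Some z))"
  unfolding Some_quot_point by (intro continuous_on_stereo_quot_point continuous_intros) auto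

lemma chordal_ball_finite:
  assumes "r > 0"
  obtains \<delta> where "\<delta> > 0" "\<And>x. chordal (Some z) x < \<delta> \<Longrightarrow> \<exists>w. x = Some w \<and> dist w z < r"
proof
  define B where "B = 1 + cmod z"
  define \<delta> where "\<delta> = 2 * r / (B * (B + r))"
  have B: "B \<ge> 1" by (simp add: B_def)
  show "\<delta> > 0" using assms B by (simp add: \<delta>_def)
  fix x assume x: "chordal (Some z) x < \<delta>"
  show "\<exists>w. x = Some w \<and> dist w z < r"
  proof (cases x)
    case None
    have "(2 / B) * (r / (B + r)) \<le> 2 / B * 1" using B assms by (intro mult_left_mono) auto
    also have "\<dots> \<le> chordal (Some z) None"
      using chordal_None_ge[of z] by (simp add: B_def chordal_commute)
    finally show ?thesis using x None by (simp add: \<delta>_def)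
  next
    case (Some w)
    have "dist w z < r"
    proof (rule ccontr)
      assume "\<not> dist w z < r"
      then have far: "r \<le> dist w z" by simp
      then have "r * (B + dist w z) \<le> dist w z * (B + r)" using B by (simp add: algebra_simps)
      then have "r / (B + r) \<le> dist w z / (B + dist w z)" using assms B far by (simp add: divide_simps)
      then have "(2 / B) * (r / (B + r)) \<le> (2 / B) * (dist w z / (B + dist w z))"
        using B by (intro mult_left_mono) auto
      also have "\<dots> \<le> chordal (Some z) x" using chordal_Some_ge[of w z] Some by (simp add: B_def)
      finally show False using x by (simp add: \<delta>_def)
    qed
    then show ?thesis using Some by blast
  qed
qed

lemma sphere_open_Some_image:
  assumes "open V"
  shows "sphere_open (Some ` V)"
  unfolding sphere_open_def
proof
  fix x assume "x \<in> Some ` V"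
  then obtain z where z: "x = Some z" "z \<in> V" by auto
  from assms z obtain r where r: "r > 0" "ball z r \<subseteq> V" by (meson open_contains_ball)
  obtain \<delta> where "\<delta> > 0" "\<And>x. chordal (Some z) x < \<delta> \<Longrightarrow> \<exists>w. x = Some w \<and> dist w z < r"
    using chordal_ball_finite[OF r(1)] by blast
  then show "\<exists>r>0. \<forall>w. chordal x w < r \<longrightarrow> w \<in> Some ` V"
    using r z by (intro exI[of _ \<delta>]) (fastforce simp: dist_commute)
qed

lemma sphere_open_Some_preimage:
  assumes U: "sphere_open U" and z: "Some z \<in> U"
  obtains r where "r > 0" "Some ` cball z r \<subseteq> U"
proof -
  from U z obtain e where e: "e > 0" "\<And>x. chordal (Some z) x < e \<Longrightarrow> x \<in> U"
    unfolding sphere_open_def by metis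
  have "Some w \<in> U" if "dist z w \<le> e / 3" for w
    using that e(1) chordal_Some_le[of z w] by (intro e(2)) (simp add: dist_norm)
  then show ?thesis using e(1) by (intro that[of "e / 3"]) auto
qed

section \<open>Fatou sets and equicontinuity\<close>

definition equicont_at :: "(complex option \<Rightarrow> complex option) \<Rightarrow> complex \<Rightarrow> bool" where
  "equicont_at f z \<longleftrightarrow>
     (\<forall>\<epsilon>>0. \<forall>\<^sub>F w in nhds z. \<forall>k. chordal ((f ^^ k) (Some w)) ((f ^^ k) (Some z)) < \<epsilon>)"

definition finite_julia :: "(complex option \<Rightarrow> complex option) \<Rightarrow> complex set" where
  "finite_julia f = {z. Some z \<in> julia f}"

definition iterates_continuous :: "(complex option \<Rightarrow> complex option) \<Rightarrow> bool" where
  "iterates_continuous f \<longleftrightarrow> (\<forall>k. continuous_on UNIV (\<lambda>z. stereo ((f ^^ k) (Some z))))"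

lemma eventually_iterate_near:
  assumes "iterates_continuous f" "\<epsilon> > 0"
  shows "\<forall>\<^sub>F w in nhds z. chordal ((f ^^ k) (Some w)) ((f ^^ k) (Some z)) < \<epsilon>"
  using assms unfolding iterates_continuous_def continuous_on_iff chordal_def eventually_nhds_metric
  by (metis UNIV_I)

lemma uniform_subsequence_eventually_near:
  assumes cont: "iterates_continuous f" and r: "r > 0" and \<epsilon>: "\<epsilon> > 0"
    and conv: "\<And>\<epsilon>. \<epsilon> > 0 \<Longrightarrow> \<forall>\<^sub>F j in sequentially. \<forall>w\<in>cball z r. chordal ((f ^^ k j) (Some w)) (g w) < \<epsilon>"
  shows "\<exists>\<delta>>0. \<forall>\<^sub>F j in sequentially. \<forall>w. dist w z < \<delta> \<longrightarrow>
    chordal ((f ^^ k j) (Some w)) ((f ^^ k j) (Some z)) < \<epsilon>"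
proof -
  have "\<epsilon> / 6 > 0" using \<epsilon> by simp
  from conv[OF this] obtain i where close:
    "\<And>j w. j \<ge> i \<Longrightarrow> w \<in> cball z r \<Longrightarrow> chordal ((f ^^ k j) (Some w)) (g w) < \<epsilon> / 6"
    unfolding eventually_sequentially by blast
  obtain \<delta> where \<delta>: "\<delta> > 0"
      "\<And>w. dist w z < \<delta> \<Longrightarrow> chordal ((f ^^ k i) (Some w)) ((f ^^ k i) (Some z)) < \<epsilon> / 6"
    using eventually_iterate_near[OF cont, of "\<epsilon> / 6" "k i" z] \<epsilon> unfolding eventually_nhds_metric by auto
  have "chordal ((f ^^ k j) (Some w)) ((f ^^ k j) (Some z)) < \<epsilon>"
    if j: "j \<ge> i" and w: "dist w z < min \<delta> r" for j w
  proof -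
    have in_ball: "w \<in> cball z r" "z \<in> cball z r" using w r by (auto simp: dist_commute)
    show ?thesis
      using close[OF j in_ball(1)] close[OF j in_ball(2)] close[OF order_refl in_ball(1)]
        close[OF order_refl in_ball(2)] \<delta>(2)[of w] w \<epsilon>
        chordal_triangle[of "(f ^^ k j) (Some w)" "(f ^^ k j) (Some z)" "g w"]
        chordal_triangle[of "g w" "(f ^^ k j) (Some z)" "g z"]
        chordal_triangle[of "g w" "g z" "(f ^^ k i) (Some w)"]
        chordal_triangle[of "(f ^^ k i) (Some w)" "g z" "(f ^^ k i) (Some z)"]
        chordal_commute[of "g z" "(f ^^ k j) (Some z)"]
        chordal_commute[of "g w" "(f ^^ k i) (Some w)"]
      by simp
  qed
  then show ?thesis using \<delta>(1) r unfolding eventually_sequentially by (intro exI[of _ "min \<delta> r"]) auto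
qed

lemma equicont_at_if_normal_on:
  assumes cont: "iterates_continuous f"
    and U: "sphere_open U" "Some z \<in> U" "iterates_normal_on f U"
  shows "equicont_at f z"
proof (rule ccontr)
  obtain r where r: "r > 0" "Some ` cball z r \<subseteq> U" using sphere_open_Some_preimage[OF U(1,2)] .
  have compact: "sphere_compact (Some ` cball z r)" unfolding sphere_compact_def image_image
    by (intro compact_continuous_image continuous_on_stereo_Some) simp
  assume "\<not> equicont_at f z"
  then obtain \<epsilon> where \<epsilon>: "\<epsilon> > 0" and
    "\<And>\<delta>. \<delta> > 0 \<Longrightarrow> \<exists>w k. dist w z < \<delta> \<and> \<not> chordal ((f ^^ k) (Some w)) ((f ^^ k) (Some z)) < \<epsilon>"
    unfolding equicont_at_def eventually_nhds_metric by metis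
  then have "\<forall>j::nat. \<exists>w k. dist w z < 1 / real (Suc j) \<and>
      \<not> chordal ((f ^^ k) (Some w)) ((f ^^ k) (Some z)) < \<epsilon>"
    by (metis zero_less_divide_1_iff of_nat_0_less_iff zero_less_Suc)
  then obtain w k where w: "\<And>j. dist (w j) z < 1 / real (Suc j)"
      and apart: "\<And>j. \<not> chordal ((f ^^ k j) (Some (w j))) ((f ^^ k j) (Some z)) < \<epsilon>" by metis
  have w_lim: "w \<longlonglongrightarrow> z"
    by (rule metric_tendsto_imp_tendsto[OF LIMSEQ_Suc[OF lim_1_over_n[where ?'a = real]]])
       (use w in \<open>simp add: less_imp_le\<close>)
  from U(3) obtain s g where s: "strict_mono s" and
     "\<And>K \<epsilon>. K \<subseteq> U \<Longrightarrow> sphere_compact K \<Longrightarrow> \<epsilon> > 0 \<Longrightarrow>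
        \<forall>\<^sub>F j in sequentially. \<forall>x\<in>K. chordal ((f ^^ k (s j)) x) (g x) < \<epsilon>"
    using spec[OF U(3)[unfolded iterates_normal_on_def], of k] by (elim exE conjE) blast
  from this(2)[OF r(2) compact]
  obtain \<delta> where \<delta>: "\<delta> > 0" "\<forall>\<^sub>F j in sequentially. \<forall>w. dist w z < \<delta> \<longrightarrow>
      chordal ((f ^^ k (s j)) (Some w)) ((f ^^ k (s j)) (Some z)) < \<epsilon>"
    using uniform_subsequence_eventually_near[OF cont r(1) \<epsilon>, of z "\<lambda>j. k (s j)" "\<lambda>w. g (Some w)"] by auto
  have "\<forall>\<^sub>F j in sequentially. dist (w (s j)) z < \<delta>"
    using tendstoD[OF LIMSEQ_subseq_LIMSEQ[OF w_lim s] \<delta>(1)] by (simp add: o_def)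
  then have "\<forall>\<^sub>F j in sequentially. False" using \<delta>(2) by eventually_elim (use apart in blast)
  then show False by simp
qed

lemma uniform_subsequence_if_equicont:
  assumes eq: "\<And>w. w \<in> cball z r \<Longrightarrow> equicont_at f w"
  obtains s g where "strict_mono (s :: nat \<Rightarrow> nat)"
    "\<And>\<epsilon>. \<epsilon> > 0 \<Longrightarrow> \<forall>\<^sub>F j in sequentially. \<forall>w\<in>cball z r. chordal ((f ^^ k (s j)) (Some w)) (g w) < \<epsilon>"
proof -
  let ?h = "\<lambda>j w. stereo ((f ^^ k j) (Some w))"
  have bounded: "norm (?h j w) \<le> 1" for j w by (simp add: norm_stereo)
  have equicont: "\<exists>\<delta>>0. \<forall>j y. y \<in> cball z r \<and> norm (w - y) < \<delta> \<longrightarrow> norm (?h j w - ?h j y) < \<epsilon>"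
    if w: "w \<in> cball z r" and \<epsilon>: "\<epsilon> > 0" for w \<epsilon>
  proof -
    obtain \<delta> where "\<delta> > 0" "\<And>y k. dist y w < \<delta> \<Longrightarrow> chordal ((f ^^ k) (Some y)) ((f ^^ k) (Some w)) < \<epsilon>"
      using eq[OF w] \<epsilon> unfolding equicont_at_def eventually_nhds_metric by metis
    then show ?thesis
      by (intro exI[of _ \<delta>]) (auto simp: chordal_def dist_norm norm_minus_commute)
  qed
  obtain G and s :: "nat \<Rightarrow> nat" where s: "strict_mono s"
      and uniform: "\<And>\<epsilon>. 0 < \<epsilon> \<Longrightarrow> \<exists>i. \<forall>j w. j \<ge> i \<and> w \<in> cball z r \<longrightarrow> norm (?h (s j) w - G w) < \<epsilon>"
    by (rule Arzela_Ascoli[OF compact_cball bounded equicont]) metis+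
  have "G w \<in> range stereo" if "w \<in> cball z r" for w
  proof -
    have "(\<lambda>j. ?h (s j) w) \<longlonglongrightarrow> G w" unfolding LIMSEQ_iff using uniform that by blast
    then have "(\<lambda>j. norm (?h (s j) w)) \<longlonglongrightarrow> norm (G w)" by (rule tendsto_norm)
    then show ?thesis by (simp add: range_stereo norm_stereo LIMSEQ_const_iff)
  qed
  then have "\<forall>w\<in>cball z r. \<exists>x. G w = stereo x" by blast
  from bchoice[OF this] obtain g where g: "\<And>w. w \<in> cball z r \<Longrightarrow> G w = stereo (g w)" by blast
  show ?thesis
  proof
    show "strict_mono s" by (rule s)
    show "\<forall>\<^sub>F j in sequentially. \<forall>w\<in>cball z r. chordal ((f ^^ k (s j)) (Some w)) (g w) < \<epsilon>"
      if "\<epsilon> > 0" for \<epsilon>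
      using uniform[OF that] g unfolding eventually_sequentially chordal_def dist_norm by metis
  qed
qed

lemma in_fatou_if_equicont:
  assumes r: "r > 0" and eq: "\<And>w. w \<in> cball z r \<Longrightarrow> equicont_at f w"
  shows "Some z \<in> fatou f"
proof -
  define U where "U = Some ` ball z r"
  have "iterates_normal_on f U"
    unfolding iterates_normal_on_def
  proof
    fix k
    obtain s :: "nat \<Rightarrow> nat" and g where s: "strict_mono s" and conv: "\<And>\<epsilon>. \<epsilon> > 0 \<Longrightarrow>
        \<forall>\<^sub>F j in sequentially. \<forall>w\<in>cball z r. chordal ((f ^^ k (s j)) (Some w)) (g w) < \<epsilon>"
      using uniform_subsequence_if_equicont[OF eq] by blast
    have "\<forall>\<^sub>F j in sequentially. \<forall>x\<in>K. chordal ((f ^^ k (s j)) x) (g (the x)) < \<epsilon>"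
      if "K \<subseteq> U" "\<epsilon> > 0" for K \<epsilon>
      using conv[OF that(2)] by eventually_elim (use that(1) in \<open>force simp: U_def\<close>)
    then show "\<exists>s g. strict_mono s \<and> (\<forall>K. K \<subseteq> U \<and> sphere_compact K \<longrightarrow>
        (\<forall>\<epsilon>>0. \<forall>\<^sub>F j in sequentially. \<forall>x\<in>K. chordal ((f ^^ k (s j)) x) (g x) < \<epsilon>))"
      using s by (intro exI[of _ s] exI[of _ "\<lambda>x. g (the x)"]) blast
  qed
  moreover have "sphere_open U" unfolding U_def by (rule sphere_open_Some_image) simp
  moreover have "Some z \<in> U" using r by (simp add: U_def)
  ultimately show ?thesis unfolding fatou_def by blast
qed

lemma not_finite_julia_iff:
  assumes cont: "iterates_continuous f"
  shows "z \<notin> finite_julia f \<longleftrightarrow> (\<forall>\<^sub>F w in nhds z. equicont_at f w)"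
proof
  assume "z \<notin> finite_julia f"
  then obtain U where U: "sphere_open U" "Some z \<in> U" "iterates_normal_on f U"
    by (auto simp: finite_julia_def julia_def fatou_def)
  obtain r where r: "r > 0" "Some ` cball z r \<subseteq> U" using sphere_open_Some_preimage[OF U(1,2)] .
  then show "\<forall>\<^sub>F w in nhds z. equicont_at f w" unfolding eventually_nhds_metric
    by (intro exI[of _ r]) (auto simp: dist_commute intro!: equicont_at_if_normal_on[OF cont U(1) _ U(3)])
next
  assume "\<forall>\<^sub>F w in nhds z. equicont_at f w"
  then obtain r where "r > 0" "\<And>w. dist w z \<le> r \<Longrightarrow> equicont_at f w"
    unfolding eventually_nhds_metric_le by blast
  then show "z \<notin> finite_julia f"
    using in_fatou_if_equicont[of r z f] by (simp add: finite_julia_def julia_def dist_commute)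
qed

lemma equicont_at_if_not_finite_julia:
  assumes "iterates_continuous f" "z \<notin> finite_julia f"
  shows "equicont_at f z"
  using assms not_finite_julia_iff eventually_nhds_x_imp_x by blast

lemma closed_finite_julia:
  assumes "iterates_continuous f"
  shows "closed (finite_julia f)"
proof -
  have "\<forall>\<^sub>F w in nhds z. w \<in> - finite_julia f" if "z \<in> - finite_julia f" for z
    using that not_finite_julia_iff[OF assms] by (simp add: eventually_eventually)
  then have "open (- finite_julia f)" unfolding open_dist eventually_nhds_metric by blast
  then show ?thesis by (simp add: closed_def)
qed

lemma not_finite_julia_if_uniform_limit:
  assumes cont: "iterates_continuous f" and U: "open U" "z \<in> U"
    and lim: "\<And>\<epsilon>. \<epsilon> > 0 \<Longrightarrow> \<forall>\<^sub>F k in sequentially. \<forall>w\<in>U. chordal ((f ^^ k) (Some w)) l < \<epsilon>"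
  shows "z \<notin> finite_julia f"
proof -
  have "equicont_at f v" if v: "v \<in> U" for v
    unfolding equicont_at_def
  proof (intro allI impI)
    fix \<epsilon> :: real assume \<epsilon>: "\<epsilon> > 0"
    then obtain k0 where k0: "\<And>k w. k \<ge> k0 \<Longrightarrow> w \<in> U \<Longrightarrow> chordal ((f ^^ k) (Some w)) l < \<epsilon> / 2"
      using lim[of "\<epsilon> / 2"] unfolding eventually_sequentially by auto
    have near: "\<forall>\<^sub>F w in nhds v. \<forall>k\<in>{..<k0}. chordal ((f ^^ k) (Some w)) ((f ^^ k) (Some v)) < \<epsilon>"
      using eventually_iterate_near[OF cont \<epsilon>] by (intro eventually_ball_finite) auto
    show "\<forall>\<^sub>F w in nhds v. \<forall>k. chordal ((f ^^ k) (Some w)) ((f ^^ k) (Some v)) < \<epsilon>"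
      using near eventually_nhds_in_open[OF U(1) v]
    proof eventually_elim
      case (elim w)
      show ?case
      proof
        fix k show "chordal ((f ^^ k) (Some w)) ((f ^^ k) (Some v)) < \<epsilon>"
        proof (cases "k < k0")
          case False
          then show ?thesis
            using k0[of k w] k0[of k v] elim(2) v
              chordal_triangle[of "(f ^^ k) (Some w)" "(f ^^ k) (Some v)" l] by (simp add: chordal_commute[of l])
        qed (use elim(1) in simp)
      qed
    qed
  qed
  then show ?thesis unfolding not_finite_julia_iff[OF cont]
    using eventually_nhds_in_open[OF U] by (rule eventually_mono[rotated])
qed

lemma equicont_at_image_iff:
  assumes local: "\<forall>\<^sub>F w in nhds z. f (Some w) = Some (g w)"
    and open_at: "filtermap g (nhds z) = nhds (g z)"
  shows "equicont_at f (g z) \<longleftrightarrow> equicont_at f z"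
proof -
  have step: "(f ^^ k) (Some (g w)) = (f ^^ Suc k) (Some w)" if "f (Some w) = Some (g w)" for k w
    using that by (simp add: funpow_Suc_right del: funpow.simps)
  have fz: "f (Some z) = Some (g z)" using local by (rule eventually_nhds_x_imp_x)
  show ?thesis unfolding equicont_at_def open_at[symmetric] eventually_filtermap
  proof (intro iff_allI imp_cong refl iffI)
    fix \<epsilon> :: real assume \<epsilon>: "\<epsilon> > 0"
    have "\<forall>\<^sub>F w in nhds z. dist w z < \<epsilon> / 2" using \<epsilon> unfolding eventually_nhds_metric by (meson half_gt_zero)
    moreover assume "\<forall>\<^sub>F w in nhds z. \<forall>k. chordal ((f ^^ k) (Some (g w))) ((f ^^ k) (Some (g z))) < \<epsilon>"
    ultimately show "\<forall>\<^sub>F w in nhds z. \<forall>k. chordal ((f ^^ k) (Some w)) ((f ^^ k) (Some z)) < \<epsilon>"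
      using local
    proof eventually_elim
      case (elim w)
      show ?case
      proof
        fix k show "chordal ((f ^^ k) (Some w)) ((f ^^ k) (Some z)) < \<epsilon>"
        proof (cases k)
          case 0
          then show ?thesis using chordal_Some_le[of w z] elim(1) by (simp add: dist_norm)
        next
          case (Suc j)
          then show ?thesis using elim(2) step[OF elim(3), of j] step[OF fz, of j] by metis
        qed
      qed
    qed
  next
    fix \<epsilon> :: real
    assume "\<forall>\<^sub>F w in nhds z. \<forall>k. chordal ((f ^^ k) (Some w)) ((f ^^ k) (Some z)) < \<epsilon>"
    then show "\<forall>\<^sub>F w in nhds z. \<forall>k. chordal ((f ^^ k) (Some (g w))) ((f ^^ k) (Some (g z))) < \<epsilon>"
      using local by eventually_elim (simp only: step[OF fz] step, blast)
  qed
qed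

lemma finite_julia_image_iff:
  assumes cont: "iterates_continuous f" and S: "open S" "z \<in> S"
    and local: "\<And>w. w \<in> S \<Longrightarrow> f (Some w) = Some (g w)"
    and open_at: "\<And>w. w \<in> S \<Longrightarrow> filtermap g (nhds w) = nhds (g w)"
  shows "g z \<in> finite_julia f \<longleftrightarrow> z \<in> finite_julia f"
proof -
  have near: "\<forall>\<^sub>F w in nhds v. w \<in> S" if "v \<in> S" for v using eventually_nhds_in_open[OF S(1) that] .
  have "equicont_at f (g w) \<longleftrightarrow> equicont_at f w" if "w \<in> S" for w
    using near[OF that] by (intro equicont_at_image_iff open_at that) (auto elim: eventually_mono simp: local)
  then have "(\<forall>\<^sub>F w in nhds z. equicont_at f (g w)) \<longleftrightarrow> (\<forall>\<^sub>F w in nhds z. equicont_at f w)"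
    using near[OF S(2)] by (intro eventually_cong) (auto elim: eventually_mono)
  then have "(\<forall>\<^sub>F v in nhds (g z). equicont_at f v) \<longleftrightarrow> (\<forall>\<^sub>F w in nhds z. equicont_at f w)"
    by (simp add: eventually_filtermap flip: open_at[OF S(2)])
  then show ?thesis using not_finite_julia_iff[OF cont] by blast
qed

lemma contracting_fixed_point_not_in_julia:
  assumes cont: "iterates_continuous f" and r: "r > 0" and q: "0 \<le> q" "q < 1"
    and contract: "\<And>z. dist z a < r \<Longrightarrow> \<exists>x. f (Some z) = Some x \<and> dist x a \<le> q * dist z a"
  shows "a \<notin> finite_julia f"
proof -
  have orbit: "\<exists>x. (f ^^ k) (Some z) = Some x \<and> dist x a \<le> q ^ k * dist z a" if z: "dist z a < r" for z k
  proof (induction k)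
    case (Suc k)
    then obtain x where x: "(f ^^ k) (Some z) = Some x" "dist x a \<le> q ^ k * dist z a" by blast
    have "q ^ k * dist z a \<le> 1 * dist z a" using q by (intro mult_right_mono power_le_one) auto
    then obtain y where "f (Some x) = Some y" "dist y a \<le> q * dist x a" using contract[of x] x(2) z by fastforce
    moreover have "q * dist x a \<le> q * (q ^ k * dist z a)" using x(2) q by (intro mult_left_mono) auto
    ultimately show ?case using x(1) by fastforce
  qed simp
  show ?thesis
  proof (rule not_finite_julia_if_uniform_limit[OF cont, of "ball a r" _ "Some a"])
    fix \<epsilon> :: real assume \<epsilon>: "\<epsilon> > 0"
    have "(\<lambda>k. 2 * (q ^ k * r)) \<longlonglongrightarrow> 0"
      using q by (intro tendsto_mult_right_zero tendsto_mult_left_zero LIMSEQ_realpow_zero)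
    then have "\<forall>\<^sub>F k in sequentially. 2 * (q ^ k * r) < \<epsilon>" using \<epsilon> by (rule order_tendstoD)
    then show "\<forall>\<^sub>F k in sequentially. \<forall>w\<in>ball a r. chordal ((f ^^ k) (Some w)) (Some a) < \<epsilon>"
    proof eventually_elim
      case (elim k)
      show ?case
      proof
        fix w assume "w \<in> ball a r"
        then have w: "dist w a < r" by (simp add: dist_commute)
        then obtain x where x: "(f ^^ k) (Some w) = Some x" "dist x a \<le> q ^ k * dist w a" using orbit by blast
        have "q ^ k * dist w a \<le> q ^ k * r" using w q by (intro mult_left_mono) auto
        then show "chordal ((f ^^ k) (Some w)) (Some a) < \<epsilon>"
          using x elim chordal_Some_le[of x a] by (simp add: dist_norm)
      qed
    qed
  qed (use r in auto)
qed

lemma attracting_fixed_point_not_in_julia: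
  assumes cont: "iterates_continuous f" and local: "\<forall>\<^sub>F z in nhds a. f (Some z) = Some (g z)"
    and fixpoint: "g a = a" and deriv: "(g has_field_derivative D) (at a)" and D: "cmod D < 1"
  shows "a \<notin> finite_julia f"
proof -
  obtain q where q: "cmod D < q" "q < 1" using dense[OF D] by blast
  have "((\<lambda>z. cmod ((g z - g a) / (z - a))) \<longlongrightarrow> cmod D) (at a)"
    using deriv unfolding has_field_derivative_iff by (rule tendsto_norm)
  then have "\<forall>\<^sub>F z in at a. cmod ((g z - g a) / (z - a)) < q" using q(1) by (rule order_tendstoD)
  then have "\<forall>\<^sub>F z in nhds a. z \<noteq> a \<longrightarrow> cmod ((g z - g a) / (z - a)) < q"
    by (simp add: eventually_at_filter)
  then have "\<forall>\<^sub>F z in nhds a. f (Some z) = Some (g z) \<and> dist (g z) a \<le> q * dist z a"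
    using local by eventually_elim (auto simp: fixpoint dist_norm norm_divide divide_less_eq split: if_splits)
  then obtain r where "r > 0" "\<And>z. dist z a < r \<Longrightarrow> f (Some z) = Some (g z) \<and> dist (g z) a \<le> q * dist z a"
    unfolding eventually_nhds_metric by blast
  moreover have "0 \<le> q" using q(1) norm_ge_zero[of D] by linarith
  ultimately show ?thesis using q(2) by (intro contracting_fixed_point_not_in_julia[OF cont, of r q]) auto
qed

section \<open>Symmetries of Julia sets\<close>

lemma norm_root_of_unity:
  fixes a :: complex
  assumes "a ^ n = 1" "n > 0"
  shows "cmod a = 1"
  using assms power_eq_imp_eq_base[of "cmod a" n 1] by (simp flip: norm_power)

lemma equicont_at_rotate:
  assumes eq: "equicont_at f (a * z)"
    and sym: "\<And>k. \<exists>b. cmod b = 1 \<and> (\<forall>w. (f ^^ k) (Some (a * w)) = ext_aff (\<lambda>w. b * w) ((f ^^ k) (Some w)))"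
  shows "equicont_at f z"
  unfolding equicont_at_def
proof (intro allI impI)
  have "isCont ((*) a) z" by (intro continuous_intros)
  then have rotate: "filterlim ((*) a) (nhds (a * z)) (nhds z)" unfolding isCont_def tendsto_at_iff_tendsto_nhds .
  have chordal_eq: "chordal ((f ^^ k) (Some (a * w))) ((f ^^ k) (Some (a * z))) =
      chordal ((f ^^ k) (Some w)) ((f ^^ k) (Some z))" for k w
    using sym[of k] by (metis chordal_rotate)
  fix \<epsilon> :: real assume "\<epsilon> > 0"
  then have "\<forall>\<^sub>F v in nhds (a * z). \<forall>k. chordal ((f ^^ k) (Some v)) ((f ^^ k) (Some (a * z))) < \<epsilon>"
    using eq unfolding equicont_at_def by blast
  from eventually_compose_filterlim[OF this rotate]
  show "\<forall>\<^sub>F w in nhds z. \<forall>k. chordal ((f ^^ k) (Some w)) ((f ^^ k) (Some z)) < \<epsilon>"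
    unfolding chordal_eq .
qed

lemma finite_julia_rotate:
  assumes cont: "iterates_continuous f"
    and sym: "\<And>k. \<exists>b. cmod b = 1 \<and> (\<forall>w. (f ^^ k) (Some (a * w)) = ext_aff (\<lambda>w. b * w) ((f ^^ k) (Some w)))"
    and z: "z \<in> finite_julia f"
  shows "a * z \<in> finite_julia f"
proof (rule ccontr)
  assume "a * z \<notin> finite_julia f"
  then have "\<forall>\<^sub>F v in nhds (a * z). equicont_at f v" using not_finite_julia_iff[OF cont] by blast
  moreover have "filterlim ((*) a) (nhds (a * z)) (nhds z)"
    unfolding tendsto_at_iff_tendsto_nhds[symmetric] isCont_def[symmetric] by (intro continuous_intros)
  ultimately have "\<forall>\<^sub>F w in nhds z. equicont_at f (a * w)" by (rule eventually_compose_filterlim)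
  then have "\<forall>\<^sub>F w in nhds z. equicont_at f w"
    by (rule eventually_mono) (rule equicont_at_rotate[OF _ sym])
  then show False using z not_finite_julia_iff[OF cont] by blast
qed

lemma finite_julia_rotate_root_of_unity:
  assumes cont: "iterates_continuous f" and n: "n > 0" and a: "a ^ n = 1"
    and semiconj: "\<And>a x. a ^ n = 1 \<Longrightarrow> f (ext_aff (\<lambda>z. a * z) x) = ext_aff (\<lambda>z. a ^ j * z) (f x)"
  shows "a * z \<in> finite_julia f \<longleftrightarrow> z \<in> finite_julia f"
proof -
  have iterate: "(f ^^ k) (ext_aff (\<lambda>z. a * z) x) = ext_aff (\<lambda>z. a ^ (j ^ k) * z) ((f ^^ k) x)"
    if "a ^ n = 1" for a k x
  proof (induction k)
    case (Suc k)
    have "(a ^ (j ^ k)) ^ n = 1" using that by (metis mult.commute power_mult power_one)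
    then show ?case using Suc semiconj[of "a ^ (j ^ k)"] by (simp add: mult.commute flip: power_mult)
  qed simp
  have rotate: "b * w \<in> finite_julia f" if b: "b ^ n = 1" and w: "w \<in> finite_julia f" for b w
  proof (rule finite_julia_rotate[OF cont _ w])
    fix k
    show "\<exists>c. cmod c = 1 \<and> (\<forall>z. (f ^^ k) (Some (b * z)) = ext_aff (\<lambda>z. c * z) ((f ^^ k) (Some z)))"
      using iterate[OF b, of k "Some _"] norm_root_of_unity[OF b n]
      by (intro exI[of _ "b ^ (j ^ k)"]) (simp add: ext_aff_def norm_power)
  qed
  have "a \<noteq> 0" using a n by (auto simp: power_0_left)
  then have "inverse a * (a * z) = z" by simp
  moreover have "inverse a ^ n = 1" using a by (simp add: power_inverse)
  ultimately show ?thesis using rotate a by metis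
qed

lemma bij_image_eq_iff:
  assumes "bij f"
  shows "f ` A = A \<longleftrightarrow> (\<forall>x. f x \<in> A \<longleftrightarrow> x \<in> A)"
proof -
  have "f ` A = A \<longleftrightarrow> f -` A = A"
    using inj_vimage_image_eq[OF bij_is_inj[OF assms]] surj_image_vimage_eq[OF bij_is_surj[OF assms]] by metis
  then show ?thesis by auto
qed

lemma bij_ext_aff:
  assumes "a \<noteq> 0"
  shows "bij (ext_aff (\<lambda>z. a * z + b))"
  unfolding ext_aff_def
proof (rule o_bij)
  show "map_option (\<lambda>z. (z - b) / a) \<circ> map_option (\<lambda>z. a * z + b) = id"
    using assms by (simp add: option.map_comp o_def option.map_id0[unfolded id_def] id_def)
  show "map_option (\<lambda>z. a * z + b) \<circ> map_option (\<lambda>z. (z - b) / a) = id"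
    using assms by (simp add: option.map_comp o_def option.map_id0[unfolded id_def] id_def)
qed

lemma sym_group_julia:
  "sym_group (julia f) = {\<lambda>z. a * z + b | a b.
     cmod a = 1 \<and> (\<forall>z. a * z + b \<in> finite_julia f \<longleftrightarrow> z \<in> finite_julia f)}"
proof -
  have "ext_aff (\<lambda>z. a * z + b) ` J = J \<longleftrightarrow> (\<forall>z. Some (a * z + b) \<in> J \<longleftrightarrow> Some z \<in> J)"
    if "cmod a = 1" for a b J
  proof -
    have "a \<noteq> 0" using that by auto
    then show ?thesis by (simp add: bij_image_eq_iff bij_ext_aff split_option_all) (simp add: ext_aff_def)
  qed
  then show ?thesis unfolding sym_group_def finite_julia_def
    by (intro Collect_cong ex_cong1) (unfold mem_Collect_eq, blast)
qed

definition rotations :: "nat \<Rightarrow> (complex \<Rightarrow> complex) set" where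
  "rotations n = {\<lambda>z. a * z | a. a ^ n = 1}"

lemma sym_group_julia_eq_rotations:
  assumes n: "n > 0"
    and invariant: "\<And>a z. a ^ n = 1 \<Longrightarrow> a * z \<in> finite_julia f \<longleftrightarrow> z \<in> finite_julia f"
    and rigid: "\<And>a b. cmod a = 1 \<Longrightarrow> (\<And>z. a * z + b \<in> finite_julia f \<longleftrightarrow> z \<in> finite_julia f) \<Longrightarrow> b = 0 \<and> a ^ n = 1"
  shows "sym_group (julia f) = rotations n"
proof
  show "sym_group (julia f) \<subseteq> rotations n"
    unfolding sym_group_julia rotations_def using rigid by fastforce
  have "\<exists>b c. (\<lambda>z. a * z) = (\<lambda>z. b * z + c) \<and> cmod b = 1 \<and>
      (\<forall>z. b * z + c \<in> finite_julia f \<longleftrightarrow> z \<in> finite_julia f)" if "a ^ n = 1" for a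
    using that invariant norm_root_of_unity[OF that n] by (intro exI[of _ a] exI[of _ 0]) simp
  then show "rotations n \<subseteq> sym_group (julia f)"
    unfolding sym_group_julia rotations_def by blast
qed

section \<open>Julia sets of rational maps\<close>

definition hom_eval :: "complex poly \<Rightarrow> nat \<Rightarrow> complex \<Rightarrow> complex \<Rightarrow> complex" where
  "hom_eval p D a b = (\<Sum>i\<le>D. coeff p i * a ^ i * b ^ (D - i))"

lemma hom_eval_nonzero:
  assumes "b \<noteq> 0" "degree p \<le> D"
  shows "hom_eval p D a b = b ^ D * poly p (a / b)"
proof -
  have "poly p (a / b) = (\<Sum>i\<le>D. coeff p i * (a / b) ^ i)"
    unfolding poly_altdef using assms(2)
    by (intro sum.mono_neutral_left) (auto simp: coeff_eq_0)
  then have "b ^ D * poly p (a / b) = (\<Sum>i\<le>D. b ^ D * (coeff p i * (a / b) ^ i))"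
    by (simp add: sum_distrib_left)
  also have "\<dots> = hom_eval p D a b"
    unfolding hom_eval_def
  proof (rule sum.cong)
    fix i assume "i \<in> {..D}"
    then have "b ^ D = b ^ i * b ^ (D - i)" by (simp flip: power_add)
    then show "b ^ D * (coeff p i * (a / b) ^ i) = coeff p i * a ^ i * b ^ (D - i)"
      using assms(1) by (simp add: power_divide)
  qed simp
  finally show ?thesis by simp
qed

lemma hom_eval_zero: "hom_eval p D a 0 = coeff p D * a ^ D"
proof -
  have "hom_eval p D a 0 = (\<Sum>i\<le>D. if i = D then coeff p i * a ^ i else 0)"
    unfolding hom_eval_def by (intro sum.cong) (auto simp: power_0_left)
  then show ?thesis by simp
qed

lemma holomorphic_on_hom_eval [holomorphic_intros]:
  assumes "a holomorphic_on S" "b holomorphic_on S"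
  shows "(\<lambda>z. hom_eval p D (a z) (b z)) holomorphic_on S"
  unfolding hom_eval_def by (intro holomorphic_intros assms)

lemma chordal_quot_point_le_inversion:
  assumes ab: "a \<noteq> 0 \<or> b \<noteq> 0" and ce: "c \<noteq> 0 \<or> e \<noteq> 0" and w: "a - w * b \<noteq> 0" "c - w * e \<noteq> 0"
  shows "chordal (quot_point a b) (quot_point c e) \<le>
    2 * (1 + cmod w)^2 * cmod (b / (a - w * b) - e / (c - w * e))"
proof -
  define S T where "S = sqrt ((cmod a)^2 + (cmod b)^2)" and "T = sqrt ((cmod c)^2 + (cmod e)^2)"
  define V where "V = b / (a - w * b) - e / (c - w * e)"
  have pos: "S > 0" "T > 0" using hom_norm_pos[OF ab] hom_norm_pos[OF ce] by (simp_all add: S_def T_def)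
  have norm_le: "cmod (x - w * y) \<le> (1 + cmod w) * sqrt ((cmod x)^2 + (cmod y)^2)" for x y
  proof -
    have "cmod (x - w * y) \<le> cmod x + cmod w * cmod y" by (metis norm_mult norm_triangle_ineq4)
    also have "\<dots> \<le> sqrt ((cmod x)^2 + (cmod y)^2) + cmod w * sqrt ((cmod x)^2 + (cmod y)^2)"
      by (intro add_mono mult_left_mono) (auto simp: real_le_rsqrt)
    finally show ?thesis by (simp add: algebra_simps)
  qed
  have "a * e - b * c = - V * ((a - w * b) * (c - w * e))"
    unfolding V_def using w by (simp add: divide_simps) (simp add: algebra_simps)
  then have "cmod (a * e - b * c) = cmod V * (cmod (a - w * b) * cmod (c - w * e))"
    by (simp add: norm_mult)
  also have "\<dots> \<le> cmod V * (((1 + cmod w) * S) * ((1 + cmod w) * T))"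
    unfolding S_def T_def by (intro mult_left_mono mult_mono norm_le) auto
  finally have "2 * cmod (a * e - b * c) / (S * T) \<le> 2 * (cmod V * (((1 + cmod w) * S) * ((1 + cmod w) * T))) / (S * T)"
    using pos by (intro divide_right_mono mult_left_mono) auto
  also have "\<dots> = 2 * (1 + cmod w)^2 * cmod V" using pos by (simp add: power2_eq_square)
  finally show ?thesis unfolding chordal_quot_point[OF ab ce] S_def T_def V_def .
qed

lemma bounded_holomorphic_lipschitz:
  assumes hol: "f holomorphic_on ball z r" and bound: "\<And>x. x \<in> ball z r \<Longrightarrow> cmod (f x) \<le> B"
    and uv: "u \<in> ball z (r / 2)" "v \<in> ball z (r / 2)"
  shows "cmod (f u - f v) \<le> 2 * B / r * cmod (u - v)"
proof (rule field_differentiable_bound[of "ball z (r / 2)" f "deriv f"])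
  fix x assume x: "x \<in> ball z (r / 2)"
  have r: "r > 0" using x by (smt (verit) dist_not_less_zero field_sum_of_halves mem_ball)
  have sub: "cball x (r / 2) \<subseteq> ball z r"
  proof
    fix y assume "y \<in> cball x (r / 2)"
    then show "y \<in> ball z r" using x dist_triangle[of z y x] by simp
  qed
  show "(f has_field_derivative deriv f x) (at x within ball z (r / 2))"
    by (rule has_field_derivative_at_within[OF holomorphic_derivI[OF hol]]) (use x r in auto)
  have "cmod ((deriv ^^ 1) f x) \<le> fact 1 * B / (r / 2) ^ 1"
  proof (rule Cauchy_inequality)
    show "f holomorphic_on ball x (r / 2)"
      by (rule holomorphic_on_subset[OF hol order_trans[OF ball_subset_cball sub]])
    show "continuous_on (cball x (r / 2)) f"
      by (rule holomorphic_on_imp_continuous_on[OF holomorphic_on_subset[OF hol sub]])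
    show "cmod (f y) \<le> B" if "cmod (x - y) = r / 2" for y
      using that sub by (intro bound) (auto simp: dist_norm)
  qed (use r in simp)
  then show "cmod (deriv f x) \<le> 2 * B / r" by (simp add: mult.commute)
qed (use uv in auto)

locale rational_map =
  fixes P Q :: "complex poly"
  assumes coprime: "coprime P Q" and nonconstant: "degree P > 0 \<or> degree Q > 0"
begin

definition "D = max (degree P) (degree Q)"

abbreviation "f \<equiv> rat_sphere P Q"
abbreviation "J \<equiv> finite_julia f"

lemma no_common_zero: "poly P z \<noteq> 0 \<or> poly Q z \<noteq> 0"
  by (rule coprime_poly_0[OF coprime])

lemma nonzero: "P \<noteq> 0" "Q \<noteq> 0"
  using coprime nonconstant
  by (metis coprime_0_left_iff coprime_0_right_iff degree_0 is_unit_iff_degree less_irrefl not_is_unit_0)+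

lemma not_constant_multiple: "P \<noteq> smult c Q"
proof
  assume P: "P = smult c Q"
  then have "is_unit Q" using coprime by (metis coprime_common_divisor dvd_refl dvd_smult)
  then show False using nonconstant P by (simp add: is_unit_iff_degree nonzero split: if_splits)
qed

lemma rational_map_swap: "rational_map Q P"
  using coprime nonconstant by unfold_locales (auto simp: coprime_commute)

lemma rat_sphere_quot_point:
  assumes "a \<noteq> 0 \<or> b \<noteq> 0"
  shows "f (quot_point a b) = quot_point (hom_eval P D a b) (hom_eval Q D a b)"
    and "hom_eval P D a b \<noteq> 0 \<or> hom_eval Q D a b \<noteq> 0"
proof -
  have "f (quot_point a b) = quot_point (hom_eval P D a b) (hom_eval Q D a b) \<and>
    (hom_eval P D a b \<noteq> 0 \<or> hom_eval Q D a b \<noteq> 0)"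
  proof (cases "b = 0")
    case False
    have "degree P \<le> D" "degree Q \<le> D" by (auto simp: D_def)
    then show ?thesis
      using False no_common_zero[of "a / b"]
      by (auto simp: hom_eval_nonzero rat_sphere_def quot_point_def)
  next
    case True
    then have a: "a \<noteq> 0" using assms by simp
    have lead: "coeff P (degree P) \<noteq> 0" "coeff Q (degree Q) \<noteq> 0"
      using nonzero by auto
    consider "degree P > degree Q" | "degree P = degree Q" | "degree P < degree Q" by linarith
    then show ?thesis
      by cases (use True a lead in \<open>auto simp: hom_eval_zero rat_sphere_def quot_point_def D_def coeff_eq_0 max_def\<close>)
  qed
  then show "f (quot_point a b) = quot_point (hom_eval P D a b) (hom_eval Q D a b)"
    and "hom_eval P D a b \<noteq> 0 \<or> hom_eval Q D a b \<noteq> 0" by auto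
qed

lemma iterate_quot_point:
  "\<exists>a b. a holomorphic_on UNIV \<and> b holomorphic_on UNIV \<and>
     (\<forall>z. (a z \<noteq> 0 \<or> b z \<noteq> 0) \<and> (f ^^ k) (Some z) = quot_point (a z) (b z))"
proof (induction k)
  case 0
  show ?case
    by (intro exI[of _ "\<lambda>z. z"] exI[of _ "\<lambda>_. 1"]) (auto simp: quot_point_def intro: holomorphic_intros)
next
  case (Suc k)
  then obtain a b where ab: "a holomorphic_on UNIV" "b holomorphic_on UNIV"
    "\<And>z. a z \<noteq> 0 \<or> b z \<noteq> 0" "\<And>z. (f ^^ k) (Some z) = quot_point (a z) (b z)" by blast
  show ?case
    by (intro exI[of _ "\<lambda>z. hom_eval P D (a z) (b z)"] exI[of _ "\<lambda>z. hom_eval Q D (a z) (b z)"] conjI allI)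
       (use ab rat_sphere_quot_point in \<open>auto intro!: holomorphic_intros\<close>)
qed

lemma iterates_continuous: "iterates_continuous f"
  unfolding iterates_continuous_def
proof
  fix k
  obtain a b where ab: "a holomorphic_on UNIV" "b holomorphic_on UNIV"
    "\<And>z. a z \<noteq> 0 \<or> b z \<noteq> 0" "\<And>z. (f ^^ k) (Some z) = quot_point (a z) (b z)"
    using iterate_quot_point by blast
  show "continuous_on UNIV (\<lambda>z. stereo ((f ^^ k) (Some z)))"
    unfolding ab(4) using ab by (intro continuous_on_stereo_quot_point holomorphic_on_imp_continuous_on) auto
qed

lemma f_Some: "f (Some z) = (if poly Q z = 0 then None else Some (poly P z / poly Q z))"
  by (simp add: rat_sphere_def)

lemma filtermap_nhds_quotient:
  assumes "poly Q z \<noteq> 0"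
  shows "filtermap (\<lambda>w. poly P w / poly Q w) (nhds z) = nhds (poly P z / poly Q z)"
proof (rule filtermap_nhds_open_map')
  show op: "open {w. poly Q w \<noteq> 0}" by (intro open_Collect_neq continuous_intros)
  show "isCont (\<lambda>w. poly P w / poly Q w) z" using assms by (intro continuous_intros)
  have hol: "(\<lambda>w. poly P w / poly Q w) holomorphic_on {w. poly Q w \<noteq> 0}" by (intro holomorphic_intros) auto
  fix S :: "complex set" assume S: "open S" "S \<subseteq> {w. poly Q w \<noteq> 0}"
  show "open ((\<lambda>w. poly P w / poly Q w) ` S)"
  proof (rule open_mapping_thm2[OF hol op S])
    fix X :: "complex set" assume X: "open X" "X \<subseteq> {w. poly Q w \<noteq> 0}" "X \<noteq> {}"
    then obtain x e where ball: "e > 0" "ball x e \<subseteq> X" by (meson ex_in_conv open_contains_ball)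
    show "\<not> (\<lambda>w. poly P w / poly Q w) constant_on X"
    proof
      assume "(\<lambda>w. poly P w / poly Q w) constant_on X"
      then obtain c where "\<And>w. w \<in> X \<Longrightarrow> poly P w / poly Q w = c" unfolding constant_on_def by blast
      then have "ball x e \<subseteq> {w. poly (P - smult c Q) w = 0}" using ball(2) X(2) by (force simp: field_simps)
      moreover have "finite {w. poly (P - smult c Q) w = 0}"
        using not_constant_multiple by (intro poly_roots_finite) simp
      ultimately have "finite (ball x e)" by (rule finite_subset)
      then show False using uncountable_ball[OF ball(1)] countable_finite by blast
    qed
  qed
qed (use assms in simp)

lemma julia_invariant:
  assumes "f (Some z) = Some w"
  shows "w \<in> J \<longleftrightarrow> z \<in> J"
proof -
  have Qz: "poly Q z \<noteq> 0" and w: "w = poly P z / poly Q z"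
    using assms by (auto simp: f_Some split: if_splits)
  have "open {w. poly Q w \<noteq> 0}" by (intro open_Collect_neq continuous_intros)
  then show ?thesis
    unfolding w using Qz filtermap_nhds_quotient
    by (intro finite_julia_image_iff[OF iterates_continuous, of "{w. poly Q w \<noteq> 0}"]) (auto simp: f_Some)
qed

text \<open>The functions \<open>1 / (f\<^sup>k - w)\<close> are uniformly bounded, so Cauchy's estimate makes them uniformly Lipschitz.\<close>

lemma iterates_lipschitz_if_omitting:
  assumes \<epsilon>: "\<epsilon> > 0"
    and omit: "\<And>u k x. u \<in> ball z r \<Longrightarrow> (f ^^ k) (Some u) = Some x \<Longrightarrow> \<epsilon> \<le> dist x w"
    and uv: "u \<in> ball z (r / 2)" "v \<in> ball z (r / 2)"
  shows "chordal ((f ^^ k) (Some u)) ((f ^^ k) (Some v)) \<le> 2 * (1 + cmod w)^2 * (2 * (1 / \<epsilon>) / r) * dist u v"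
proof -
  obtain a b where hol: "a holomorphic_on UNIV" "b holomorphic_on UNIV"
    and ab: "\<And>z. a z \<noteq> 0 \<or> b z \<noteq> 0" "\<And>z. (f ^^ k) (Some z) = quot_point (a z) (b z)"
    using iterate_quot_point by blast
  define F where "F = (\<lambda>x. b x / (a x - w * b x))"
  have far: "a x - w * b x \<noteq> 0 \<and> cmod (F x) \<le> 1 / \<epsilon>" if x: "x \<in> ball z r" for x
  proof (cases "b x = 0")
    case True
    then show ?thesis using ab(1)[of x] \<epsilon> by (simp add: F_def)
  next
    case False
    have "\<epsilon> \<le> cmod (a x / b x - w)"
      unfolding dist_norm[symmetric] using omit[OF x, of k] ab(2)[of x] False by (simp add: quot_point_def)
    moreover from this have "a x / b x - w \<noteq> 0" using \<epsilon> by auto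
    moreover have "F x = 1 / (a x / b x - w)" using False by (simp add: F_def field_simps)
    moreover have "a x - w * b x = b x * (a x / b x - w)" using False by (simp add: field_simps)
    ultimately show ?thesis using \<epsilon> False by (simp add: norm_divide frac_le)
  qed
  have "F holomorphic_on ball z r" unfolding F_def using far
    by (intro holomorphic_intros holomorphic_on_subset[OF hol(1)] holomorphic_on_subset[OF hol(2)]) auto
  then have lipschitz: "cmod (F u - F v) \<le> 2 * (1 / \<epsilon>) / r * dist u v"
    unfolding dist_norm using far uv by (intro bounded_holomorphic_lipschitz[of F z r]) auto
  have "ball z (r / 2) \<subseteq> ball z r"
  proof (cases "r \<ge> 0")
    case False
    then show ?thesis using uv(1) by (simp add: dist_not_less_zero) (smt (verit) zero_le_dist)
  qed (intro subset_ball, simp)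
  then have "chordal ((f ^^ k) (Some u)) ((f ^^ k) (Some v)) \<le> 2 * (1 + cmod w)^2 * cmod (F u - F v)"
    unfolding ab(2) F_def using uv far by (intro chordal_quot_point_le_inversion ab(1)) auto
  also have "\<dots> \<le> 2 * (1 + cmod w)^2 * (2 * (1 / \<epsilon>) / r * dist u v)" using lipschitz by (intro mult_left_mono) auto
  finally show ?thesis by (simp only: mult.assoc)
qed

lemma julia_orbits_dense:
  assumes z: "z \<in> J" and r: "r > 0" and \<epsilon>: "\<epsilon> > 0"
  shows "\<exists>u k x. dist u z < r \<and> (f ^^ k) (Some u) = Some x \<and> dist x w < \<epsilon>"
proof (rule ccontr)
  define C where "C = 2 * (1 + cmod w)^2 * (2 * (1 / \<epsilon>) / r)"
  have C: "C > 0" using r \<epsilon> unfolding C_def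
    by (intro mult_pos_pos divide_pos_pos zero_less_power) (auto simp: add_pos_nonneg)
  assume "\<not> ?thesis"
  then have omit: "\<epsilon> \<le> dist x w" if "u \<in> ball z r" "(f ^^ k) (Some u) = Some x" for u k x
    using that by (fastforce simp: dist_commute[of z] not_less)
  have "equicont_at f v" if v: "v \<in> ball z (r / 2)" for v
    unfolding equicont_at_def
  proof (intro allI impI)
    fix \<eta> :: real assume \<eta>: "\<eta> > 0"
    then have "\<forall>\<^sub>F u in nhds v. u \<in> ball v (\<eta> / C)" using C by (intro eventually_nhds_in_open) auto
    moreover have "\<forall>\<^sub>F u in nhds v. u \<in> ball z (r / 2)" using v by (intro eventually_nhds_in_open) auto
    ultimately show "\<forall>\<^sub>F u in nhds v. \<forall>k. chordal ((f ^^ k) (Some u)) ((f ^^ k) (Some v)) < \<eta>"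
    proof eventually_elim
      case (elim u)
      have "C * dist u v < \<eta>" using elim(1) C by (simp add: less_divide_eq dist_commute mult.commute)
      moreover have "chordal ((f ^^ k) (Some u)) ((f ^^ k) (Some v)) \<le> C * dist u v" for k
        unfolding C_def using \<epsilon> omit elim(2) v by (rule iterates_lipschitz_if_omitting)
      ultimately show ?case by (blast intro: le_less_trans)
    qed
  qed
  moreover have "\<forall>\<^sub>F v in nhds z. v \<in> ball z (r / 2)" using r by (intro eventually_nhds_in_open) auto
  ultimately have "\<forall>\<^sub>F v in nhds z. equicont_at f v" by (rule eventually_mono[rotated])
  then show False using z not_finite_julia_iff[OF iterates_continuous] by blast
qed

lemma julia_forward_orbit:
  assumes "f None = None" "u \<in> J" "(f ^^ k) (Some u) = Some x"
  shows "x \<in> J"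
  using assms(3)
proof (induction k arbitrary: x)
  case (Suc k)
  then obtain v where "(f ^^ k) (Some u) = Some v"
    using assms(1) by (cases "(f ^^ k) (Some u)") auto
  then show ?case using Suc julia_invariant[of v x] by simp
qed (use assms(2) in simp)

lemma julia_empty_interior:
  assumes inf: "f None = None" and x: "x \<notin> J"
  shows "interior J = {}"
proof (rule ccontr)
  assume "interior J \<noteq> {}"
  then obtain z r where z: "r > 0" "ball z r \<subseteq> J" by (metis ex_in_conv mem_interior)
  obtain \<epsilon> where \<epsilon>: "\<epsilon> > 0" "ball x \<epsilon> \<subseteq> - J"
    using closed_finite_julia[OF iterates_continuous] x by (metis ComplI closed_def open_contains_ball)
  have "z \<in> J" using z by auto
  then obtain u k y where "dist u z < r" "(f ^^ k) (Some u) = Some y" "dist y x < \<epsilon>"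
    using julia_orbits_dense[OF _ z(1) \<epsilon>(1)] by blast
  then show False using julia_forward_orbit[OF inf, of u k y] z \<epsilon> by (auto simp: dist_commute subset_iff)
qed

lemma large_values_near_pole:
  assumes pole: "f (Some z) = None" and lim: "filterlim y at_infinity sequentially"
    and near: "\<forall>\<^sub>F w in nhds z. S w"
  shows "\<exists>j w. S w \<and> f (Some w) = Some (y j)"
proof -
  have "poly Q z = 0" using pole by (simp add: f_Some split: if_splits)
  then have open_at: "filtermap (\<lambda>w. poly Q w / poly P w) (nhds z) = nhds 0"
    using rational_map.filtermap_nhds_quotient[OF rational_map_swap, of z] no_common_zero[of z] by simp
  have "\<forall>\<^sub>F v in nhds 0. \<exists>w. S w \<and> v = poly Q w / poly P w"
    unfolding open_at[symmetric] eventually_filtermap using near by (rule eventually_mono) blast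
  moreover have "(\<lambda>j. inverse (y j)) \<longlonglongrightarrow> 0" by (rule filterlim_compose[OF tendsto_inverse_0 lim])
  ultimately have "\<forall>\<^sub>F j in sequentially. \<exists>w. S w \<and> inverse (y j) = poly Q w / poly P w"
    by (rule eventually_compose_filterlim)
  moreover have "\<forall>\<^sub>F j in sequentially. y j \<noteq> 0" using filterlim_at_infinity_imp_eventually_ne[OF lim] .
  ultimately have "\<forall>\<^sub>F j in sequentially. \<exists>w. S w \<and> f (Some w) = Some (y j)"
  proof eventually_elim
    case (elim j)
    then obtain w where w: "S w" and y: "inverse (y j) = poly Q w / poly P w" by blast
    have "y j = poly P w / poly Q w" using arg_cong[OF y, of inverse] by simp
    then show ?case using w elim(2) by (intro exI[of _ w]) (auto simp: f_Some)
  qed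
  then show ?thesis unfolding eventually_sequentially by blast
qed

lemma pole_in_julia:
  assumes inf: "f None = None" and pole: "f (Some z) = None"
    and orbit: "\<And>k. (f ^^ k) (Some (y k)) = Some y0" and lim: "filterlim y at_infinity sequentially"
  shows "z \<in> J"
proof (rule ccontr)
  assume "z \<notin> J"
  then have "equicont_at f z" by (rule equicont_at_if_not_finite_julia[OF iterates_continuous])
  moreover define \<epsilon> where "\<epsilon> = chordal None (Some y0)"
  have "\<epsilon> > 0" unfolding \<epsilon>_def using chordal_None_ge[of y0]
    by (rule less_le_trans[rotated]) (simp add: add_pos_nonneg)
  ultimately have near: "\<forall>\<^sub>F w in nhds z. \<forall>k. chordal ((f ^^ k) (Some w)) ((f ^^ k) (Some z)) < \<epsilon>"
    unfolding equicont_at_def by blast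
  obtain j w where w: "\<And>k. chordal ((f ^^ k) (Some w)) ((f ^^ k) (Some z)) < \<epsilon>" "f (Some w) = Some (y j)"
    using large_values_near_pole[OF pole lim near] by blast
  have "(f ^^ k) None = None" for k by (induction k) (simp_all add: inf)
  then have "(f ^^ Suc j) (Some z) = None" "(f ^^ Suc j) (Some w) = Some y0"
    using pole orbit[of j] w(2) by (simp_all add: funpow_Suc_right del: funpow.simps)
  then show False using w(1)[of "Suc j"] by (simp add: \<epsilon>_def chordal_commute)
qed

end

section \<open>Polynomials that escape to infinity\<close>

lemma poly_sphere_iterate: "(poly_sphere p ^^ k) (Some z) = Some ((poly p ^^ k) z)"
proof (induction k)
  case (Suc k)
  have "poly_sphere p (Some w) = Some (poly p w)" for w by (simp add: poly_sphere_def rat_sphere_def)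
  then show ?case using Suc by simp
qed simp

locale escaping_poly =
  fixes p :: "complex poly" and R :: real
  assumes R: "R > 0" and expands: "cmod z > R \<Longrightarrow> cmod (poly p z) \<ge> 2 * cmod z"
begin

lemma degree_pos: "degree p > 0"
proof (rule ccontr)
  assume "\<not> degree p > 0"
  then obtain c where p: "p = [:c:]" using degree_eq_zeroE by blast
  define t where "t = max (R + 1) (cmod c)"
  have t: "t > R" "t > 0" "t \<ge> cmod c" using R by (auto simp: t_def)
  then show False using expands[of "of_real t"] by (simp add: p)
qed

sublocale rational_map p 1
  rewrites "rat_sphere p 1 = poly_sphere p"
  by unfold_locales (use degree_pos in \<open>simp_all add: poly_sphere_def\<close>)

abbreviation "julia_poly \<equiv> finite_julia (poly_sphere p)"

lemma julia_poly_invariant: "poly p z \<in> julia_poly \<longleftrightarrow> z \<in> julia_poly"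
  using julia_invariant[of z "poly p z"] poly_sphere_iterate[of 1 p z] by simp

lemma iterate_expands:
  assumes "cmod z > R"
  shows "cmod ((poly p ^^ k) z) \<ge> 2 ^ k * cmod z"
proof (induction k)
  case (Suc k)
  have "1 * cmod z \<le> 2 ^ k * cmod z" by (intro mult_right_mono) auto
  then have "cmod ((poly p ^^ k) z) > R" using Suc assms by simp
  then show ?case using expands[of "(poly p ^^ k) z"] Suc by simp
qed simp

lemma julia_poly_bounded:
  assumes "z \<in> julia_poly"
  shows "cmod z \<le> R"
proof (rule ccontr)
  assume z: "\<not> cmod z \<le> R"
  have "z \<notin> julia_poly"
  proof (rule not_finite_julia_if_uniform_limit[OF iterates_continuous, of "{w. cmod w > R}" _ None])
    show "open {w. cmod w > R}" by (intro open_Collect_less continuous_intros)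
    fix \<epsilon> :: real assume \<epsilon>: "\<epsilon> > 0"
    have "(\<lambda>k. 2 / (R * \<epsilon>) * (1 / 2) ^ k) \<longlonglongrightarrow> 2 / (R * \<epsilon>) * 0" by (intro tendsto_intros LIMSEQ_realpow_zero) auto
    then have "(\<lambda>k. 2 / (R * \<epsilon>) * (1 / 2) ^ k) \<longlonglongrightarrow> 0" by simp
    then have "\<forall>\<^sub>F k in sequentially. 2 / (R * \<epsilon>) * (1 / 2) ^ k < 1" by (rule order_tendstoD) simp
    then show "\<forall>\<^sub>F k in sequentially. \<forall>w\<in>{w. cmod w > R}. chordal ((poly_sphere p ^^ k) (Some w)) None < \<epsilon>"
    proof eventually_elim
      case (elim k)
      show ?case
      proof
        fix w assume "w \<in> {w. cmod w > R}"
        then have w: "cmod w > R" by simp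
        have "2 / \<epsilon> < 2 ^ k * R" using elim R \<epsilon> by (simp add: power_one_over field_simps)
        also have "\<dots> \<le> 2 ^ k * cmod w" using w by simp
        also have "\<dots> \<le> cmod ((poly p ^^ k) w)" by (rule iterate_expands[OF w])
        finally have large: "2 / \<epsilon> < cmod ((poly p ^^ k) w)" .
        moreover have "2 / \<epsilon> > 0" using \<epsilon> by simp
        ultimately have pos: "0 < cmod ((poly p ^^ k) w)" by linarith
        then have "2 / cmod ((poly p ^^ k) w) < \<epsilon>" using large \<epsilon> by (simp add: field_simps)
        then show "chordal ((poly_sphere p ^^ k) (Some w)) None < \<epsilon>"
          using chordal_None_le[OF pos] by (simp add: poly_sphere_iterate chordal_commute)
      qed
    qed
  qed (use z in auto)
  then show False using assms by blast
qed

lemma compact_julia_poly: "compact julia_poly"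
  using closed_finite_julia[OF iterates_continuous] julia_poly_bounded
  by (auto simp: compact_eq_bounded_closed bounded_iff)

definition filled_julia :: "complex set" where
  "filled_julia = {z. \<forall>k. cmod ((poly p ^^ k) z) \<le> R}"

lemma closed_filled_julia: "closed filled_julia"
proof -
  have "continuous_on UNIV (poly p ^^ k)" for k
    by (induction k) (auto intro!: continuous_intros continuous_on_compose2[of UNIV "poly p" UNIV])
  then show ?thesis unfolding filled_julia_def
    by (intro closed_Collect_all closed_Collect_le continuous_intros)
qed

lemma filled_julia_nonempty: "filled_julia \<noteq> {}"
proof -
  have "degree (p - [:0, 1:]) \<noteq> 0"
  proof
    assume "degree (p - [:0, 1:]) = 0"
    then obtain c where "p - [:0, 1:] = [:c:]" using degree_eq_zeroE by blast
    then have p: "p = [:0, 1:] + [:c:]" by (simp add: algebra_simps)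
    define t where "t = R + cmod c + 1"
    have t: "t > R" "t > 0" "t > cmod c" unfolding t_def using R norm_ge_zero[of c] by linarith+
    then have "2 * t \<le> cmod (of_real t + c)" using expands[of "of_real t"] by (simp add: p add.commute)
    also have "\<dots> \<le> t + cmod c" using norm_triangle_ineq[of "of_real t" c] t by simp
    finally show False using t by simp
  qed
  then obtain z where "poly (p - [:0, 1:]) z = 0" using alg_closed_imp_poly_has_root by blast
  then have fixpoint: "poly p z = z" by simp
  then have "(poly p ^^ k) z = z" for k by (induction k) auto
  moreover have "cmod z \<le> R" using expands[of z] fixpoint R by (cases "cmod z > R") auto
  ultimately show ?thesis by (auto simp: filled_julia_def intro!: exI[of _ z])
qed

lemma frontier_filled_julia_subset: "frontier filled_julia \<subseteq> julia_poly"
proof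
  fix z assume z: "z \<in> frontier filled_julia"
  then have bounded: "cmod ((poly p ^^ k) z) \<le> R" for k
    using closed_filled_julia by (auto simp: frontier_def filled_julia_def)
  show "z \<in> julia_poly"
  proof (rule ccontr)
    assume "z \<notin> julia_poly"
    then have "equicont_at (poly_sphere p) z" by (rule equicont_at_if_not_finite_julia[OF iterates_continuous])
    moreover have "1 / (1 + R) > 0" using R by simp
    ultimately obtain \<delta> where \<delta>: "\<delta> > 0"
      "\<And>w k. dist w z < \<delta> \<Longrightarrow> chordal (Some ((poly p ^^ k) w)) (Some ((poly p ^^ k) z)) < 1 / (1 + R)"
      unfolding equicont_at_def eventually_nhds_metric poly_sphere_iterate by metis
    obtain w where w: "dist w z < \<delta>" "w \<notin> filled_julia"
      using z \<delta>(1) unfolding frontier_straddle by (metis dist_commute)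
    then obtain k where k: "cmod ((poly p ^^ k) w) > R" by (auto simp: filled_julia_def not_le)
    obtain j where j: "2 * (1 + R) / R < 2 ^ j" using real_arch_pow[of 2 "2 * (1 + R) / R"] by auto
    define u v where "u = (poly p ^^ (j + k)) w" and "v = (poly p ^^ (j + k)) z"
    have "2 * (1 + R) < 2 ^ j * R" using j R by (simp only: pos_divide_less_eq)
    also have "\<dots> \<le> 2 ^ j * cmod ((poly p ^^ k) w)" using k by simp
    also have "\<dots> \<le> cmod u" using iterate_expands[OF k, of j] by (simp add: u_def funpow_add)
    finally have u: "2 * (1 + R) < cmod u" .
    moreover have "2 * (1 + R) > 0" using R by simp
    ultimately have u_pos: "cmod u > 0" by (rule less_trans[rotated])
    have "chordal None (Some u) \<le> 2 / cmod u" by (rule chordal_None_le[OF u_pos])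
    also have "\<dots> \<le> 1 / (1 + R)" using u u_pos R by (simp add: field_simps)
    finally have "chordal None (Some u) \<le> 1 / (1 + R)" .
    moreover have "chordal (Some u) (Some v) < 1 / (1 + R)" unfolding u_def v_def by (rule \<delta>(2)[OF w(1)])
    moreover have "2 / (1 + R) \<le> 2 / (1 + cmod v)"
      using bounded[of "j + k"] R by (intro divide_left_mono) (auto simp: v_def add_pos_nonneg intro!: mult_pos_pos)
    ultimately show False
      using chordal_None_ge[of v] chordal_triangle[of None "Some v" "Some u"] by simp
  qed
qed

lemma julia_poly_nonempty: "julia_poly \<noteq> {}"
proof -
  have "of_real (R + 1) \<notin> filled_julia" using R by (auto simp: filled_julia_def intro!: exI[of _ 0])
  then have "frontier filled_julia \<noteq> {}" using filled_julia_nonempty by (auto simp: frontier_eq_empty)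
  then show ?thesis using frontier_filled_julia_subset by auto
qed

end

section \<open>Power sums over the fibres of a polynomial\<close>

lemma fps_deriv_prod_linear:
  fixes A :: "'a :: field multiset"
  shows "fps_deriv (\<Prod>x\<in>#A. 1 - fps_const x * fps_X) =
    - Abs_fps (\<lambda>k. \<Sum>x\<in>#A. x ^ Suc k) * (\<Prod>x\<in>#A. 1 - fps_const x * fps_X)"
proof (induction A)
  case (add x A)
  define E where "E = Abs_fps (\<lambda>k. x ^ Suc k)"
  define T where "T = Abs_fps (\<lambda>k. \<Sum>x\<in>#A. x ^ Suc k)"
  define R where "R = (\<Prod>x\<in>#A. 1 - fps_const x * fps_X)"
  have "E * (1 - fps_const x * fps_X) = fps_const x"
  proof (rule fps_ext)
    fix k show "(E * (1 - fps_const x * fps_X)) $ k = fps_const x $ k"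
      by (cases k) (auto simp: E_def right_diff_distrib fps_mult_right_const_nth mult.assoc[symmetric])
  qed
  then have "fps_deriv (1 - fps_const x * fps_X) = - (E * (1 - fps_const x * fps_X))" by simp
  moreover have "fps_deriv R = - T * R" using add unfolding R_def T_def .
  ultimately have "fps_deriv ((1 - fps_const x * fps_X) * R) = - (E + T) * ((1 - fps_const x * fps_X) * R)"
    unfolding fps_deriv_mult by (simp only:) (simp add: algebra_simps)
  moreover have "Abs_fps (\<lambda>k. \<Sum>y\<in>#add_mset x A. y ^ Suc k) = E + T" by (rule fps_ext) (simp add: E_def T_def)
  ultimately show ?case by (simp add: R_def)
qed (simp add: fps_eq_iff)

lemma newton_identity:
  fixes A :: "'a :: field multiset"
  defines "R \<equiv> \<Prod>x\<in>#A. 1 - fps_const x * fps_X"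
  shows "(\<Sum>x\<in>#A. x ^ Suc k) = - of_nat (Suc k) * R $ Suc k - (\<Sum>i<k. (\<Sum>x\<in>#A. x ^ Suc i) * R $ (k - i))"
proof -
  have R_nth_0: "R $ 0 = 1" unfolding R_def by (induction A) auto
  have "of_nat (Suc k) * R $ Suc k = fps_deriv R $ k" by simp
  also have "\<dots> = - (Abs_fps (\<lambda>k. \<Sum>x\<in>#A. x ^ Suc k) * R) $ k" unfolding R_def fps_deriv_prod_linear by simp
  also have "\<dots> = - (\<Sum>i<Suc k. (\<Sum>x\<in>#A. x ^ Suc i) * R $ (k - i))"
    by (simp add: fps_mult_nth atLeast0AtMost lessThan_Suc_atMost)
  finally show ?thesis by (simp add: R_nth_0 del: of_nat_Suc power_Suc)
qed

lemma fps_of_reflect_prod_linear: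
  fixes A :: "'a :: field multiset"
  shows "fps_of_poly (reflect_poly (\<Prod>x\<in>#A. [:-x, 1:])) = (\<Prod>x\<in>#A. 1 - fps_const x * fps_X)"
proof (induction A)
  case (add x A)
  have "reflect_poly [:-x, 1:] = [:1, -x:]" by (simp add: reflect_poly_pCons' monom_Suc monom_0)
  moreover have "fps_of_poly [:1, -x:] = 1 - fps_const x * fps_X" by (simp add: fps_of_poly_pCons)
  ultimately show ?case using add
    by (simp only: image_mset_add_mset prod_mset.add_mset reflect_poly_mult fps_of_poly_mult)
qed simp

lemma power_sum_proots_cong:
  fixes p q :: "complex poly"
  assumes monic: "lead_coeff p = 1" "lead_coeff q = 1" and degree: "degree p = degree q"
    and coeffs: "\<And>i. degree p \<le> i + k \<Longrightarrow> coeff p i = coeff q i"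
  shows "(\<Sum>x\<in>#proots p. x ^ k) = (\<Sum>x\<in>#proots q. x ^ k)"
proof (cases k)
  case 0
  then show ?thesis by (simp add: size_proots_complex degree)
next
  case (Suc l)
  define R where "R = (\<lambda>p :: complex poly. \<Prod>x\<in>#proots p. 1 - fps_const x * fps_X)"
  have reflect: "R r = fps_of_poly (reflect_poly r)" if "lead_coeff r = 1" for r
    using complex_poly_decompose_multiset[of r] that unfolding R_def
    by (simp flip: fps_of_reflect_prod_linear)
  have R_eq: "R p $ i = R q $ i" if "i \<le> k" for i
    unfolding reflect[OF monic(1)] reflect[OF monic(2)] using that coeffs[of "degree p - i"]
    by (simp add: coeff_reflect_poly degree)
  have "(\<Sum>x\<in>#proots p. x ^ Suc j) = (\<Sum>x\<in>#proots q. x ^ Suc j)" if "j \<le> l" for j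
    using that
  proof (induction j rule: less_induct)
    case (less j)
    have "(\<Sum>i<j. (\<Sum>x\<in>#proots p. x ^ Suc i) * R p $ (j - i)) = (\<Sum>i<j. (\<Sum>x\<in>#proots q. x ^ Suc i) * R q $ (j - i))"
      using less Suc R_eq by (intro sum.cong refl arg_cong2[of _ _ _ _ "(*)"]) auto
    moreover have "R p $ Suc j = R q $ Suc j" using less.prems Suc by (intro R_eq) simp
    moreover have "(\<Sum>x\<in>#proots r. x ^ Suc j) =
        - of_nat (Suc j) * R r $ Suc j - (\<Sum>i<j. (\<Sum>x\<in>#proots r. x ^ Suc i) * R r $ (j - i))" for r
      unfolding R_def by (rule newton_identity)
    ultimately show ?case by simp
  qed
  then show ?thesis using Suc by simp
qed

definition fibre :: "complex poly \<Rightarrow> complex \<Rightarrow> complex multiset" where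
  "fibre p w = proots (p - [:w:])"

lemma degree_diff_const: "degree (p - [:w:]) = degree p" for p :: "'a :: ab_group_add poly"
proof (cases "degree p = 0")
  case True
  then show ?thesis by (auto elim!: degree_eq_zeroE)
next
  case False
  then show ?thesis using degree_add_eq_left[of "- [:w:]" p] unfolding add_uminus_conv_diff by simp
qed

lemma
  assumes "degree p > 0"
  shows set_fibre: "set_mset (fibre p w) = {x. poly p x = w}"
    and size_fibre: "size (fibre p w) = degree p"
    and lead_coeff_diff_const: "lead_coeff (p - [:w:]) = lead_coeff p"
proof -
  have "degree (p - [:w:]) > 0" using assms by (simp add: degree_diff_const)
  then have "p - [:w:] \<noteq> 0" by auto
  then show "set_mset (fibre p w) = {x. poly p x = w}" by (simp add: fibre_def)
  show "size (fibre p w) = degree p" by (simp add: fibre_def size_proots_complex degree_diff_const)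
  show "lead_coeff (p - [:w:]) = lead_coeff p" using assms by (simp add: degree_diff_const coeff_pCons split: nat.split)
qed

lemma power_sum_fibre_const:
  assumes monic: "lead_coeff p = 1" and k: "k < degree p"
  shows "(\<Sum>x\<in>#fibre p w. x ^ k) = (\<Sum>x\<in>#fibre p 0. x ^ k)"
proof -
  have deg: "degree p > 0" using k by simp
  show ?thesis unfolding fibre_def using lead_coeff_diff_const[OF deg] monic k
    by (intro power_sum_proots_cong) (auto simp: degree_diff_const coeff_pCons split: nat.split)
qed

lemma norm_sum_mset_le:
  fixes g :: "'a \<Rightarrow> 'b :: real_normed_vector" and r :: real
  assumes "\<And>x. x \<in># A \<Longrightarrow> norm (g x) \<le> r"
  shows "norm (\<Sum>x\<in>#A. g x) \<le> size A * r"
  using assms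
proof (induction A)
  case (add x A)
  have "norm (g x + (\<Sum>x\<in>#A. g x)) \<le> r + size A * r"
    using add by (intro order_trans[OF norm_triangle_ineq] add_mono) auto
  then show ?case by (simp add: algebra_simps)
qed simp

section \<open>Sets with a rotational symmetry\<close>

lemma nontrivial_root_of_unity:
  assumes "n \<ge> 2"
  obtains \<omega> :: complex where "\<omega> ^ n = 1" "\<omega> \<noteq> 1"
proof -
  have "card {z :: complex. z ^ n = 1} = n" using assms by (intro card_roots_unity_eq) simp
  then have "{z :: complex. z ^ n = 1} \<noteq> {1}" using assms by auto
  then show ?thesis using that power_one by blast
qed

lemma norm_add_complex_square: "(cmod (x + y))^2 = (cmod x)^2 + (cmod y)^2 + 2 * Re (x * cnj y)"
  by (simp add: cmod_power2) (simp add: power2_eq_square algebra_simps)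

text \<open>Averaging \<open>|\<omega>\<^sup>j w + b|\<^sup>2\<close> over \<open>j\<close> shows that the smallest enclosing disc is centred at 0.\<close>

lemma rotation_invariant_centre:
  fixes S :: "complex set"
  assumes \<omega>: "\<omega> ^ n = 1" "\<omega> \<noteq> 1" and n: "n > 0"
    and inv: "\<And>z. z \<in> S \<Longrightarrow> \<omega> * z \<in> S" and w: "w \<in> S"
    and b: "\<And>z. z \<in> S \<Longrightarrow> cmod (z + b) \<le> cmod w"
  shows "b = 0"
proof -
  have orbit: "\<omega> ^ j * w \<in> S" for j by (induction j) (auto simp: w mult.assoc intro: inv)
  have sum_zero: "(\<Sum>j<n. \<omega> ^ j) = 0" using \<omega> by (simp add: sum_gp_strict)
  have "(\<Sum>j<n. (cmod (\<omega> ^ j * w + b))^2) = (\<Sum>j<n. (cmod w)^2 + (cmod b)^2 + 2 * Re (\<omega> ^ j * w * cnj b))"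
    unfolding norm_add_complex_square using norm_root_of_unity[OF \<omega>(1) n] by (simp add: norm_mult norm_power)
  also have "\<dots> = n * ((cmod w)^2 + (cmod b)^2) + 2 * Re ((\<Sum>j<n. \<omega> ^ j) * w * cnj b)"
    by (simp only: sum.distrib sum_distrib_right sum_distrib_left Re_sum) (simp add: distrib_left)
  finally have "(\<Sum>j<n. (cmod (\<omega> ^ j * w + b))^2) = n * ((cmod w)^2 + (cmod b)^2)" by (simp add: sum_zero)
  moreover have "(\<Sum>j<n. (cmod (\<omega> ^ j * w + b))^2) \<le> (\<Sum>j<n. (cmod w)^2)"
    using b[OF orbit] by (intro sum_mono power_mono) auto
  ultimately have "n * ((cmod w)^2 + (cmod b)^2) \<le> n * (cmod w)^2" by simp
  then have "(cmod b)^2 \<le> 0" using n by (simp add: mult_le_cancel_left)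
  then show ?thesis by simp
qed

lemma inward_perturbations_sum_zero:
  fixes A :: "'a multiset" and g :: "'a \<Rightarrow> complex"
  assumes inward: "\<And>x. x \<in># A \<Longrightarrow> cmod (w + g x) \<le> cmod w" and sum: "(\<Sum>x\<in>#A. g x) = 0" and y: "y \<in># A"
  shows "g y = 0"
proof -
  have small: "(cmod (g x))^2 \<le> - 2 * Re (w * cnj (g x))" if "x \<in># A" for x
    using power_mono[OF inward[OF that] norm_ge_zero, of 2] unfolding norm_add_complex_square by simp
  have "(\<Sum>x\<in>#A. (cmod (g x))^2) \<le> (\<Sum>x\<in>#A. - 2 * Re (w * cnj (g x)))" by (intro sum_mset_mono small)
  also have "\<dots> = - 2 * Re (w * cnj (\<Sum>x\<in>#A. g x))" by (induction A) (auto simp: algebra_simps)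
  finally have "(\<Sum>x\<in>#A. (cmod (g x))^2) \<le> 0" by (simp add: sum)
  moreover have "(\<Sum>x\<in>#B. (cmod (g x))^2) \<ge> 0" for B by (induction B) auto
  moreover obtain B where "A = add_mset y B" using multi_member_split[OF y] by blast
  ultimately have "(cmod (g y))^2 + (\<Sum>x\<in>#B. (cmod (g x))^2) \<le> 0" "0 \<le> (\<Sum>x\<in>#B. (cmod (g x))^2)" by simp_all
  then have "(cmod (g y))^2 \<le> 0" by linarith
  then show ?thesis by simp
qed

section \<open>The symmetries of \<open>z\<^sup>m (z\<^sup>n - 1)\<close>\<close>

lemma poly_pmn: "poly (pmn m n) z = z ^ m * (z ^ n - 1)"
  by (simp add: pmn_def poly_monom)

lemma pmn_eq: "pmn m n = monom 1 (m + n) - monom 1 m"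
  by (simp add: pmn_def right_diff_distrib mult_monom)

lemma
  assumes "n > 0"
  shows degree_pmn: "degree (pmn m n) = m + n" and lead_coeff_pmn: "lead_coeff (pmn m n) = 1"
proof -
  have "coeff (pmn m n) (m + n) = 1" using assms by (simp add: pmn_eq)
  moreover from this show "degree (pmn m n) = m + n"
    by (intro antisym degree_le le_degree) (auto simp: pmn_eq)
  ultimately show "lead_coeff (pmn m n) = 1" by simp
qed

lemma pmn_rotate:
  assumes "a ^ n = 1"
  shows "poly (pmn m n) (a * z) = a ^ m * poly (pmn m n) z"
  using assms by (simp add: poly_pmn power_mult_distrib)

lemma pmn_expands:
  assumes "n \<ge> 2" and z: "cmod z > 3"
  shows "cmod (poly (pmn m n) z) \<ge> 2 * cmod z"
proof -
  have "(cmod z)^2 \<le> cmod z ^ n" using assms by (intro power_increasing) auto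
  also have "\<dots> \<le> cmod (z ^ n - 1) + 1"
    using norm_triangle_ineq[of "z ^ n - 1" 1] by (simp add: norm_power)
  finally have "cmod (z ^ n - 1) \<ge> (cmod z)^2 - 1" by simp
  moreover have "3 * cmod z \<le> (cmod z)^2" unfolding power2_eq_square using z by (intro mult_right_mono) auto
  ultimately have "2 * cmod z \<le> cmod (z ^ n - 1)" using z by simp
  also have "1 \<le> cmod (z ^ m)" using z by (simp add: norm_power)
  then have "cmod (z ^ n - 1) \<le> cmod (z ^ m) * cmod (z ^ n - 1)"
    by (simp add: mult_le_cancel_right1)
  finally show ?thesis by (simp add: poly_pmn norm_mult)
qed

locale pmn_exponents =
  fixes m n :: nat
  assumes n: "n \<ge> 2"
begin

lemma n_pos: "n > 0" using n by simp

sublocale escaping: escaping_poly "pmn m n" 3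
  by unfold_locales (use pmn_expands n in auto)

abbreviation "julia_pmn \<equiv> finite_julia (poly_sphere (pmn m n))"

lemma julia_pmn_rotate:
  assumes "a ^ n = 1"
  shows "a * z \<in> julia_pmn \<longleftrightarrow> z \<in> julia_pmn"
proof (rule finite_julia_rotate_root_of_unity[OF escaping.iterates_continuous n_pos assms])
  fix a :: complex and x assume a: "a ^ n = 1"
  show "poly_sphere (pmn m n) (ext_aff (\<lambda>z. a * z) x) = ext_aff (\<lambda>z. a ^ m * z) (poly_sphere (pmn m n) x)"
    using escaping.degree_pos
    by (cases x) (auto simp: poly_sphere_def rat_sphere_def ext_aff_def pmn_rotate[OF a])
qed

lemma julia_pmn_farthest_point:
  obtains w where "w \<in> julia_pmn" "\<And>z. z \<in> julia_pmn \<Longrightarrow> cmod z \<le> cmod w"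
    "\<And>c. (\<And>z. z \<in> julia_pmn \<Longrightarrow> cmod (z + c) \<le> cmod w) \<Longrightarrow> c = 0"
proof -
  obtain w where w: "w \<in> julia_pmn" "\<And>z. z \<in> julia_pmn \<Longrightarrow> cmod z \<le> cmod w"
    using continuous_attains_sup[of julia_pmn cmod] escaping.compact_julia_poly escaping.julia_poly_nonempty
    by (auto intro: continuous_on_norm_id)
  obtain \<omega> :: complex where \<omega>: "\<omega> ^ n = 1" "\<omega> \<noteq> 1" using nontrivial_root_of_unity[OF n] .
  have "c = 0" if "\<And>z. z \<in> julia_pmn \<Longrightarrow> cmod (z + c) \<le> cmod w" for c
    using julia_pmn_rotate[OF \<omega>(1)] by (intro rotation_invariant_centre[OF \<omega> n_pos _ w(1) that]) auto
  then show ?thesis using that w by blast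
qed

text \<open>Averaging \<open>p(x) + \<gamma> x\<^sup>m\<close> over the fibre of \<open>p\<close> over \<open>w\<close> translates \<open>w\<close> by a constant, which vanishes since
  the smallest disc enclosing the Julia set is centred at 0.\<close>

lemma julia_pmn_perturbation:
  assumes w: "w \<in> julia_pmn" "\<And>z. z \<in> julia_pmn \<Longrightarrow> cmod z \<le> cmod w"
    and centre: "\<And>c. (\<And>z. z \<in> julia_pmn \<Longrightarrow> cmod (z + c) \<le> cmod w) \<Longrightarrow> c = 0"
    and bound: "\<And>z. z \<in> julia_pmn \<Longrightarrow> cmod (poly (pmn m n) z + \<gamma> * z ^ m) \<le> cmod w"
  shows "\<gamma> = 0"
proof -
  let ?p = "pmn m n"
  have deg: "degree ?p = m + n" "degree ?p > 0" and monic: "lead_coeff ?p = 1"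
    using degree_pmn lead_coeff_pmn n_pos by simp_all
  define s where "s = (\<Sum>x\<in>#fibre ?p 0. x ^ m)"
  have power_sum: "(\<Sum>x\<in>#fibre ?p v. x ^ m) = s" for v
    unfolding s_def using deg n_pos by (intro power_sum_fibre_const monic) simp
  have fibre_bound: "cmod (v + \<gamma> * x ^ m) \<le> cmod w" if "v \<in> julia_pmn" "x \<in># fibre ?p v" for v x
    using that bound[of x] escaping.julia_poly_invariant[of x] set_fibre[OF deg(2)] by auto
  have "\<gamma> * s / of_nat (m + n) = 0"
  proof (rule centre)
    fix v assume v: "v \<in> julia_pmn"
    have "(\<Sum>x\<in>#A. v + \<gamma> * x ^ m) = of_nat (size A) * v + \<gamma> * (\<Sum>x\<in>#A. x ^ m)" for A
      by (induction A) (auto simp: algebra_simps)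
    then have "(\<Sum>x\<in>#fibre ?p v. v + \<gamma> * x ^ m) = of_nat (m + n) * (v + \<gamma> * s / of_nat (m + n))"
      using n_pos by (simp add: power_sum size_fibre deg distrib_left del: of_nat_add)
    moreover have "cmod (\<Sum>x\<in>#fibre ?p v. v + \<gamma> * x ^ m) \<le> size (fibre ?p v) * cmod w"
      using fibre_bound[OF v] by (rule norm_sum_mset_le)
    ultimately have "(m + n) * cmod (v + \<gamma> * s / of_nat (m + n)) \<le> (m + n) * cmod w"
      using deg by (simp add: size_fibre norm_mult del: of_nat_add)
    then show "cmod (v + \<gamma> * s / of_nat (m + n)) \<le> cmod w" using n_pos by (simp del: of_nat_add)
  qed
  then have "\<gamma> * s = 0" using n_pos by (simp del: of_nat_add mult_eq_0_iff)
  then have sum_zero: "(\<Sum>x\<in>#fibre ?p w. \<gamma> * x ^ m) = 0" by (simp add: power_sum flip: sum_mset_distrib_left)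
  have "fibre ?p w \<noteq> {#}" using size_fibre[OF deg(2), of w] deg(2) by auto
  then obtain x where x: "x \<in># fibre ?p w" by auto
  have "\<gamma> * x ^ m = 0" using fibre_bound[OF w(1)] sum_zero x by (rule inward_perturbations_sum_zero)
  moreover have "x ^ m \<noteq> 0"
  proof
    assume "x ^ m = 0"
    then have "w = 0" using x set_fibre[OF deg(2), of w] by (auto simp: poly_pmn)
    then have "poly ?p 1 \<in> julia_pmn" using w(1) by (simp add: poly_pmn)
    then show False using escaping.julia_poly_invariant[of 1] w(2)[of 1] \<open>w = 0\<close> by simp
  qed
  ultimately show ?thesis by (metis mult_eq_0_iff)
qed

lemma julia_pmn_rigid:
  assumes a: "cmod a = 1" and sym: "\<And>z. a * z + b \<in> julia_pmn \<longleftrightarrow> z \<in> julia_pmn"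
  shows "b = 0 \<and> a ^ n = 1"
proof -
  obtain w where w: "w \<in> julia_pmn" "\<And>z. z \<in> julia_pmn \<Longrightarrow> cmod z \<le> cmod w"
    and centre: "\<And>c. (\<And>z. z \<in> julia_pmn \<Longrightarrow> cmod (z + c) \<le> cmod w) \<Longrightarrow> c = 0"
    using julia_pmn_farthest_point by blast
  have a_nonzero: "a \<noteq> 0" using a by auto
  have "b / a = 0"
  proof (rule centre)
    fix z assume "z \<in> julia_pmn"
    then have "cmod (a * z + b) \<le> cmod w" using sym w(2) by blast
    moreover have "a * z + b = a * (z + b / a)" using a_nonzero by (simp add: distrib_left)
    ultimately show "cmod (z + b / a) \<le> cmod w" using a by (simp add: norm_mult)
  qed
  then have b: "b = 0" using a_nonzero by simp
  have "1 - inverse (a ^ n) = 0"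
  proof (rule julia_pmn_perturbation[OF w centre])
    fix z assume "z \<in> julia_pmn"
    then have "poly (pmn m n) (a * z) \<in> julia_pmn" using sym[of z] b escaping.julia_poly_invariant by simp
    then have "cmod (poly (pmn m n) (a * z)) \<le> cmod w" by (rule w(2))
    moreover have "poly (pmn m n) (a * z) = a ^ m * a ^ n * (poly (pmn m n) z + (1 - inverse (a ^ n)) * z ^ m)"
      using a_nonzero by (simp add: poly_pmn power_mult_distrib field_simps)
    ultimately show "cmod (poly (pmn m n) z + (1 - inverse (a ^ n)) * z ^ m) \<le> cmod w"
      using a by (simp add: norm_mult norm_power)
  qed
  then show ?thesis using b by simp
qed

theorem sym_group_pmn: "sym_group (julia (poly_sphere (pmn m n))) = rotations n"
  using n_pos julia_pmn_rotate julia_pmn_rigid by (rule sym_group_julia_eq_rotations)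

end

section \<open>Relaxed Newton maps\<close>

locale relaxed_newton_map =
  fixes h :: complex and p :: "complex poly"
  assumes degree_pos: "degree p > 0" and h_nonzero: "h \<noteq> 0" and h_not_degree: "h \<noteq> of_nat (degree p)"
begin

definition "numerator = [:0, 1:] * pderiv p - smult h p"
definition "common = gcd numerator (pderiv p)"
definition "P = numerator div common"
definition "Q = pderiv p div common"

abbreviation "F \<equiv> relaxed_newton h p"

lemma F_eq_rat_sphere: "F = rat_sphere P Q"
  by (simp add: relaxed_newton_def P_def Q_def common_def numerator_def Let_def)

lemma pderiv_nonzero: "pderiv p \<noteq> 0"
  using degree_pos by (simp add: pderiv_eq_0_iff)

lemma common_factor: "numerator = P * common" "pderiv p = Q * common" "common \<noteq> 0"
  using pderiv_nonzero by (simp_all add: P_def Q_def common_def)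

lemma cross_multiplied: "P * pderiv p = Q * numerator"
  unfolding common_factor by (simp add: mult_ac)

lemma degree_numerator: "degree numerator = degree p"
proof (rule antisym)
  have "degree ([:0, 1:] * pderiv p) \<le> degree p"
    using degree_mult_le[of "[:0, 1:]" "pderiv p"] degree_pos by (simp add: degree_pderiv)
  then show "degree numerator \<le> degree p"
    unfolding numerator_def by (intro degree_diff_le) simp_all
  obtain j where "degree p = Suc j" using degree_pos gr0_implies_Suc by blast
  then have "coeff numerator (degree p) = (of_nat (degree p) - h) * lead_coeff p"
    by (simp add: numerator_def coeff_pderiv algebra_simps)
  then show "degree p \<le> degree numerator"
    using h_not_degree degree_pos by (intro le_degree) auto
qed

lemma degree_P: "degree P = Suc (degree Q)"
proof -
  have "P \<noteq> 0" "Q \<noteq> 0" using common_factor degree_numerator degree_pos pderiv_nonzero by auto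
  then have "degree p = degree P + degree common" "degree p - 1 = degree Q + degree common"
    using common_factor degree_numerator by (metis degree_mult_eq degree_pderiv)+
  then show ?thesis using degree_pos by linarith
qed

sublocale rational_map P Q
  rewrites "rat_sphere P Q = F"
proof unfold_locales
  show "coprime P Q" unfolding P_def Q_def common_def using pderiv_nonzero by (intro div_gcd_coprime) simp
qed (simp_all add: degree_P F_eq_rat_sphere)

lemma F_None: "F None = None"
  by (simp add: F_eq_rat_sphere rat_sphere_def degree_P)

lemma poly_cross_multiplied: "poly P z * poly (pderiv p) z = poly Q z * (z * poly (pderiv p) z - h * poly p z)"
  using arg_cong[OF cross_multiplied, of "\<lambda>q. poly q z"] by (simp add: numerator_def)

lemma F_regular:
  assumes "poly (pderiv p) z \<noteq> 0"
  shows "F (Some z) = Some (z - h * poly p z / poly (pderiv p) z)"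
proof -
  have "poly Q z \<noteq> 0" using poly_cross_multiplied[of z] no_common_zero[of z] assms by auto
  then show ?thesis using poly_cross_multiplied[of z] assms by (simp add: f_Some field_simps)
qed

lemma F_critical:
  assumes "poly (pderiv p) z = 0" "poly p z \<noteq> 0"
  shows "F (Some z) = None"
  using poly_cross_multiplied[of z] assms h_nonzero by (simp add: f_Some)

text \<open>This includes the multiple roots, where numerator and denominator have a common zero.\<close>

lemma F_root:
  assumes "poly p z = 0"
  shows "F (Some z) = Some z"
proof -
  define k where "k = order z p - 1"
  have p_nonzero: "p \<noteq> 0" using degree_pos by auto
  then have "order z p = Suc k" using assms order_root[of p z] by (simp add: k_def)
  then obtain r where p: "p = [:-z, 1:] ^ Suc k * r" and "\<not> [:-z, 1:] dvd r"
    using order_decomp[OF p_nonzero, of z] by auto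
  then have rz: "poly r z \<noteq> 0" by (simp add: poly_eq_0_iff_dvd)
  define s where "s = smult (of_nat (Suc k)) r + [:-z, 1:] * pderiv r"
  have sz: "poly s z \<noteq> 0" using rz by (simp add: s_def del: of_nat_Suc)
  have pderiv: "pderiv p = [:-z, 1:] ^ k * s"
    unfolding p pderiv_mult pderiv_power_Suc s_def by (simp add: pderiv_pCons algebra_simps)
  have "[:-z, 1:] ^ k * (P * s) = [:-z, 1:] ^ k * (Q * ([:0, 1:] * s - smult h ([:-z, 1:] * r)))"
    using cross_multiplied unfolding numerator_def pderiv unfolding p by (simp add: algebra_simps)
  then have "P * s = Q * ([:0, 1:] * s - smult h ([:-z, 1:] * r))"
    by (simp only: mult_cancel_left power_eq_0_iff pCons_eq_0_iff) simp
  from arg_cong[OF this, of "\<lambda>q. poly q z"] have "poly P z = z * poly Q z" using sz by simp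
  then show ?thesis using no_common_zero[of z] by (auto simp: f_Some)
qed

end

section \<open>Translations preserving a closed set\<close>

definition translation_stabilizer :: "'a :: ab_group_add set \<Rightarrow> 'a set" where
  "translation_stabilizer S = {c. \<forall>z. z + c \<in> S \<longleftrightarrow> z \<in> S}"

lemma translation_stabilizerD: "c \<in> translation_stabilizer S \<Longrightarrow> z + c \<in> S \<longleftrightarrow> z \<in> S"
  by (simp add: translation_stabilizer_def)

lemma translation_stabilizer_alt: "translation_stabilizer S = {c. \<forall>z\<in>S. z + c \<in> S \<and> z - c \<in> S}"
  unfolding translation_stabilizer_def
proof (rule Collect_cong, rule iffI)
  fix c assume "\<forall>z. z + c \<in> S \<longleftrightarrow> z \<in> S"
  then show "\<forall>z\<in>S. z + c \<in> S \<and> z - c \<in> S" by (metis diff_add_cancel)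
next
  fix c assume "\<forall>z\<in>S. z + c \<in> S \<and> z - c \<in> S"
  then show "\<forall>z. z + c \<in> S \<longleftrightarrow> z \<in> S" by (metis add_diff_cancel)
qed

lemma zero_in_translation_stabilizer: "0 \<in> translation_stabilizer S"
  by (simp add: translation_stabilizer_def)

lemma translation_stabilizer_add:
  "a \<in> translation_stabilizer S \<Longrightarrow> b \<in> translation_stabilizer S \<Longrightarrow> a + b \<in> translation_stabilizer S"
  by (simp add: translation_stabilizer_def flip: add.assoc)

lemma translation_stabilizer_minus: "a \<in> translation_stabilizer S \<Longrightarrow> - a \<in> translation_stabilizer S"
  by (simp add: translation_stabilizer_alt)

lemma translation_stabilizer_of_nat_mult:
  fixes S :: "'a :: ring_1 set"
  shows "c \<in> translation_stabilizer S \<Longrightarrow> of_nat j * c \<in> translation_stabilizer S"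
  by (induction j) (simp_all add: zero_in_translation_stabilizer translation_stabilizer_add distrib_right)

lemma closed_translation_stabilizer:
  fixes S :: "'a :: real_normed_vector set"
  assumes "closed S"
  shows "closed (translation_stabilizer S)"
proof -
  have "closed {c. z + c \<in> S}" "closed {c. z - c \<in> S}" for z
    using assms by (auto intro!: closed_vimage[of S, unfolded vimage_def] continuous_intros)
  then have "closed (\<Inter>z\<in>S. {c. z + c \<in> S} \<inter> {c. z - c \<in> S})" by (intro closed_INT closed_Int ballI)
  moreover have "translation_stabilizer S = (\<Inter>z\<in>S. {c. z + c \<in> S} \<inter> {c. z - c \<in> S})"
    unfolding translation_stabilizer_alt by auto
  ultimately show ?thesis by simp
qed

lemma floor_mult_tendsto:
  assumes "r \<longlonglongrightarrow> 0" "\<And>k. r k > 0"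
  shows "(\<lambda>k. of_int \<lfloor>t / r k\<rfloor> * r k) \<longlonglongrightarrow> (t :: real)"
proof (rule tendsto_sandwich[of "\<lambda>k. t - r k" _ _ "\<lambda>k. t"])
  show "\<forall>\<^sub>F k in sequentially. t - r k \<le> of_int \<lfloor>t / r k\<rfloor> * r k"
  proof (intro always_eventually allI)
    fix k
    have "(t / r k - 1) * r k \<le> of_int \<lfloor>t / r k\<rfloor> * r k"
      using assms(2)[of k] by (intro mult_right_mono) linarith+
    then show "t - r k \<le> of_int \<lfloor>t / r k\<rfloor> * r k" using assms(2)[of k] by (simp add: left_diff_distrib)
  qed
  show "\<forall>\<^sub>F k in sequentially. of_int \<lfloor>t / r k\<rfloor> * r k \<le> t"
    using assms(2) by (intro always_eventually allI) (metis of_int_floor_le pos_le_divide_eq)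
qed (use tendsto_diff[OF tendsto_const assms(1), of t] in auto)

lemma normalised_subsequence:
  fixes u :: "nat \<Rightarrow> 'a :: euclidean_space"
  assumes "\<And>k. u k \<noteq> 0"
  obtains v s where "norm v = 1" "strict_mono (s :: nat \<Rightarrow> nat)" "(\<lambda>k. u (s k) /\<^sub>R norm (u (s k))) \<longlonglongrightarrow> v"
proof -
  have unit: "\<forall>k. u k /\<^sub>R norm (u k) \<in> sphere 0 1" using assms by simp
  have "seq_compact (sphere (0 :: 'a) 1)" by (simp add: compact_imp_seq_compact)
  from seq_compactE[OF this unit] obtain v s where "v \<in> sphere 0 1" "strict_mono (s :: nat \<Rightarrow> nat)"
    "((\<lambda>k. u k /\<^sub>R norm (u k)) \<circ> s) \<longlonglongrightarrow> v" .
  then show ?thesis by (intro that[of v s]) (simp_all add: o_def)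
qed

lemma closed_subgroup_contains_line:
  fixes T :: "'a :: euclidean_space set"
  assumes "closed T" and zero: "0 \<in> T" and add: "\<And>a b. a \<in> T \<Longrightarrow> b \<in> T \<Longrightarrow> a + b \<in> T"
    and minus: "\<And>a. a \<in> T \<Longrightarrow> - a \<in> T"
    and u: "\<And>k. u k \<in> T" "\<And>k. u k \<noteq> 0" "u \<longlonglongrightarrow> 0"
  obtains v where "norm v = 1" "\<And>t. t *\<^sub>R v \<in> T"
proof -
  have nat_multiple: "of_nat j *\<^sub>R a \<in> T" if "a \<in> T" for a and j :: nat
    using that by (induction j) (auto simp: zero add scaleR_add_left)
  have int_multiple: "of_int j *\<^sub>R a \<in> T" if "a \<in> T" for a and j :: int
    using nat_multiple[OF that] minus by (cases j rule: int_cases2) fastforce+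
  obtain v s where v: "norm v = 1" and s: "strict_mono (s :: nat \<Rightarrow> nat)"
    and lim: "(\<lambda>k. u (s k) /\<^sub>R norm (u (s k))) \<longlonglongrightarrow> v"
    using normalised_subsequence[OF u(2)] .
  have norm_lim: "(\<lambda>k. norm (u (s k))) \<longlonglongrightarrow> 0"
    using tendsto_norm[OF LIMSEQ_subseq_LIMSEQ[OF u(3) s]] by (simp add: o_def)
  have "t *\<^sub>R v \<in> T" for t
  proof -
    have "(\<lambda>k. (of_int \<lfloor>t / norm (u (s k))\<rfloor> * norm (u (s k))) *\<^sub>R (u (s k) /\<^sub>R norm (u (s k)))) \<longlonglongrightarrow> t *\<^sub>R v"
      using u(2) by (intro tendsto_scaleR lim floor_mult_tendsto norm_lim) simp
    then have "(\<lambda>k. of_int \<lfloor>t / norm (u (s k))\<rfloor> *\<^sub>R u (s k)) \<longlonglongrightarrow> t *\<^sub>R v"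
      using u(2) by (simp add: mult.assoc)
    then show ?thesis by (rule closed_sequentially[OF \<open>closed T\<close> int_multiple[OF u(1)]])
  qed
  then show ?thesis using that v by blast
qed

section \<open>Maps asymptotic to a linear contraction at infinity\<close>

lemma near_identity_attains:
  fixes f :: "'a :: euclidean_space \<Rightarrow> 'a"
  assumes "r > 0" and cont: "continuous_on (cball y r) f"
    and near: "\<And>x. x \<in> cball y r \<Longrightarrow> dist (f x) x \<le> r"
  obtains x where "x \<in> cball y r" "f x = y"
proof -
  have "continuous_on (cball y r) (\<lambda>x. y - (f x - x))" by (intro continuous_intros cont)
  moreover have "(\<lambda>x. y - (f x - x)) \<in> cball y r \<rightarrow> cball y r" using near by (auto simp: dist_norm)
  ultimately obtain x where "x \<in> cball y r" "y - (f x - x) = x"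
    using brouwer[of "cball y r" "\<lambda>x. y - (f x - x)"] \<open>r > 0\<close> by auto
  then show ?thesis by (intro that[of x]) (auto simp: algebra_simps)
qed

locale asymptotically_linear =
  fixes N :: "complex \<Rightarrow> complex" and \<mu> :: complex and r :: real
  assumes \<mu>: "\<mu> \<noteq> 0" "cmod \<mu> < 1"
    and cont: "continuous_on {z. cmod z \<ge> r} N"
    and asymptotic: "((\<lambda>z. N z - \<mu> * z) \<longlongrightarrow> 0) at_infinity"
begin

lemma far_preimage: "\<forall>\<^sub>F y in at_infinity. \<exists>w. N w = y \<and> dist w (y / \<mu>) \<le> 1 \<and> cmod w \<ge> B"
proof -
  have "\<forall>\<^sub>F z in at_infinity. dist (N z - \<mu> * z) 0 < cmod \<mu>"
    using \<mu> by (intro tendstoD[OF asymptotic]) simp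
  then obtain b where b: "\<And>z. cmod z \<ge> b \<Longrightarrow> cmod (N z - \<mu> * z) < cmod \<mu>"
    unfolding eventually_at_infinity by auto
  define C where "C = Max {B, b, r}"
  have C: "C \<ge> B" "C \<ge> b" "C \<ge> r" by (simp_all add: C_def)
  have "\<exists>w. N w = y \<and> dist w (y / \<mu>) \<le> 1 \<and> cmod w \<ge> B" if y: "cmod y \<ge> cmod \<mu> * (C + 1)" for y
  proof -
    have large: "cmod w \<ge> C" if "w \<in> cball (y / \<mu>) 1" for w
    proof -
      have "C + 1 \<le> cmod (y / \<mu>)" using y \<mu> by (simp add: norm_divide le_divide_eq mult.commute)
      then show ?thesis using that norm_triangle_ineq2[of "y / \<mu>" w] by (simp add: dist_norm)
    qed
    have "continuous_on (cball (y / \<mu>) 1) (\<lambda>w. N w / \<mu>)"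
      using \<mu> large C by (intro continuous_intros continuous_on_subset[OF cont]) fastforce+
    moreover have "dist (N w / \<mu>) w \<le> 1" if "w \<in> cball (y / \<mu>) 1" for w
    proof -
      have "N w / \<mu> - w = (N w - \<mu> * w) / \<mu>" using \<mu> by (simp add: diff_divide_distrib)
      then show ?thesis using b[of w] large[OF that] C \<mu> by (simp add: dist_norm norm_divide)
    qed
    ultimately obtain w where "w \<in> cball (y / \<mu>) 1" "N w / \<mu> = y / \<mu>"
      by (rule near_identity_attains[OF zero_less_one])
    then show ?thesis using large[of w] C \<mu> by (intro exI[of _ w]) (auto simp: dist_commute)
  qed
  then show ?thesis unfolding eventually_at_infinity by blast
qed

lemma inverse_orbit_to_infinity:
  obtains y where "\<And>k. N (y (Suc k)) = y k" "\<And>k. cmod (y k) \<ge> B" "filterlim y at_infinity sequentially"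
proof -
  define q where "q = (1 + 1 / cmod \<mu>) / 2"
  have \<mu>_inv: "1 / cmod \<mu> > 1" using \<mu> by simp
  then have q: "q > 1" by (simp add: q_def)
  obtain b where b: "\<And>y. cmod y \<ge> b \<Longrightarrow> \<exists>w. N w = y \<and> dist w (y / \<mu>) \<le> 1"
    using far_preimage[of 0] unfolding eventually_at_infinity by blast
  define C where "C = Max {B, b, 2 / (1 / cmod \<mu> - 1), 1}"
  have C: "C \<ge> B" "C \<ge> b" "C \<ge> 2 / (1 / cmod \<mu> - 1)" "C \<ge> 1" by (simp_all add: C_def)
  have step: "\<exists>w. cmod w \<ge> C \<and> N w = y \<and> cmod w \<ge> q * cmod y" if y: "cmod y \<ge> C" for y
  proof -
    obtain w where w: "N w = y" "dist w (y / \<mu>) \<le> 1" using b[of y] y C by auto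
    have "cmod y * (1 / cmod \<mu>) \<le> cmod w + 1"
      using w(2) norm_triangle_ineq2[of "y / \<mu>" w] by (simp add: dist_norm norm_divide norm_minus_commute)
    moreover have "2 \<le> cmod y * (1 / cmod \<mu> - 1)"
      using order_trans[OF C(3) y] \<mu>_inv by (simp add: pos_divide_le_eq)
    ultimately have "cmod w \<ge> q * cmod y" by (simp add: q_def algebra_simps add_divide_distrib)
    moreover have "q * cmod y \<ge> 1 * cmod y" using q by (intro mult_right_mono) auto
    ultimately show ?thesis using w(1) y by (intro exI[of _ w]) auto
  qed
  have "cmod (of_real C) \<ge> C" using C by simp
  then obtain y where y: "\<And>k. cmod (y k) \<ge> C" "\<And>k. N (y (Suc k)) = y k \<and> cmod (y (Suc k)) \<ge> q * cmod (y k)"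
    using dependent_nat_choice[of "\<lambda>_ y. cmod y \<ge> C" "\<lambda>_ y w. N w = y \<and> cmod w \<ge> q * cmod y"] step by metis
  have "cmod (y k) \<ge> q ^ k" for k
  proof (induction k)
    case (Suc k)
    then have "q * q ^ k \<le> q * cmod (y k)" using q by (intro mult_left_mono) auto
    then show ?case using y(2)[of k] by simp
  qed (use y(1)[of 0] C in simp)
  moreover have "filterlim (\<lambda>k. norm (q ^ k)) at_top sequentially"
    using filterlim_realpow_sequentially_gt1[of q] q by (simp add: filterlim_at_infinity_conv_norm_at_top)
  ultimately have "filterlim (\<lambda>k. norm (y k)) at_top sequentially"
    using q by (elim filterlim_at_top_mono) (simp add: always_eventually)
  then have "filterlim y at_infinity sequentially" by (simp add: filterlim_at_infinity_conv_norm_at_top)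
  then show ?thesis using that y C(1) by (meson order_trans)
qed

text \<open>Far out \<open>N\<close> conjugates the translation by \<open>c\<close> to one by about \<open>\<mu> c\<close>; translating back by a multiple
  of \<open>c\<close> makes the error arbitrarily small near any given point.\<close>

lemma stabilizer_mult_approx:
  assumes inv: "\<forall>\<^sub>F z in at_infinity. N z \<in> J \<longleftrightarrow> z \<in> J"
    and c: "c \<in> translation_stabilizer J" "c \<noteq> 0" and z: "z \<in> J" and \<epsilon>: "\<epsilon> > 0"
  shows "\<exists>y\<in>J. dist y (z + \<mu> * c) < \<epsilon>"
proof -
  have "\<forall>\<^sub>F x in at_infinity. dist (N x - \<mu> * x) 0 < \<epsilon> / 2 \<and> (N x \<in> J \<longleftrightarrow> x \<in> J)"
    using \<epsilon> by (intro eventually_conj inv tendstoD[OF asymptotic]) simp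
  then obtain b where near: "\<And>x. cmod x \<ge> b \<Longrightarrow> cmod (N x - \<mu> * x) < \<epsilon> / 2"
    and invariant: "\<And>x. cmod x \<ge> b \<Longrightarrow> N x \<in> J \<longleftrightarrow> x \<in> J"
    unfolding eventually_at_infinity by auto
  have "filterlim (\<lambda>j. z + of_nat j * c) at_infinity sequentially"
    unfolding mult.commute[of _ c] using c(2)
    by (intro tendsto_add_filterlim_at_infinity[OF tendsto_const]
        tendsto_mult_filterlim_at_infinity[OF tendsto_const] tendsto_of_nat)
  from eventually_compose_filterlim[OF far_preimage this]
  obtain j w where w: "N w = z + of_nat j * c" "cmod w \<ge> b + cmod c"
    unfolding eventually_sequentially by blast
  have b: "cmod w \<ge> b" "cmod (w + c) \<ge> b"
    using w(2) norm_ge_zero[of c] norm_triangle_ineq4[of "w + c" c] by (simp_all del: norm_ge_zero)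
  have "z + of_nat j * c \<in> J" using z translation_stabilizerD[OF translation_stabilizer_of_nat_mult[OF c(1)]] by blast
  then have "w \<in> J" using invariant[OF b(1)] w(1) by simp
  then have "N (w + c) \<in> J" using translation_stabilizerD[OF c(1)] invariant[OF b(2)] by blast
  then have in_J: "N (w + c) - of_nat j * c \<in> J"
    using translation_stabilizer_of_nat_mult[OF c(1), of j] unfolding translation_stabilizer_alt by blast
  have displacement: "N (w + c) - of_nat j * c - (z + \<mu> * c) = (N (w + c) - \<mu> * (w + c)) - (N w - \<mu> * w)"
    using w(1) by (simp add: algebra_simps)
  have "dist (N (w + c) - of_nat j * c) (z + \<mu> * c) < \<epsilon>"
    using norm_triangle_ineq4[of "N (w + c) - \<mu> * (w + c)" "N w - \<mu> * w"] near[OF b(1)] near[OF b(2)]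
    unfolding dist_norm displacement by simp
  then show ?thesis using in_J by blast
qed

lemma stabilizer_mult:
  assumes inv: "\<forall>\<^sub>F z in at_infinity. N z \<in> J \<longleftrightarrow> z \<in> J" and J: "closed J"
    and c: "c \<in> translation_stabilizer J"
  shows "\<mu> * c \<in> translation_stabilizer J"
proof (cases "c = 0")
  case False
  have "z + \<mu> * c \<in> J" if "c \<in> translation_stabilizer J" "c \<noteq> 0" "z \<in> J" for c z
    using stabilizer_mult_approx[OF inv that] closure_approachable[of "z + \<mu> * c" J] J by simp
  from this[OF c False] this[OF translation_stabilizer_minus[OF c]] show ?thesis
    using False unfolding translation_stabilizer_alt by auto
qed (use c in simp)

lemma stabilizer_contains_line:
  assumes inv: "\<forall>\<^sub>F z in at_infinity. N z \<in> J \<longleftrightarrow> z \<in> J" and J: "closed J"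
    and c: "c \<in> translation_stabilizer J" "c \<noteq> 0"
  obtains v where "cmod v = 1" "\<And>t. t *\<^sub>R v \<in> translation_stabilizer J"
proof (rule closed_subgroup_contains_line[OF closed_translation_stabilizer[OF J] zero_in_translation_stabilizer
      translation_stabilizer_add translation_stabilizer_minus])
  show "\<mu> ^ k * c \<in> translation_stabilizer J" for k
    by (induction k) (auto simp: c mult.assoc intro: stabilizer_mult[OF inv J])
  show "\<mu> ^ k * c \<noteq> 0" for k using c \<mu> by simp
  have "(\<lambda>k. \<mu> ^ k * c) \<longlonglongrightarrow> 0 * c" using \<mu> by (intro tendsto_intros LIMSEQ_power_zero)
  then show "(\<lambda>k. \<mu> ^ k * c) \<longlonglongrightarrow> 0" by simp
qed (use that in auto)

end

text \<open>A connected set transversal to \<open>v\<close> would sweep out an open set under the translations.\<close>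

lemma connected_subset_parallel:
  fixes J :: "complex set"
  assumes B: "open B" and v: "v \<noteq> 0"
    and inv: "\<And>z t. z \<in> J \<Longrightarrow> z \<in> B \<Longrightarrow> z + of_real t * v \<in> B \<Longrightarrow> z + of_real t * v \<in> J"
    and J: "interior J = {}"
    and S: "connected S" "S \<subseteq> J" "S \<subseteq> B" and zw: "z \<in> S" "w \<in> S"
  shows "Im (z / v) = Im (w / v)"
proof (rule ccontr)
  let ?height = "\<lambda>x. Im (x / v)"
  have cont: "continuous_on A ?height" for A using v by (intro continuous_intros) auto
  have connected: "connected (?height ` S)" by (rule connected_continuous_image[OF cont S(1)])
  define a b where "a = min (?height z) (?height w)" and "b = max (?height z) (?height w)"
  assume "?height z \<noteq> ?height w"
  then have ab: "a < b" "a \<in> ?height ` S" "b \<in> ?height ` S" using zw by (auto simp: a_def b_def min_def max_def)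
  have sub: "{a..b} \<subseteq> ?height ` S" using connected_contains_Icc[OF connected ab(2,3)] .
  define V where "V = B \<inter> {x. a < ?height x \<and> ?height x < b}"
  have "open V" unfolding V_def
    by (intro open_Int B open_Collect_conj open_Collect_less cont continuous_on_const)
  moreover have "V \<subseteq> J"
  proof
    fix x assume x: "x \<in> V"
    then have "?height x \<in> ?height ` S" using sub by (auto simp: V_def)
    then obtain y where y: "y \<in> S" "?height y = ?height x" by auto
    define t where "t = Re (x / v) - Re (y / v)"
    have "x / v = y / v + of_real t" using y(2) by (intro complex_eqI) (auto simp: t_def)
    then have "x = (y / v + of_real t) * v" using v by (metis nonzero_divide_eq_eq)
    then have "x = y + of_real t * v" using v by (simp add: distrib_right)
    then show "x \<in> J" using inv[of y t] y S x by (auto simp: V_def)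
  qed
  ultimately have "V \<subseteq> interior J" by (rule interior_maximal[rotated])
  moreover have "(a + b) / 2 \<in> ?height ` S" using sub ab(1) by auto
  then have "V \<noteq> {}" using S ab(1) unfolding V_def by fastforce
  ultimately show False using J by auto
qed

lemma real_on_positive_axis:
  assumes deriv: "(f has_field_derivative D) (at 0)" and "b > 0"
    and real: "\<And>s. 0 < s \<Longrightarrow> s \<le> b \<Longrightarrow> Im (f (of_real s)) = 0"
  shows "Im (f 0) = 0" "Im D = 0"
proof -
  have "\<forall>\<^sub>F s in at_right 0. s \<in> {0<..b}" using eventually_at_right_real[OF \<open>b > 0\<close>] by (rule eventually_mono) auto
  then have zero: "\<forall>\<^sub>F s in at_right 0. Im (f (of_real s)) = 0" by (rule eventually_mono) (use real in auto)
  have "((\<lambda>s. complex_of_real s) \<longlongrightarrow> of_real 0) (at_right 0)" by (intro tendsto_intros)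
  then have at_0: "filterlim complex_of_real (at 0) (at_right 0)"
    unfolding filterlim_at by (auto simp: eventually_at_filter)
  have "(f \<longlongrightarrow> f 0) (at 0)" using DERIV_isCont[OF deriv] by (simp add: isCont_def)
  from tendsto_Im[OF filterlim_compose[OF this at_0]]
  have "((\<lambda>s. Im (f (of_real s))) \<longlongrightarrow> Im (f 0)) (at_right 0)" .
  moreover have "((\<lambda>s. Im (f (of_real s))) \<longlongrightarrow> 0) (at_right 0)" using zero by (rule tendsto_eventually)
  ultimately show Im_f_0: "Im (f 0) = 0" using tendsto_unique trivial_limit_at_right_real by blast
  have "((\<lambda>z. (f z - f 0) / (z - 0)) \<longlongrightarrow> D) (at 0)" using deriv by (simp add: has_field_derivative_iff)
  from tendsto_Im[OF filterlim_compose[OF this at_0]]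
  have "((\<lambda>s. Im ((f (of_real s) - f 0) / of_real s)) \<longlongrightarrow> Im D) (at_right 0)" by simp
  moreover have "((\<lambda>s. Im ((f (of_real s) - f 0) / of_real s)) \<longlongrightarrow> 0) (at_right 0)"
    using zero by (intro tendsto_eventually) (auto elim!: eventually_mono simp: Im_f_0 Im_divide_of_real)
  ultimately show "Im D = 0" using tendsto_unique trivial_limit_at_right_real by blast
qed

text \<open>Substituting \<open>t = 1/s\<close> turns the expression, up to the factor \<open>s\<^sup>-\<^sup>k\<close>, into a function that is analytic
  at \<open>s = 0\<close> with value \<open>A\<close> and derivative \<open>\<i> k e A\<close>.\<close>

lemma real_on_horizontal_ray:
  fixes A B :: complex and e :: real
  assumes A: "A \<noteq> 0" and k: "k > 0"
    and real: "\<And>t. t \<ge> 1 \<Longrightarrow> Im (A * Complex t e ^ k - B / Complex t e) = 0"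
  shows "e = 0"
proof -
  define f where "f = (\<lambda>s. A * (1 + \<i> * e * s) ^ k - B * s ^ Suc k / (1 + \<i> * e * s))"
  have deriv: "(f has_field_derivative A * (of_nat k * (\<i> * e))) (at 0)"
    unfolding f_def using k by (auto intro!: derivative_eq_intros simp: power_0_left)
  have "Im (f (of_real s)) = 0" if s: "0 < s" "s \<le> 1" for s
  proof -
    define \<zeta> where "\<zeta> = Complex (1 / s) e"
    have s\<zeta>: "1 + \<i> * e * s = s * \<zeta>" using s by (simp add: \<zeta>_def complex_eq_iff)
    have "f (of_real s) = A * (s * \<zeta>) ^ k - B * (of_real s * of_real s ^ k) / (s * \<zeta>)"
      unfolding f_def s\<zeta> by simp
    also have "\<dots> = of_real (s ^ k) * (A * \<zeta> ^ k - B / \<zeta>)"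
      using s(1) by (simp add: power_mult_distrib right_diff_distrib mult_ac)
    finally show ?thesis using real[of "1 / s"] s by (simp add: \<zeta>_def flip: of_real_power)
  qed
  from real_on_positive_axis[OF deriv zero_less_one this]
  have "Im A = 0" "k * (Re A * e) = 0" using k by (simp_all add: f_def power_0_left)
  moreover from this(1) have "Re A \<noteq> 0" using A by (auto simp: complex_eq_iff)
  ultimately show ?thesis using k by simp
qed

section \<open>The relaxed Newton map of \<open>z\<^sup>m (z\<^sup>n - 1)\<close>\<close>

locale newton_pmn = pmn_exponents +
  fixes h :: complex
  assumes h: "cmod (h - 1) < 1"
begin

abbreviation "F \<equiv> relaxed_newton h (pmn m n)"
abbreviation "J \<equiv> finite_julia F"

definition "d = complex_of_nat (m + n)"
definition "\<mu> = 1 - h / d"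
definition "\<kappa> = h * of_nat n / d"
definition "N z = z * (\<mu> + \<kappa> / (d * z ^ n - of_nat m))"

lemma d_nonzero: "d \<noteq> 0" using n by (simp add: d_def del: of_nat_add)

lemma cmod_d: "cmod d = m + n" by (simp add: d_def del: of_nat_add)

lemma h_nonzero: "h \<noteq> 0" using h by auto

lemma \<kappa>_nonzero: "\<kappa> \<noteq> 0" using h_nonzero d_nonzero n by (simp add: \<kappa>_def)

lemma \<mu>_nonzero: "\<mu> \<noteq> 0" and \<mu>_less_1: "cmod \<mu> < 1"
proof -
  have n_ge_2: "real n \<ge> 2" using n by simp
  have "d - 1 = of_real (real (m + n) - 1)" by (simp add: d_def)
  then have norm_d: "cmod (d - 1) = real (m + n) - 1" using n by (simp only: norm_of_real)
  have "cmod (d - 1) \<le> cmod (d - h) + cmod (h - 1)" "cmod (d - h) \<le> cmod (d - 1) + cmod (h - 1)"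
    using norm_triangle_ineq[of "d - h" "h - 1"] norm_triangle_ineq4[of "d - 1" "h - 1"] by simp_all
  then have "0 < cmod (d - h)" "cmod (d - h) < m + n" using norm_d h n_ge_2 by linarith+
  moreover have "\<mu> = (d - h) / d" using d_nonzero by (simp add: \<mu>_def diff_divide_distrib)
  ultimately show "\<mu> \<noteq> 0" "cmod \<mu> < 1" using d_nonzero by (auto simp: norm_divide cmod_d divide_less_eq)
qed

sublocale newton: relaxed_newton_map h "pmn m n"
proof
  show "h \<noteq> of_nat (degree (pmn m n))"
    using \<mu>_nonzero d_nonzero n_pos by (auto simp: degree_pmn \<mu>_def d_def simp del: of_nat_add)
qed (use h_nonzero n_pos in \<open>simp_all add: degree_pmn\<close>)

lemma poly_pderiv_pmn: "z * poly (pderiv (pmn m n)) z = z ^ m * (d * z ^ n - of_nat m)"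
proof -
  have monom: "z * poly (pderiv (monom 1 k)) z = of_nat k * z ^ k" for k
    by (cases k) (simp_all add: pderiv_monom poly_monom)
  show ?thesis unfolding pmn_eq pderiv_diff poly_diff right_diff_distrib monom
    by (simp add: d_def power_add algebra_simps)
qed

lemma F_Some:
  assumes "d * z ^ n \<noteq> of_nat m"
  shows "F (Some z) = Some (N z)"
proof (cases "z = 0")
  case True
  then have "poly (pmn m n) z = 0" using assms n_pos by (auto simp: poly_pmn power_0_left)
  then show ?thesis using newton.F_root[of z] True by (simp add: N_def)
next
  case False
  define E where "E = d * z ^ n - of_nat m"
  have E: "E \<noteq> 0" using assms by (simp add: E_def)
  have pderiv: "poly (pderiv (pmn m n)) z = z ^ m * E / z"
    using poly_pderiv_pmn[of z] False by (simp add: E_def field_simps)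
  have "h * (z ^ m * (z ^ n - 1)) / (z ^ m * E / z) = z * (h * (z ^ n - 1) / E)" using False by simp
  then have "z - h * (z ^ m * (z ^ n - 1)) / (z ^ m * E / z) = z * (1 - h * (z ^ n - 1) / E)"
    by (simp add: right_diff_distrib)
  also have "1 - h * (z ^ n - 1) / E = \<mu> + \<kappa> / E"
  proof -
    have "h * (z ^ n - 1) = h * (d * (z ^ n - 1)) / d" using d_nonzero by simp
    also have "d * (z ^ n - 1) = E - of_nat n" by (simp add: E_def d_def algebra_simps)
    finally show ?thesis using E by (simp add: \<mu>_def \<kappa>_def diff_divide_distrib right_diff_distrib)
  qed
  finally show ?thesis using newton.F_regular[of z] E False unfolding pderiv
    by (simp add: poly_pmn N_def E_def)
qed

lemma F_pole:
  assumes "d * z ^ n = of_nat m"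
  shows "F (Some z) = None"
proof (rule newton.F_critical)
  show "poly (pderiv (pmn m n)) z = 0"
  proof (cases "z = 0")
    case True
    then have "m = 0" using assms n_pos by (simp add: power_0_left)
    then show ?thesis using True n by (simp add: pmn_eq pderiv_diff pderiv_monom poly_monom)
  next
    case False
    then show ?thesis using poly_pderiv_pmn[of z] assms by simp
  qed
  have "z ^ n \<noteq> 1" using assms n by (auto simp: d_def)
  moreover have "z ^ m \<noteq> 0"
  proof
    assume "z ^ m = 0"
    then show False using assms n_pos by (auto simp: power_0_left)
  qed
  ultimately show "poly (pmn m n) z \<noteq> 0" by (simp add: poly_pmn)
qed

lemma pole_exists: "\<exists>z. d * z ^ n = of_nat m"
proof -
  obtain z where "of_nat m / d = z ^ n" using exists_complex_root n_pos by blast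
  then show ?thesis using d_nonzero by (intro exI[of _ z]) (simp add: field_simps)
qed

lemma closed_J: "closed J"
  by (rule closed_finite_julia[OF newton.iterates_continuous])

lemma N_in_J_iff: "d * z ^ n \<noteq> of_nat m \<Longrightarrow> N z \<in> J \<longleftrightarrow> z \<in> J"
  using newton.julia_invariant F_Some by blast

lemma denominator_ge:
  assumes "cmod z \<ge> 1"
  shows "cmod (d * z ^ n - of_nat m) \<ge> n * cmod z ^ n"
proof -
  have "1 \<le> cmod z ^ n" using assms by simp
  then have "real m * 1 \<le> real m * cmod z ^ n" by (intro mult_left_mono) auto
  moreover have "cmod (d * z ^ n) - cmod (of_nat m :: complex) \<le> cmod (d * z ^ n - of_nat m)"
    by (rule norm_triangle_ineq2)
  ultimately show ?thesis by (simp add: norm_mult norm_power cmod_d algebra_simps)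
qed

lemma nonpole_large:
  assumes "cmod z \<ge> 1"
  shows "d * z ^ n \<noteq> of_nat m"
proof
  assume "d * z ^ n = of_nat m"
  then have "real n * cmod z ^ n \<le> 0" using denominator_ge[OF assms] by simp
  moreover have "real n * cmod z ^ n > 0" using assms n_pos by (intro mult_pos_pos zero_less_power) auto
  ultimately show False by simp
qed

lemma N_asymptotic: "((\<lambda>z. N z - \<mu> * z) \<longlongrightarrow> 0) at_infinity"
proof (rule Lim_null_comparison)
  show "((\<lambda>z. cmod \<kappa> / cmod z) \<longlongrightarrow> 0) at_infinity"
    by (intro tendsto_divide_0[OF tendsto_const] filterlim_at_top_imp_at_infinity filterlim_norm_at_top)
  have "norm (N z - \<mu> * z) \<le> cmod \<kappa> / cmod z" if z: "norm z \<ge> 1" for z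
  proof -
    have "cmod z * cmod z \<le> cmod z ^ n"
      using power_increasing[of 2 n "cmod z"] n z by (simp add: power2_eq_square)
    also have "\<dots> \<le> n * cmod z ^ n" using n_pos by (simp add: mult_le_cancel_right1)
    also have "\<dots> \<le> cmod (d * z ^ n - of_nat m)" by (rule denominator_ge[OF z])
    finally have denominator: "cmod z * cmod z \<le> cmod (d * z ^ n - of_nat m)" .
    have "cmod z * cmod z > 0" using z by (intro mult_pos_pos) auto
    then have "cmod z * cmod \<kappa> / cmod (d * z ^ n - of_nat m) \<le> cmod z * cmod \<kappa> / (cmod z * cmod z)"
      using denominator by (intro divide_left_mono mult_pos_pos) auto
    moreover have "N z - \<mu> * z = z * \<kappa> / (d * z ^ n - of_nat m)" by (simp add: N_def algebra_simps)
    ultimately show ?thesis by (auto simp: norm_mult norm_divide split: if_splits)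
  qed
  then show "\<forall>\<^sub>F z in at_infinity. norm (N z - \<mu> * z) \<le> cmod \<kappa> / cmod z"
    unfolding eventually_at_infinity by blast
qed

lemma continuous_on_N: "(\<And>z. z \<in> S \<Longrightarrow> d * z ^ n \<noteq> of_nat m) \<Longrightarrow> continuous_on S N"
  unfolding N_def by (intro continuous_intros) auto

sublocale newton: asymptotically_linear N \<mu> 1
  by unfold_locales (use \<mu>_nonzero \<mu>_less_1 N_asymptotic nonpole_large in \<open>auto intro: continuous_on_N\<close>)

lemma N_invariant_near_infinity: "\<forall>\<^sub>F z in at_infinity. N z \<in> J \<longleftrightarrow> z \<in> J"
  unfolding eventually_at_infinity using N_in_J_iff nonpole_large by blast

lemma pole_in_J:
  assumes "d * z ^ n = of_nat m"
  shows "z \<in> J"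
proof -
  obtain y where y: "\<And>k. N (y (Suc k)) = y k" "\<And>k. cmod (y k) \<ge> 1"
    and lim: "filterlim y at_infinity sequentially"
    using newton.inverse_orbit_to_infinity by blast
  have "F (Some (y (Suc k))) = Some (y k)" for k using y F_Some[OF nonpole_large] by simp
  then have "(F ^^ k) (Some (y k)) = Some (y 0)" for k
    by (induction k) (simp_all add: funpow_Suc_right del: funpow.simps(2))
  then show ?thesis using newton.pole_in_julia[OF newton.F_None F_pole[OF assms] _ lim] by blast
qed

lemma J_nonempty: "J \<noteq> {}"
  using pole_exists pole_in_J by blast

lemma N_derivative_at_1: "(N has_field_derivative (1 - h)) (at 1)"
proof -
  have denominator: "d - of_nat m = of_nat n" and n_nonzero: "(of_nat n :: complex) \<noteq> 0"
    using n_pos by (simp_all add: d_def)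
  have sum: "\<mu> + \<kappa> / of_nat n = 1" and prod: "\<kappa> * d = h * of_nat n"
    using n_nonzero d_nonzero by (simp_all add: \<mu>_def \<kappa>_def)
  have "((\<lambda>z. z * (\<mu> + \<kappa> / (d * z ^ n - of_nat m))) has_field_derivative
      (\<mu> + \<kappa> / of_nat n) - \<kappa> * (d * of_nat n) / (of_nat n)^2) (at 1)"
    using denominator n_nonzero by (auto intro!: derivative_eq_intros simp: power2_eq_square)
  moreover have "(\<mu> + \<kappa> / of_nat n) - \<kappa> * (d * of_nat n) / (of_nat n)^2 = 1 - h"
    unfolding sum mult.assoc[symmetric] prod using n_nonzero by (simp add: power2_eq_square)
  ultimately show ?thesis by (simp add: N_def[abs_def])
qed

lemma one_not_in_J: "1 \<notin> J"
proof (rule attracting_fixed_point_not_in_julia[OF newton.iterates_continuous _ _ N_derivative_at_1])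
  have "open {z. d * z ^ n \<noteq> of_nat m}" by (intro open_Collect_neq continuous_intros)
  then have "\<forall>\<^sub>F z in nhds 1. z \<in> {z. d * z ^ n \<noteq> of_nat m}"
    using nonpole_large[of 1] by (intro eventually_nhds_in_open) auto
  then show "\<forall>\<^sub>F z in nhds 1. F (Some z) = Some (N z)"
    by (rule eventually_mono) (simp add: F_Some)
  have "F (Some 1) = Some 1" by (rule newton.F_root) (simp add: poly_pmn)
  then show "N 1 = 1" using F_Some[OF nonpole_large[of 1]] by simp
  show "cmod (1 - h) < 1" using h by (simp add: norm_minus_commute)
qed

lemma interior_J: "interior J = {}"
  using newton.julia_empty_interior[OF newton.F_None one_not_in_J] .

lemma J_rotate:
  assumes "a ^ n = 1"
  shows "a * z \<in> J \<longleftrightarrow> z \<in> J"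
proof (rule finite_julia_rotate_root_of_unity[where j = 1, OF newton.iterates_continuous n_pos assms])
  fix a :: complex and x assume a: "a ^ n = 1"
  show "F (ext_aff (\<lambda>z. a * z) x) = ext_aff (\<lambda>z. a ^ 1 * z) (F x)"
  proof (cases x)
    case None
    then show ?thesis by (simp add: newton.F_None ext_aff_def)
  next
    case (Some w)
    have "(a * w) ^ n = w ^ n" using a by (simp add: power_mult_distrib)
    then show ?thesis using Some F_pole[of w] F_pole[of "a * w"] F_Some[of w] F_Some[of "a * w"]
      by (cases "d * w ^ n = of_nat m") (simp_all add: ext_aff_def N_def)
  qed
qed

lemma filterlim_horizontal_line:
  assumes "cmod v = 1"
  shows "filterlim (\<lambda>t. v * Complex t e) at_infinity at_top"
proof -
  have "\<forall>\<^sub>F t in at_top. t \<le> norm (v * Complex t e)"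
    using assms by (intro always_eventually allI)
      (metis abs_Re_le_cmod abs_ge_self complex.sel(1) mult_1 norm_mult order_trans)
  then show ?thesis using filterlim_at_top_mono[OF filterlim_ident]
    by (simp add: filterlim_at_infinity_conv_norm_at_top)
qed

lemma affine_tendsto_0_at_top:
  fixes c K :: real
  assumes "((\<lambda>s. K - c * s) \<longlongrightarrow> 0) at_top"
  shows "c = 0 \<and> K = 0"
proof -
  have inverse_lim: "((\<lambda>s :: real. inverse s) \<longlongrightarrow> 0) at_top" by (rule tendsto_inverse_0_at_top[OF filterlim_ident])
  have "((\<lambda>s. (K - (K - c * s)) * inverse s) \<longlongrightarrow> (K - 0) * 0) at_top"
    by (intro tendsto_intros assms inverse_lim)
  moreover have "\<forall>\<^sub>F s in at_top. (K - (K - c * s)) * inverse s = c"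
    using eventually_gt_at_top[of 0] by eventually_elim simp
  ultimately have "c = 0"
    using tendsto_unique[OF trivial_limit_at_top_linorder tendsto_eventually] by fastforce
  then show ?thesis using assms by (simp add: tendsto_const_iff)
qed

text \<open>\<open>N\<close> maps the line to a connected subset of \<open>J\<close>, which has to be parallel to \<open>v\<close>. Since \<open>N\<close> is asymptotic
  to \<open>\<mu> z\<close>, both \<open>\<mu>\<close> and \<open>(N(z) - \<mu> z) / v\<close> are real.\<close>

lemma N_displacement_real:
  assumes v: "cmod v = 1" and inv: "\<And>z t. z \<in> J \<Longrightarrow> z + of_real t * v \<in> J"
    and e: "\<i> * of_real e * v \<in> J" and t: "t \<ge> 1"
  defines "z \<equiv> \<lambda>t. v * Complex t e"
  shows "Im ((N (z t) - \<mu> * z t) / v) = 0"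
proof -
  have v_nonzero: "v \<noteq> 0" using v by auto
  have z_in_J: "z t \<in> J" for t
    using inv[OF e, of t] by (simp add: z_def Complex_eq algebra_simps)
  have z_large: "cmod (z t) \<ge> 1" if "t \<ge> 1" for t
    using v that abs_Re_le_cmod[of "Complex t e"] by (simp add: z_def norm_mult)
  have cont: "continuous_on {1..} (\<lambda>t. N (z t))"
    using nonpole_large[OF z_large] unfolding z_def Complex_eq
    by (intro continuous_on_compose2[OF continuous_on_N[OF _] _ subset_refl] continuous_intros) auto
  have height_const: "Im (N (z s) / v) = Im (N (z 1) / v)" if "s \<ge> 1" for s
  proof (rule connected_subset_parallel[of UNIV v J "(\<lambda>t. N (z t)) ` {1..}"])
    show "connected ((\<lambda>t. N (z t)) ` {1..})" by (intro connected_continuous_image cont) auto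
    show "(\<lambda>t. N (z t)) ` {1..} \<subseteq> J" using N_in_J_iff nonpole_large z_large z_in_J by auto
  qed (use that v_nonzero inv interior_J in auto)
  define G where "G = (\<lambda>t. (N (z t) - \<mu> * z t) / v)"
  define K where "K = Im (N (z 1) / v) - Re \<mu> * e"
  have Im_G: "Im (G s) = K - Im \<mu> * s" if "s \<ge> 1" for s
  proof -
    have "N (z s) / v = \<mu> * Complex s e + G s" using v_nonzero by (simp add: G_def z_def diff_divide_distrib)
    from arg_cong[OF this, of Im] show ?thesis using height_const[OF that] by (simp add: K_def)
  qed
  have "(G \<longlongrightarrow> 0 / v) at_top"
    unfolding G_def z_def using v_nonzero
    by (intro tendsto_divide tendsto_const filterlim_compose[OF N_asymptotic filterlim_horizontal_line[OF v]])
  then have "((\<lambda>s. Im (G s)) \<longlongrightarrow> 0) at_top" using tendsto_Im by fastforce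
  then have "((\<lambda>s. K - Im \<mu> * s) \<longlongrightarrow> 0) at_top"
    by (rule Lim_transform_eventually) (use Im_G in \<open>auto simp: eventually_at_top_linorder\<close>)
  then have "Im \<mu> = 0 \<and> K = 0" by (rule affine_tendsto_0_at_top)
  then show ?thesis using Im_G[OF t] by (simp add: G_def)
qed

lemma J_height_zero:
  assumes v: "cmod v = 1" and inv: "\<And>z t. z \<in> J \<Longrightarrow> z + of_real t * v \<in> J"
    and e: "\<i> * of_real e * v \<in> J"
  shows "e = 0"
proof (rule real_on_horizontal_ray[of "d * v ^ n / \<kappa>" "n - 1" e "of_nat m / \<kappa>"])
  have v_nonzero: "v \<noteq> 0" using v by auto
  then show "d * v ^ n / \<kappa> \<noteq> 0" using d_nonzero \<kappa>_nonzero by simp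
  fix t :: real assume t: "t \<ge> 1"
  define \<zeta> where "\<zeta> = Complex t e"
  define D where "D = d * (v * \<zeta>) ^ n - of_nat m"
  have \<zeta>_nonzero: "\<zeta> \<noteq> 0" using t by (auto simp: \<zeta>_def complex_eq_iff)
  have "N (v * \<zeta>) - \<mu> * (v * \<zeta>) = v * (\<zeta> * \<kappa> / D)" by (simp add: N_def D_def algebra_simps)
  then have "(N (v * \<zeta>) - \<mu> * (v * \<zeta>)) / v = \<zeta> * \<kappa> / D" using v_nonzero by simp
  then have "Im (inverse (\<zeta> * \<kappa> / D)) = 0"
    using N_displacement_real[OF v inv e t] unfolding \<zeta>_def[symmetric] by (simp del: inverse_divide)
  moreover have "inverse (\<zeta> * \<kappa> / D) = d * v ^ n / \<kappa> * \<zeta> ^ (n - 1) - of_nat m / \<kappa> / \<zeta>"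
  proof -
    have "\<zeta> ^ n = \<zeta> ^ (n - 1) * \<zeta>" using n by (simp flip: power_Suc2)
    then have "D = d * v ^ n * \<zeta> ^ (n - 1) * \<zeta> - of_nat m" by (simp add: D_def power_mult_distrib)
    then show ?thesis using \<zeta>_nonzero by (simp add: diff_divide_distrib mult.commute[of \<zeta> \<kappa>])
  qed
  ultimately show "Im (d * v ^ n / \<kappa> * Complex t e ^ (n - 1) - of_nat m / \<kappa> / Complex t e) = 0"
    by (simp add: \<zeta>_def)
qed (use n in simp)

lemma line_if_translation_invariant:
  assumes v: "cmod v = 1" and inv: "\<And>z t. z \<in> J \<Longrightarrow> z + of_real t * v \<in> J"
  shows "is_line (julia F)"
proof -
  have v_nonzero: "v \<noteq> 0" using v by auto
  have on_line: "\<exists>t. x = of_real t * v" if x: "x \<in> J" for x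
  proof -
    define t e where "t = Re (x / v)" and "e = Im (x / v)"
    have "x = x / v * v" using v_nonzero by simp
    also have "x / v = of_real t + \<i> * of_real e" by (simp add: t_def e_def complex_eq)
    finally have decomp: "x = of_real t * v + \<i> * of_real e * v" by (simp add: distrib_right)
    then have "\<i> * of_real e * v \<in> J" using inv[OF x, of "- t"] by simp
    from v inv this have "e = 0" by (rule J_height_zero)
    then show ?thesis using decomp by auto
  qed
  obtain t where t: "of_real t * v \<in> J" using J_nonempty on_line by blast
  have "of_real s * v \<in> J" for s
    using inv[OF t, of "s - t"] by (simp add: algebra_simps)
  then have "Some -` julia F = {0 + of_real s * v | s. True}"
    using on_line by (auto simp: finite_julia_def)
  then show ?thesis unfolding is_line_def using v_nonzero by blast
qed

lemma symmetry_fixes_zero: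
  assumes not_line: "\<not> is_line (julia F)" and a: "cmod a = 1"
    and sym: "\<And>z. a * z + b \<in> J \<longleftrightarrow> z \<in> J"
  shows "b = 0"
proof -
  obtain \<omega> :: complex where \<omega>: "\<omega> ^ n = 1" "\<omega> \<noteq> 1" using nontrivial_root_of_unity[OF n] .
  have nonzero: "a \<noteq> 0" "\<omega> \<noteq> 0" using a \<omega> n_pos by (auto simp: power_0_left)
  have stabilizer: "(1 - \<omega>) * b \<in> translation_stabilizer J"
    unfolding translation_stabilizer_def
  proof (intro CollectI allI)
    fix z
    define y where "y = (z / \<omega> - b) / a"
    have z: "z = \<omega> * (a * y + b)" using nonzero by (simp add: y_def)
    then have "z + (1 - \<omega>) * b = a * (\<omega> * y) + b" by (simp add: algebra_simps)
    then show "z + (1 - \<omega>) * b \<in> J \<longleftrightarrow> z \<in> J" using sym J_rotate[OF \<omega>(1)] z by simp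
  qed
  have "(1 - \<omega>) * b = 0"
  proof (rule ccontr)
    assume "(1 - \<omega>) * b \<noteq> 0"
    then obtain v where v: "cmod v = 1" "\<And>t. t *\<^sub>R v \<in> translation_stabilizer J"
      using newton.stabilizer_contains_line[OF N_invariant_near_infinity closed_J stabilizer] by blast
    then have "is_line (julia F)"
      using line_if_translation_invariant translation_stabilizerD[OF v(2)] by (simp add: scaleR_conv_of_real)
    then show False using not_line by simp
  qed
  then show ?thesis using \<omega>(2) by simp
qed

end

section \<open>Koenigs linearisation at a repelling fixed point at infinity\<close>

locale koenigs_coordinate =
  fixes M P :: "complex \<Rightarrow> complex" and \<Lambda> x0 :: complex and R K :: real
  assumes \<Lambda>: "\<Lambda> \<noteq> 0" "cmod \<Lambda> < 1" and R: "R \<ge> 1" and K: "0 \<le> K" "K \<le> R"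
    and P_holomorphic: "P holomorphic_on {y. cmod y > R}"
    and P_near: "cmod y > R \<Longrightarrow> cmod (P y - (y + x0)) \<le> K / cmod y"
    and P_conjugates: "cmod (\<Lambda> * y) > R \<Longrightarrow> M (P y) = P (\<Lambda> * y)"

lemma open_norm_gt: "open {y :: 'a :: real_normed_vector. norm y > r}"
  by (intro open_Collect_less continuous_intros)

lemma norm_le_norm_div:
  fixes y \<Lambda> :: complex
  assumes "\<Lambda> \<noteq> 0" "cmod \<Lambda> < 1"
  shows "cmod y \<le> cmod (y / \<Lambda>)"
  using assms mult_left_mono[of "cmod \<Lambda>" 1 "cmod y"] by (simp add: norm_divide le_divide_eq)

locale koenigs_limit =
  fixes M :: "complex \<Rightarrow> complex" and \<Lambda> x0 :: complex and r C :: real and G :: "complex \<Rightarrow> complex"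
  assumes \<Lambda>: "\<Lambda> \<noteq> 0" "cmod \<Lambda> < 1" and r: "r \<ge> 1" and C: "C \<ge> 0"
    and M_holomorphic: "M holomorphic_on {x. cmod x > r}"
    and M_eq: "M x = \<Lambda> * (x - x0) + x0 + G x"
    and G_bound: "cmod x > r \<Longrightarrow> cmod (G x) \<le> C / cmod x"
    and G_lipschitz: "cmod x > r \<Longrightarrow> cmod y > r \<Longrightarrow> cmod (G x - G y) \<le> C * cmod (x - y) / (cmod x * cmod y)"
begin

definition "q = (1 + cmod \<Lambda>) / 2"
definition "K = 4 * C / (1 - cmod \<Lambda>)"
definition "\<rho> = max r (2 * C / (1 - cmod \<Lambda>))"
definition "R = Max {1, K, 2 * cmod x0, \<rho> + cmod x0 + 1}"

primrec approximant :: "nat \<Rightarrow> complex \<Rightarrow> complex" where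
  "approximant 0 = (\<lambda>y. y + x0)"
| "approximant (Suc k) = (\<lambda>y. M (approximant k (y / \<Lambda>)))"

definition "P y = (y + x0) + (\<Sum>k. approximant (Suc k) y - approximant k y)"

lemma q: "0 < q" "q < 1"
  using \<Lambda> by (auto simp: q_def add_pos_nonneg)

lemma K_nonneg: "K \<ge> 0"
  using C \<Lambda> by (simp add: K_def)

lemma K_q: "K * (1 - q) = 2 * C"
  using \<Lambda> by (simp add: K_def q_def field_simps)

lemma \<rho>: "\<rho> \<ge> r" "\<rho> \<ge> 1" "2 * C \<le> \<rho> * (1 - cmod \<Lambda>)"
proof -
  show "\<rho> \<ge> r" "\<rho> \<ge> 1" using r by (auto simp: \<rho>_def)
  have "2 * C / (1 - cmod \<Lambda>) \<le> \<rho>" by (simp add: \<rho>_def)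
  then show "2 * C \<le> \<rho> * (1 - cmod \<Lambda>)" using \<Lambda> by (simp add: divide_le_eq)
qed

lemma R: "R \<ge> 1" "R \<ge> K" "R \<ge> 2 * cmod x0" "R \<ge> \<rho> + cmod x0 + 1"
  by (simp_all add: R_def)

lemma M_contracts:
  assumes "cmod a > \<rho>" "cmod b > \<rho>"
  shows "cmod (M a - M b) \<le> q * cmod (a - b)"
proof -
  have ab: "cmod a > r" "cmod b > r" using assms \<rho> by auto
  have "\<rho> * (1 - cmod \<Lambda>) \<le> \<rho> * \<rho> * (1 - cmod \<Lambda>)" using \<rho> \<Lambda> by (intro mult_right_mono) auto
  then have "2 * C \<le> \<rho> * \<rho> * (1 - cmod \<Lambda>)" using \<rho>(3) by linarith
  then have "C / (\<rho> * \<rho>) \<le> (1 - cmod \<Lambda>) / 2" using \<rho> by (simp add: divide_le_eq mult.commute)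
  then have C_le: "cmod \<Lambda> + C / (\<rho> * \<rho>) \<le> q" unfolding q_def add_divide_distrib diff_divide_distrib by linarith
  have "M a - M b = \<Lambda> * (a - b) + (G a - G b)" unfolding M_eq by (simp add: algebra_simps)
  then have "cmod (M a - M b) \<le> cmod \<Lambda> * cmod (a - b) + C * cmod (a - b) / (cmod a * cmod b)"
    using norm_triangle_ineq[of "\<Lambda> * (a - b)" "G a - G b"] G_lipschitz[OF ab] by (simp add: norm_mult)
  also have "C * cmod (a - b) / (cmod a * cmod b) \<le> C * cmod (a - b) / (\<rho> * \<rho>)"
    using assms \<rho> C by (intro divide_left_mono mult_mono mult_pos_pos) auto
  also have "cmod \<Lambda> * cmod (a - b) + C * cmod (a - b) / (\<rho> * \<rho>) = (cmod \<Lambda> + C / (\<rho> * \<rho>)) * cmod (a - b)"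
    by (simp add: distrib_right)
  also have "\<dots> \<le> q * cmod (a - b)" using C_le by (intro mult_right_mono) auto
  finally show ?thesis by simp
qed

lemma near_shift_large:
  assumes y: "cmod y > R" and x: "cmod (x - (y + x0)) \<le> K / cmod y"
  shows "cmod x > \<rho>"
proof -
  have "K \<le> cmod y" "cmod y > 0" using y R by linarith+
  then have "K / cmod y \<le> 1" by simp
  then have "cmod (x - (y + x0)) \<le> 1" using x by linarith
  moreover have "cmod y \<le> cmod x + cmod (x - (y + x0)) + cmod x0"
    using norm_triangle_ineq4[of x "x - (y + x0)"] norm_triangle_ineq4[of "y + x0" x0] by simp
  ultimately show ?thesis using y R by linarith
qed

lemma approximant_first_step:
  assumes y: "cmod y > R"
  shows "cmod (approximant 1 y - approximant 0 y) \<le> 2 * C / cmod y"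
proof -
  define x where "x = y / \<Lambda> + x0"
  have "cmod y \<le> cmod x + cmod x0"
    using norm_le_norm_div[OF \<Lambda>, of y] norm_triangle_ineq4[of x x0] by (simp add: x_def)
  then have x: "cmod x \<ge> cmod y / 2" "cmod x > r" "cmod y > 0" using y R \<rho> by linarith+
  have "approximant 1 y - approximant 0 y = G x" using \<Lambda> by (simp add: M_eq x_def)
  then have "cmod (approximant 1 y - approximant 0 y) \<le> C / cmod x" using G_bound[OF x(2)] by simp
  also have "\<dots> \<le> C / (cmod y / 2)" using x r C by (intro divide_left_mono mult_pos_pos) auto
  finally show ?thesis by (simp add: mult.commute)
qed

lemma approximant_estimates:
  assumes "cmod y > R"
  shows "cmod (approximant k y - (y + x0)) \<le> K * (1 - q ^ k) / cmod y \<and>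
    cmod (approximant (Suc k) y - approximant k y) \<le> K * (1 - q) * q ^ k / cmod y"
  using assms
proof (induction k arbitrary: y)
  case 0
  then show ?case using approximant_first_step[of y] by (simp add: K_q)
next
  case (Suc k)
  have distance: "cmod (approximant (Suc k) y - (y + x0)) \<le> K * (1 - q ^ Suc k) / cmod y" if "cmod y > R" for y
  proof -
    have "cmod (approximant (Suc k) y - (y + x0)) \<le>
        cmod (approximant (Suc k) y - approximant k y) + cmod (approximant k y - (y + x0))"
      using dist_triangle[of "approximant (Suc k) y" "y + x0" "approximant k y"] by (simp only: dist_norm)
    also have "\<dots> \<le> K * (1 - q) * q ^ k / cmod y + K * (1 - q ^ k) / cmod y"
      using Suc.IH[OF that] by (intro add_mono) simp_all
    also have "\<dots> = K * (1 - q ^ Suc k) / cmod y" by (simp add: algebra_simps flip: add_divide_distrib)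
    finally show ?thesis .
  qed
  define u where "u = y / \<Lambda>"
  have u: "cmod u > R" "cmod u \<ge> cmod y" using norm_le_norm_div[OF \<Lambda>, of y] Suc.prems by (simp_all add: u_def)
  have "K * (1 - q ^ j) / cmod u \<le> K / cmod u" for j
    using K_nonneg q by (intro divide_right_mono mult_left_le) auto
  then have "cmod (approximant (Suc k) u) > \<rho>" "cmod (approximant k u) > \<rho>"
    using near_shift_large[OF u(1)] distance[OF u(1)] Suc.IH[OF u(1)] order_trans by blast+
  then have "cmod (M (approximant (Suc k) u) - M (approximant k u)) \<le>
      q * cmod (approximant (Suc k) u - approximant k u)"
    by (rule M_contracts)
  also have "\<dots> \<le> q * (K * (1 - q) * q ^ k / cmod u)" using Suc.IH[OF u(1)] q by (intro mult_left_mono) auto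
  also have "\<dots> \<le> q * (K * (1 - q) * q ^ k / cmod y)"
    using u Suc.prems R q K_nonneg by (intro mult_left_mono divide_left_mono mult_pos_pos) auto
  finally have "cmod (approximant (Suc (Suc k)) y - approximant (Suc k) y) \<le> K * (1 - q) * q ^ Suc k / cmod y"
    by (simp add: u_def mult_ac)
  then show ?case using distance[OF Suc.prems] by blast
qed

lemma approximant_near:
  assumes "cmod y > R"
  shows "cmod (approximant k y - (y + x0)) \<le> K / cmod y"
  using approximant_estimates[OF assms, of k] divide_right_mono[of "K * (1 - q ^ k)" K "cmod y"] K_nonneg q
  by (simp add: mult_left_le)

lemma approximant_large: "cmod y > R \<Longrightarrow> cmod (approximant k y) > \<rho>"
  by (rule near_shift_large[OF _ approximant_near])

lemma approximant_holomorphic: "approximant k holomorphic_on {y. cmod y > R}"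
proof (induction k)
  case 0
  show ?case by (simp add: holomorphic_intros)
next
  case (Suc k)
  have outer: "cmod (y / \<Lambda>) > R" if "cmod y > R" for y using that norm_le_norm_div[OF \<Lambda>, of y] by linarith
  have "(\<lambda>y. y / \<Lambda>) holomorphic_on {y. cmod y > R}" using \<Lambda> by (intro holomorphic_intros) auto
  from holomorphic_on_compose_gen[OF this Suc]
  have "(\<lambda>y. approximant k (y / \<Lambda>)) holomorphic_on {y. cmod y > R}" using outer by (auto simp: o_def)
  moreover have "(\<lambda>y. approximant k (y / \<Lambda>)) ` {y. cmod y > R} \<subseteq> {x. cmod x > r}"
    using approximant_large[OF outer] \<rho>(1) by (auto intro: le_less_trans)
  ultimately show ?case using M_holomorphic holomorphic_on_compose_gen by (fastforce simp: o_def)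
qed

lemma approximant_uniform_limit: "uniform_limit {y. cmod y > R} approximant P sequentially"
proof -
  have "uniform_limit {y. cmod y > R} (\<lambda>k y. \<Sum>i<k. approximant (Suc i) y - approximant i y)
      (\<lambda>y. \<Sum>i. approximant (Suc i) y - approximant i y) sequentially"
  proof (rule Weierstrass_m_test[where M = "\<lambda>i. K * (1 - q) * q ^ i"])
    fix i y assume "y \<in> {y. cmod y > R}"
    then have y: "cmod y > R" "cmod y \<ge> 1" using R by auto
    have "cmod (approximant (Suc i) y - approximant i y) \<le> K * (1 - q) * q ^ i / cmod y"
      using approximant_estimates[OF y(1)] by blast
    also have "\<dots> \<le> K * (1 - q) * q ^ i / 1" using y(2) K_nonneg q by (intro divide_left_mono) auto
    finally show "cmod (approximant (Suc i) y - approximant i y) \<le> K * (1 - q) * q ^ i" by simp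
  qed (use q in \<open>auto intro!: summable_mult summable_geometric\<close>)
  then have "uniform_limit {y. cmod y > R}
      (\<lambda>k y. (y + x0) + (\<Sum>i<k. approximant (Suc i) y - approximant i y)) P sequentially"
    unfolding P_def by (intro uniform_limit_add uniform_limit_const)
  moreover have "(\<lambda>k y. (y + x0) + (\<Sum>i<k. approximant (Suc i) y - approximant i y)) = approximant"
    using sum_lessThan_telescope[of "\<lambda>i. approximant i _"] by (intro ext) simp
  ultimately show ?thesis by simp
qed

lemma approximant_tendsto: "cmod y > R \<Longrightarrow> (\<lambda>k. approximant k y) \<longlonglongrightarrow> P y"
  using tendsto_uniform_limitI[OF approximant_uniform_limit] by simp

lemma P_holomorphic: "P holomorphic_on {y. cmod y > R}"
proof (rule holomorphic_uniform_sequence[OF open_norm_gt approximant_holomorphic])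
  fix y assume "y \<in> {y. cmod y > R}"
  then obtain e where "e > 0" "cball y e \<subseteq> {y. cmod y > R}" using open_norm_gt open_contains_cball by metis
  then show "\<exists>e>0. cball y e \<subseteq> {y. cmod y > R} \<and> uniform_limit (cball y e) approximant P sequentially"
    using uniform_limit_on_subset[OF approximant_uniform_limit] by blast
qed

lemma P_near:
  assumes "cmod y > R"
  shows "cmod (P y - (y + x0)) \<le> K / cmod y"
proof (rule LIMSEQ_le_const2)
  show "(\<lambda>k. cmod (approximant k y - (y + x0))) \<longlonglongrightarrow> cmod (P y - (y + x0))"
    by (intro tendsto_intros approximant_tendsto assms)
qed (use approximant_near[OF assms] in blast)

lemma P_conjugates:
  assumes "cmod (\<Lambda> * y) > R"
  shows "M (P y) = P (\<Lambda> * y)"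
proof -
  have y: "cmod y > R" using norm_le_norm_div[OF \<Lambda>, of "\<Lambda> * y"] assms \<Lambda> by simp
  have "cmod (P y) > r" using near_shift_large[OF y P_near[OF y]] \<rho> by simp
  then have "isCont M (P y)"
    using holomorphic_on_imp_continuous_on[OF M_holomorphic]
    unfolding continuous_on_eq_continuous_at[OF open_norm_gt] by blast
  then have "(\<lambda>k. M (approximant k y)) \<longlonglongrightarrow> M (P y)" using approximant_tendsto[OF y] isCont_tendsto_compose by blast
  moreover have "(\<lambda>k. approximant (Suc k) (\<Lambda> * y)) \<longlonglongrightarrow> P (\<Lambda> * y)"
    using approximant_tendsto[OF assms] by (rule LIMSEQ_Suc)
  moreover have "approximant (Suc k) (\<Lambda> * y) = M (approximant k y)" for k using \<Lambda> by simp
  ultimately show ?thesis using LIMSEQ_unique by simp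
qed

lemma koenigs_coordinate_limit:
  assumes "B \<ge> R"
  shows "koenigs_coordinate M P \<Lambda> x0 B K"
proof
  show "P holomorphic_on {y. cmod y > B}"
    using assms by (intro holomorphic_on_subset[OF P_holomorphic]) auto
qed (use assms \<Lambda> R K_nonneg P_near P_conjugates in auto)

end

lemma holomorphic_lipschitz_on_compact_convex:
  assumes hol: "f holomorphic_on S" and S: "open S" and K: "compact K" "convex K" "K \<subseteq> S"
  obtains C where "C \<ge> 0" "\<And>x y. x \<in> K \<Longrightarrow> y \<in> K \<Longrightarrow> cmod (f x - f y) \<le> C * cmod (x - y)"
proof -
  have "continuous_on K (deriv f)"
    using holomorphic_deriv[OF hol S] K(3) holomorphic_on_imp_continuous_on holomorphic_on_subset by blast
  then have "bounded (deriv f ` K)" by (intro compact_imp_bounded compact_continuous_image K(1))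
  then obtain C where C: "C > 0" "\<And>x. x \<in> K \<Longrightarrow> cmod (deriv f x) \<le> C" unfolding bounded_pos by auto
  have "(f has_field_derivative deriv f x) (at x within K)" if "x \<in> K" for x
    using that K(3) by (intro has_field_derivative_at_within[OF holomorphic_derivI[OF hol S]]) auto
  then have "cmod (f x - f y) \<le> C * cmod (x - y)" if "x \<in> K" "y \<in> K" for x y
    using that C(2) by (intro field_differentiable_bound[OF K(2), where f' = "deriv f"])
  then show ?thesis using C(1) by (intro that[of C]) auto
qed

lemma holomorphic_at_infinity_estimates:
  assumes hol: "G holomorphic_on {x. cmod x > r}" and r: "r > 0" and lim: "(G \<longlongrightarrow> 0) at_infinity"
  obtains C where "C \<ge> 0" "\<And>x. cmod x \<ge> 2 * r \<Longrightarrow> cmod (G x) \<le> C / cmod x"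
    "\<And>x y. cmod x \<ge> 2 * r \<Longrightarrow> cmod y \<ge> 2 * r \<Longrightarrow> cmod (G x - G y) \<le> C * cmod (x - y) / (cmod x * cmod y)"
proof -
  define g where "g = (\<lambda>s. if s = 0 then 0 else G (inverse s))"
  have "(\<lambda>s. G (inverse s)) holomorphic_on ball 0 (inverse r) - {0}"
  proof (rule holomorphic_on_compose_gen[of inverse _ G, unfolded o_def, OF _ hol])
    show "inverse ` (ball 0 (inverse r) - {0}) \<subseteq> {x. cmod x > r}"
      using r by (auto simp: norm_inverse)
        (metis inverse_inverse_eq inverse_less_imp_less zero_less_norm_iff less_imp_inverse_less)
  qed (auto intro!: holomorphic_intros)
  moreover have "((\<lambda>s. G (inverse s)) \<longlongrightarrow> 0) (at 0)"
    by (rule filterlim_compose[OF lim filterlim_inverse_at_infinity])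
  ultimately have "g holomorphic_on ball 0 (inverse r)"
    unfolding g_def by (intro removable_singularity) auto
  moreover have "cball 0 (inverse (2 * r)) \<subseteq> ball (0::complex) (inverse r)" using r by (auto simp: field_simps)
  ultimately obtain C where C: "C \<ge> 0"
    and lipschitz: "\<And>s t. s \<in> cball 0 (inverse (2 * r)) \<Longrightarrow> t \<in> cball 0 (inverse (2 * r)) \<Longrightarrow>
      cmod (g s - g t) \<le> C * cmod (s - t)"
    using holomorphic_lipschitz_on_compact_convex[OF _ open_ball compact_cball convex_cball] by metis
  have inverse_in: "inverse x \<in> cball 0 (inverse (2 * r))" and G_eq: "G x = g (inverse x)" and nonzero: "x \<noteq> 0"
    if "cmod x \<ge> 2 * r" for x
    using that r le_imp_inverse_le[OF that] by (auto simp: g_def norm_inverse)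
  show ?thesis
  proof
    show "C \<ge> 0" by (rule C)
    fix x assume x: "cmod x \<ge> 2 * r"
    have "0 \<in> cball 0 (inverse (2 * r))" using r by simp
    from lipschitz[OF inverse_in[OF x] this] show "cmod (G x) \<le> C / cmod x"
      unfolding G_eq[OF x] by (simp add: g_def norm_inverse divide_inverse)
    fix y assume y: "cmod y \<ge> 2 * r"
    have "cmod (inverse x - inverse y) = cmod (x - y) / (cmod x * cmod y)"
      using nonzero[OF x] nonzero[OF y]
      by (simp add: inverse_diff_inverse norm_mult norm_inverse divide_inverse mult_ac)
    then show "cmod (G x - G y) \<le> C * cmod (x - y) / (cmod x * cmod y)"
      using lipschitz[OF inverse_in[OF x] inverse_in[OF y]] unfolding G_eq[OF x] G_eq[OF y] by simp
  qed
qed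

theorem koenigs_at_infinity:
  assumes \<Lambda>: "\<Lambda> \<noteq> 0" "cmod \<Lambda> < 1" and hol: "M holomorphic_on {x. cmod x > r}"
    and lim: "((\<lambda>x. M x - \<Lambda> * x) \<longlongrightarrow> (1 - \<Lambda>) * x0) at_infinity"
  obtains P R K where "R \<ge> B" "koenigs_coordinate M P \<Lambda> x0 R K"
proof -
  define s where "s = max r 1"
  have s: "s \<ge> 1" by (simp add: s_def)
  have hol_s: "M holomorphic_on {x. cmod x > t}" if "t \<ge> s" for t
    using that by (intro holomorphic_on_subset[OF hol]) (auto simp: s_def)
  define G where "G = (\<lambda>x. M x - \<Lambda> * x - (1 - \<Lambda>) * x0)"
  have "G holomorphic_on {x. cmod x > s}" unfolding G_def by (intro holomorphic_intros hol_s) simp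
  moreover have "(G \<longlongrightarrow> 0) at_infinity" unfolding G_def using lim by (rule LIM_zero)
  moreover have "s > 0" using s by simp
  ultimately obtain C where "C \<ge> 0" "\<And>x. cmod x \<ge> 2 * s \<Longrightarrow> cmod (G x) \<le> C / cmod x"
    "\<And>x y. cmod x \<ge> 2 * s \<Longrightarrow> cmod y \<ge> 2 * s \<Longrightarrow> cmod (G x - G y) \<le> C * cmod (x - y) / (cmod x * cmod y)"
    using holomorphic_at_infinity_estimates[of G s] by blast
  then interpret koenigs_limit M \<Lambda> x0 "2 * s" C G
    by unfold_locales (use \<Lambda> s hol_s[of "2 * s"] in \<open>auto simp: G_def algebra_simps\<close>)
  show ?thesis using that[of "max B R" P K] koenigs_coordinate_limit[of "max B R"] by simp
qed

context koenigs_coordinate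
begin

lemma \<Lambda>_pos: "cmod \<Lambda> > 0" using \<Lambda> by simp

lemma cmod_div_\<Lambda>_power: "cmod (y / \<Lambda> ^ k) = cmod y / cmod \<Lambda> ^ k"
  by (simp add: norm_divide norm_power)

lemma cmod_div_\<Lambda>_power_ge: "cmod (y / \<Lambda> ^ k) \<ge> cmod y"
proof (induction k)
  case (Suc k)
  then show ?case using norm_le_norm_div[OF \<Lambda>, of "y / \<Lambda> ^ k"] by (simp add: mult.commute)
qed simp

lemma \<Lambda>_power_tendsto_0: "(\<lambda>k. \<Lambda> ^ k * y) \<longlonglongrightarrow> 0"
  using tendsto_mult_left_zero[OF LIMSEQ_power_zero[OF \<Lambda>(2)]] .

lemma eventually_\<Lambda>_power_small:
  assumes "\<epsilon> > 0"
  shows "\<forall>\<^sub>F k in sequentially. B * cmod \<Lambda> ^ k < \<epsilon>"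
proof -
  have "(\<lambda>k. cmod \<Lambda> ^ k * B) \<longlonglongrightarrow> 0"
    using \<Lambda> by (intro tendsto_mult_left_zero LIMSEQ_realpow_zero) auto
  then show ?thesis using order_tendstoD(2)[OF _ assms] by (simp add: mult.commute)
qed

lemma eventually_div_\<Lambda>_power_large:
  assumes "y \<noteq> 0"
  shows "\<forall>\<^sub>F k in sequentially. cmod (y / \<Lambda> ^ k) > B"
proof -
  have "\<forall>\<^sub>F k in sequentially. B * cmod \<Lambda> ^ k < cmod y" using assms by (intro eventually_\<Lambda>_power_small) simp
  then show ?thesis unfolding cmod_div_\<Lambda>_power using \<Lambda>_pos by (simp add: less_divide_eq)
qed

lemma div_\<Lambda>_power_large: "y \<noteq> 0 \<Longrightarrow> \<exists>k. cmod (y / \<Lambda> ^ k) > R"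
  using eventually_happens'[OF sequentially_bot eventually_div_\<Lambda>_power_large] .

lemma P_near_1:
  assumes "cmod y > R"
  shows "cmod (P y - (y + x0)) \<le> 1"
proof -
  have "K \<le> cmod y" "cmod y > 0" using assms K R by linarith+
  then have "K / cmod y \<le> 1" by simp
  then show ?thesis using P_near[OF assms] by linarith
qed

lemma cmod_P_ge:
  assumes "cmod y > R"
  shows "cmod (P y) \<ge> cmod y - cmod x0 - 1"
  using P_near_1[OF assms] norm_triangle_ineq4[of "P y" "P y - (y + x0)"] norm_triangle_ineq4[of "y + x0" x0] by simp

lemma cmod_P_le:
  assumes "cmod y > R"
  shows "cmod (P y) \<le> cmod y + cmod x0 + 1"
  using P_near_1[OF assms] norm_triangle_ineq[of "P y - (y + x0)" "y + x0"] norm_triangle_ineq[of y x0] by simp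

lemma isCont_P: "cmod y > R \<Longrightarrow> isCont P y"
  using holomorphic_on_imp_continuous_on[OF P_holomorphic]
  unfolding continuous_on_eq_continuous_at[OF open_norm_gt] by blast

lemma P_conjugates_div:
  assumes "cmod (y / \<Lambda> ^ k) > R"
  shows "M (P (y / \<Lambda> ^ Suc k)) = P (y / \<Lambda> ^ k)"
proof -
  have "\<Lambda> * (y / \<Lambda> ^ Suc k) = y / \<Lambda> ^ k" using \<Lambda> by simp
  then show ?thesis using P_conjugates[of "y / \<Lambda> ^ Suc k"] assms by simp
qed

lemma P_attains:
  assumes x: "cmod x \<ge> R + cmod x0 + 2"
  obtains y where "cmod y > R" "P y = x"
proof -
  have large: "cmod y > R" if "y \<in> cball (x - x0) 1" for y
    using that x norm_triangle_ineq2[of "x - x0" y] norm_triangle_ineq2[of x x0] by (simp add: dist_norm)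
  have "continuous_on (cball (x - x0) 1) (\<lambda>y. P y - x0)"
    using large isCont_P by (intro continuous_intros continuous_at_imp_continuous_on) auto
  moreover have "dist (P y - x0) y \<le> 1" if "y \<in> cball (x - x0) 1" for y
    using P_near_1[OF large[OF that]] by (simp add: dist_norm algebra_simps)
  ultimately obtain y where "y \<in> cball (x - x0) 1" "P y - x0 = x - x0"
    by (rule near_identity_attains[OF zero_less_one])
  then show ?thesis using large[of y] that[of y] by simp
qed

lemma P_not_constant_on:
  assumes S: "open S" "S \<noteq> {}" "S \<subseteq> {y. cmod y > R}"
  shows "\<not> P constant_on S"
proof
  assume "P constant_on S"
  then obtain c where c: "\<And>y. y \<in> S \<Longrightarrow> P y = c" unfolding constant_on_def by blast
  obtain z where z: "z \<in> S" using S(2) by blast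
  have "connected (- cball (0 :: complex) R)" by (intro connected_complement_bounded_convex) auto
  moreover have "- cball (0 :: complex) R = {y. cmod y > R}" by auto
  ultimately have connected: "connected {y :: complex. cmod y > R}" by simp
  have "(\<lambda>y. P y - c) holomorphic_on {y. cmod y > R}" by (intro holomorphic_intros P_holomorphic)
  moreover have "z islimpt S" using islimpt_UNIV[of z] S(1) z by (metis interior_open open_imp_islimpt)
  ultimately have "P y - c = 0" if "cmod y > R" for y
    using analytic_continuation[of "\<lambda>y. P y - c" "{y. cmod y > R}" S z y] open_norm_gt connected S z c that by auto
  then have "P (of_real (R + 1)) = P (of_real (R + 4))" using R by simp
  moreover have "cmod (P (of_real (R + 1)) - (of_real (R + 1) + x0)) \<le> 1"
    "cmod (P (of_real (R + 4)) - (of_real (R + 4) + x0)) \<le> 1"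
    using R by (intro P_near_1; simp)+
  moreover have "(P (of_real (R + 1)) - (of_real (R + 1) + x0)) - (P (of_real (R + 4)) - (of_real (R + 4) + x0)) =
      3 + (P (of_real (R + 1)) - P (of_real (R + 4)))" by simp
  ultimately show False
    using norm_triangle_ineq4[of "P (of_real (R + 1)) - (of_real (R + 1) + x0)"
        "P (of_real (R + 4)) - (of_real (R + 4) + x0)"]
    by simp
qed

end

section \<open>Invariant sets in the Koenigs coordinate\<close>

locale koenigs_invariant_set = koenigs_coordinate +
  fixes X :: "complex set"
  assumes closed_X: "closed X" and interior_X: "interior X = {}"
    and M_in_X_iff: "cmod y > R \<Longrightarrow> M (P y) \<in> X \<longleftrightarrow> P y \<in> X"
begin

definition lift :: "complex set" where
  "lift = {y. y \<noteq> 0 \<and> (\<exists>k. cmod (y / \<Lambda> ^ k) > R \<and> P (y / \<Lambda> ^ k) \<in> X)}"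

lemma P_div_in_X_iff: "cmod y > R \<Longrightarrow> P (y / \<Lambda> ^ k) \<in> X \<longleftrightarrow> P y \<in> X"
proof (induction k)
  case (Suc k)
  have large: "cmod (y / \<Lambda> ^ j) > R" for j using cmod_div_\<Lambda>_power_ge[of y j] Suc.prems by linarith
  show ?case using M_in_X_iff[OF large[of "Suc k"]] P_conjugates_div[OF large[of k]] Suc by simp
qed simp

lemma lift_iff:
  assumes "cmod (y / \<Lambda> ^ k) > R"
  shows "y \<in> lift \<longleftrightarrow> P (y / \<Lambda> ^ k) \<in> X"
proof
  assume "y \<in> lift"
  then obtain l where l: "cmod (y / \<Lambda> ^ l) > R" "P (y / \<Lambda> ^ l) \<in> X" by (auto simp: lift_def)
  have "y / \<Lambda> ^ k / \<Lambda> ^ l = y / \<Lambda> ^ l / \<Lambda> ^ k" by simp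
  then show "P (y / \<Lambda> ^ k) \<in> X" using P_div_in_X_iff[OF assms, of l] P_div_in_X_iff[OF l(1), of k] l(2) by metis
next
  assume "P (y / \<Lambda> ^ k) \<in> X"
  moreover have "y \<noteq> 0" using assms R by auto
  ultimately show "y \<in> lift" using assms by (auto simp: lift_def)
qed

lemma lift_iff_P: "cmod y > R \<Longrightarrow> y \<in> lift \<longleftrightarrow> P y \<in> X"
  using lift_iff[of y 0] by simp

lemma zero_not_in_lift: "0 \<notin> lift" by (simp add: lift_def)

lemma lift_scale: "\<Lambda> ^ k * y \<in> lift \<longleftrightarrow> y \<in> lift"
proof (cases "y = 0")
  case False
  then obtain l where l: "cmod (y / \<Lambda> ^ l) > R" using div_\<Lambda>_power_large by blast
  have "\<Lambda> ^ k * y / \<Lambda> ^ (k + l) = y / \<Lambda> ^ l" using \<Lambda> by (simp add: power_add)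
  then show ?thesis using lift_iff[of "\<Lambda> ^ k * y" "k + l"] lift_iff[OF l] l by simp
qed (use zero_not_in_lift in auto)

lemma closure_lift:
  assumes y: "y \<in> closure lift" "y \<noteq> 0"
  shows "y \<in> lift"
proof -
  obtain s where s: "\<And>j. s j \<in> lift" "s \<longlonglongrightarrow> y" using y(1) unfolding closure_sequential by blast
  obtain k where k: "cmod (y / \<Lambda> ^ k) > R" using div_\<Lambda>_power_large[OF y(2)] by blast
  have lim: "(\<lambda>j. s j / \<Lambda> ^ k) \<longlonglongrightarrow> y / \<Lambda> ^ k" using \<Lambda> by (intro tendsto_intros s(2)) auto
  then have "\<forall>\<^sub>F j in sequentially. R < cmod (s j / \<Lambda> ^ k)" using k by (rule order_tendstoD(1)[OF tendsto_norm])
  then have "\<forall>\<^sub>F j in sequentially. P (s j / \<Lambda> ^ k) \<in> X"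
    by (rule eventually_mono) (use lift_iff s(1) in blast)
  moreover have "(\<lambda>j. P (s j / \<Lambda> ^ k)) \<longlonglongrightarrow> P (y / \<Lambda> ^ k)" using isCont_tendsto_compose[OF isCont_P[OF k] lim] .
  ultimately have "P (y / \<Lambda> ^ k) \<in> X" using closed_X by (metis Lim_in_closed_set sequentially_bot)
  then show ?thesis using lift_iff[OF k] by simp
qed

lemma interior_lift: "interior lift = {}"
proof (rule ccontr)
  assume "interior lift \<noteq> {}"
  then obtain y where y: "y \<in> interior lift" by blast
  then have "y \<noteq> 0" using zero_not_in_lift interior_subset by blast
  then obtain k where k: "cmod (y / \<Lambda> ^ k) > R" using div_\<Lambda>_power_large by blast
  define S where "S = {w. cmod w > R} \<inter> (\<lambda>w. \<Lambda> ^ k * w) -` interior lift"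
  have "open S" unfolding S_def by (intro open_Int open_norm_gt open_vimage open_interior continuous_intros)
  moreover have nonempty: "y / \<Lambda> ^ k \<in> S" using k y \<Lambda> by (simp add: S_def)
  moreover have "S \<subseteq> {w. cmod w > R}" by (auto simp: S_def)
  ultimately have "open (P ` S)"
    using P_not_constant_on by (intro open_mapping_thm2[OF P_holomorphic open_norm_gt]) auto
  moreover have "P ` S \<subseteq> X" using interior_subset lift_iff_P lift_scale by (fastforce simp: S_def)
  ultimately have "P ` S \<subseteq> interior X" by (rule interior_maximal[rotated])
  then show False using interior_X nonempty by auto
qed

definition "R' = R + 4 * cmod x0 + 4"

lemma near_rotation:
  assumes \<beta>: "cmod \<beta> = 1" "\<And>x. x \<in> X \<Longrightarrow> \<beta> * x \<in> X" and y: "y \<in> lift" "cmod y \<ge> R'"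
  shows "\<exists>y'\<in>lift. cmod (y' - (\<beta> * y + (\<beta> - 1) * x0)) \<le> 3 * K / cmod y"
proof -
  have y_large: "cmod y > R" "cmod y \<ge> 4 * cmod x0 + 4" "cmod y > 0"
    using y(2) norm_ge_zero[of x0] R unfolding R'_def by linarith+
  define x where "x = \<beta> * P y"
  have x_in: "x \<in> X" unfolding x_def using lift_iff_P[OF y_large(1)] y(1) \<beta>(2) by blast
  have norm_x: "cmod x = cmod (P y)" using \<beta>(1) by (simp add: x_def norm_mult)
  then have "cmod x \<ge> R + cmod x0 + 2"
    using cmod_P_ge[OF y_large(1)] y(2) norm_ge_zero[of x0] unfolding R'_def by linarith
  then obtain y' where y': "cmod y' > R" "P y' = x" using P_attains by blast
  have "cmod y' \<ge> cmod y / 2"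
    using cmod_P_ge[OF y_large(1)] cmod_P_le[OF y'(1)] y'(2) norm_x y_large(2) by simp
  then have "K / cmod y' \<le> K / (cmod y / 2)" using y_large(3) K by (intro divide_left_mono mult_pos_pos) auto
  then have near: "cmod (P y' - (y' + x0)) \<le> 2 * K / cmod y" using P_near[OF y'(1)] by (simp add: mult.commute)
  have "y' - (\<beta> * y + (\<beta> - 1) * x0) = \<beta> * (P y - (y + x0)) - (P y' - (y' + x0))"
    unfolding y'(2) by (simp add: x_def algebra_simps)
  then have "cmod (y' - (\<beta> * y + (\<beta> - 1) * x0)) \<le> cmod (\<beta> * (P y - (y + x0))) + cmod (P y' - (y' + x0))"
    by (simp only: norm_triangle_ineq4)
  also have "\<dots> \<le> K / cmod y + 2 * K / cmod y"
    using near P_near[OF y_large(1)] \<beta>(1) by (intro add_mono) (simp_all add: norm_mult)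
  also have "\<dots> = 3 * K / cmod y" by (simp add: add_divide_distrib[symmetric])
  finally show ?thesis using lift_iff_P[OF y'(1)] y'(2) x_in by blast
qed

lemma lift_rotate:
  assumes \<beta>: "cmod \<beta> = 1" "\<And>x. x \<in> X \<Longrightarrow> \<beta> * x \<in> X" and y: "y \<in> lift"
  shows "\<beta> * y \<in> lift"
proof (rule closure_lift)
  have y0: "y \<noteq> 0" using y zero_not_in_lift by blast
  then show "\<beta> * y \<noteq> 0" using \<beta>(1) by auto
  define B where "B = 3 * K + 2 * cmod x0"
  show "\<beta> * y \<in> closure lift"
    unfolding closure_approachable
  proof (intro allI impI)
    fix \<epsilon> :: real assume "\<epsilon> > 0"
    then obtain k where k: "cmod (y / \<Lambda> ^ k) > R'" "B * cmod \<Lambda> ^ k < \<epsilon>"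
      using eventually_happens'[OF sequentially_bot eventually_conj[OF eventually_div_\<Lambda>_power_large[OF y0]
            eventually_\<Lambda>_power_small]] by blast
    define u where "u = y / \<Lambda> ^ k"
    have yu: "y = \<Lambda> ^ k * u" using \<Lambda> by (simp add: u_def)
    have "u \<in> lift" using y lift_scale[of k u] unfolding yu[symmetric] by blast
    moreover have "cmod u > R'" using k(1) by (simp add: u_def)
    moreover have "R' \<ge> 1" unfolding R'_def using R norm_ge_zero[of x0] by linarith
    ultimately have u: "u \<in> lift" "cmod u \<ge> R'" "cmod u \<ge> 1" by simp_all
    obtain y' where y': "y' \<in> lift" "cmod (y' - (\<beta> * u + (\<beta> - 1) * x0)) \<le> 3 * K / cmod u"
      using near_rotation[OF \<beta> u(1,2)] by blast
    have "3 * K / cmod u \<le> 3 * K / 1" using K(1) u(3) by (intro divide_left_mono) auto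
    moreover have "cmod ((\<beta> - 1) * x0) \<le> 2 * cmod x0"
      using norm_triangle_ineq4[of \<beta> 1] \<beta>(1) by (simp add: norm_mult mult_right_mono)
    moreover have "cmod (y' - \<beta> * u) \<le> cmod (y' - (\<beta> * u + (\<beta> - 1) * x0)) + cmod ((\<beta> - 1) * x0)"
      using norm_triangle_ineq[of "y' - (\<beta> * u + (\<beta> - 1) * x0)" "(\<beta> - 1) * x0"] by (simp add: algebra_simps)
    ultimately have "cmod (y' - \<beta> * u) \<le> B" using y'(2) unfolding B_def by linarith
    moreover have "\<Lambda> ^ k * y' - \<beta> * y = \<Lambda> ^ k * (y' - \<beta> * u)" by (simp add: yu algebra_simps)
    ultimately have "dist (\<Lambda> ^ k * y') (\<beta> * y) \<le> cmod \<Lambda> ^ k * B"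
      by (simp add: dist_norm norm_mult norm_power mult_left_mono)
    then show "\<exists>w\<in>lift. dist w (\<beta> * y) < \<epsilon>"
      using k(2) lift_scale[of k y'] y'(1) by (intro bexI[of _ "\<Lambda> ^ k * y'"]) (auto simp: mult.commute)
  qed
qed

end

section \<open>From approximate translations to a flow\<close>

lemma approximate_translation_chain:
  fixes S :: "'a :: real_normed_vector set" and u v :: 'a
  assumes step: "\<And>z. z \<in> S \<Longrightarrow> norm z \<ge> \<delta> \<Longrightarrow> \<exists>z'\<in>S. norm (z' - (z + u)) \<le> \<eta> * r"
    and direction: "norm (u - r *\<^sub>R v) \<le> \<eta> * r"
    and away: "\<And>t. 0 \<le> t \<Longrightarrow> t \<le> \<tau> \<Longrightarrow> norm (y + t *\<^sub>R v) \<ge> 2 * \<delta>"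
    and r: "r \<ge> 0" "real n * r \<le> \<tau>" and \<eta>: "\<eta> \<ge> 0" "2 * \<eta> * \<tau> \<le> \<delta>" and y: "y \<in> S"
  shows "\<exists>z\<in>S. norm (z - (y + (real n * r) *\<^sub>R v)) \<le> 2 * \<eta> * (real n * r)"
proof -
  have "i \<le> n \<Longrightarrow> \<exists>z\<in>S. norm (z - (y + (real i * r) *\<^sub>R v)) \<le> 2 * \<eta> * (real i * r)" for i
  proof (induction i)
    case 0
    then show ?case using y by auto
  next
    case (Suc i)
    define w where "w = y + (real i * r) *\<^sub>R v"
    obtain z where z: "z \<in> S" "norm (z - w) \<le> 2 * \<eta> * (real i * r)" using Suc by (auto simp: w_def)
    have "real i * r \<le> real n * r" using Suc.prems r by (intro mult_right_mono) auto
    then have ir: "real i * r \<le> \<tau>" using r(2) by linarith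
    then have "2 * \<eta> * (real i * r) \<le> 2 * \<eta> * \<tau>" using \<eta> by (intro mult_left_mono) auto
    moreover have "norm w \<ge> 2 * \<delta>" unfolding w_def using ir r by (intro away) auto
    moreover have "norm w \<le> norm z + norm (z - w)" using norm_triangle_ineq4[of z "z - w"] by simp
    ultimately have "norm z \<ge> \<delta>" using z(2) \<eta>(2) by linarith
    then obtain z' where z': "z' \<in> S" "norm (z' - (z + u)) \<le> \<eta> * r" using step[OF z(1)] by blast
    have "z' - (y + (real (Suc i) * r) *\<^sub>R v) = (z' - (z + u)) + (z - w) + (u - r *\<^sub>R v)"
      by (simp add: w_def algebra_simps)
    then have "norm (z' - (y + (real (Suc i) * r) *\<^sub>R v)) \<le> norm (z' - (z + u)) + norm (z - w) + norm (u - r *\<^sub>R v)"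
      by (metis norm_triangle_le norm_triangle_mono order_refl)
    also have "\<dots> \<le> 2 * \<eta> * (real (Suc i) * r)" using z(2) z'(2) direction by (simp add: algebra_simps)
    finally show ?case using z'(1) by blast
  qed
  then show ?thesis by blast
qed

lemma segment_away_from_zero:
  fixes y v :: "'a :: real_normed_vector"
  assumes "\<tau> \<ge> 0" and avoids: "\<And>t. 0 \<le> t \<Longrightarrow> t \<le> \<tau> \<Longrightarrow> y + t *\<^sub>R v \<noteq> 0"
  obtains \<delta> where "\<delta> > 0" "\<And>t. 0 \<le> t \<Longrightarrow> t \<le> \<tau> \<Longrightarrow> norm (y + t *\<^sub>R v) \<ge> 2 * \<delta>"
proof -
  have "continuous_on {0..\<tau>} (\<lambda>t. norm (y + t *\<^sub>R v))" by (intro continuous_intros)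
  moreover have "{0..\<tau>} \<noteq> {}" using assms(1) by simp
  ultimately obtain s where s: "s \<in> {0..\<tau>}" "\<And>t. t \<in> {0..\<tau>} \<Longrightarrow> norm (y + s *\<^sub>R v) \<le> norm (y + t *\<^sub>R v)"
    using continuous_attains_inf[OF compact_Icc] by blast
  show ?thesis by (rule that[of "norm (y + s *\<^sub>R v) / 2"]) (use s avoids in auto)
qed

lemma approximate_translations_imp_flow:
  fixes S :: "'a :: real_normed_vector set" and u :: "nat \<Rightarrow> 'a"
  assumes u: "u \<longlonglongrightarrow> 0" "\<And>k. u k \<noteq> 0" and direction: "(\<lambda>k. u k /\<^sub>R norm (u k)) \<longlonglongrightarrow> v"
    and approx: "\<And>\<delta> \<epsilon>. \<delta> > 0 \<Longrightarrow> \<epsilon> > 0 \<Longrightarrow> \<forall>\<^sub>F k in sequentially. \<forall>z\<in>S. norm z \<ge> \<delta> \<longrightarrow>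
      (\<exists>z'\<in>S. norm (z' - (z + u k)) \<le> \<epsilon> * norm (u k))"
    and y: "y \<in> S" and \<tau>: "\<tau> \<ge> 0" and avoids: "\<And>t. 0 \<le> t \<Longrightarrow> t \<le> \<tau> \<Longrightarrow> y + t *\<^sub>R v \<noteq> 0"
  shows "y + \<tau> *\<^sub>R v \<in> closure S"
  unfolding closure_approachable
proof (intro allI impI)
  fix \<epsilon> :: real assume \<epsilon>: "\<epsilon> > 0"
  obtain \<delta> where \<delta>: "\<delta> > 0" and away: "\<And>t. 0 \<le> t \<Longrightarrow> t \<le> \<tau> \<Longrightarrow> norm (y + t *\<^sub>R v) \<ge> 2 * \<delta>"
    using segment_away_from_zero[OF \<tau> avoids] by blast
  define \<eta> where "\<eta> = min \<delta> \<epsilon> / (2 * \<tau> + 2)"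
  have \<eta>: "\<eta> > 0" using \<delta> \<epsilon> \<tau> by (simp add: \<eta>_def)
  have "\<eta> * (2 * \<tau> + 2) = min \<delta> \<epsilon>" using \<tau> by (simp add: \<eta>_def)
  then have "2 * \<eta> * \<tau> + 2 * \<eta> = min \<delta> \<epsilon>" by (simp add: algebra_simps)
  then have \<eta>_small: "2 * \<eta> * \<tau> \<le> \<delta>" "2 * \<eta> * \<tau> + \<eta> < \<epsilon>" using \<eta> by linarith+
  have "(\<lambda>k. norm (u k /\<^sub>R norm (u k))) \<longlonglongrightarrow> norm v" using direction by (rule tendsto_norm)
  then have v: "norm v = 1" using u(2) by (simp add: LIMSEQ_const_iff)
  have "\<forall>\<^sub>F k in sequentially. (\<forall>z\<in>S. norm z \<ge> \<delta> \<longrightarrow> (\<exists>z'\<in>S. norm (z' - (z + u k)) \<le> \<eta> * norm (u k))) \<and>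
      dist (u k /\<^sub>R norm (u k)) v < \<eta> \<and> dist (u k) 0 < \<eta>"
    using \<delta> \<eta> by (intro eventually_conj approx tendstoD[OF direction] tendstoD[OF u(1)])
  then obtain k where approx_k: "\<And>z. z \<in> S \<Longrightarrow> norm z \<ge> \<delta> \<Longrightarrow> \<exists>z'\<in>S. norm (z' - (z + u k)) \<le> \<eta> * norm (u k)"
    and near: "norm (u k /\<^sub>R norm (u k) - v) < \<eta>" "norm (u k) < \<eta>"
    unfolding eventually_sequentially dist_norm by auto
  define r where "r = norm (u k)"
  have r: "r > 0" "r < \<eta>" using u(2) near(2) by (simp_all add: r_def)
  have "u k - r *\<^sub>R v = r *\<^sub>R (u k /\<^sub>R r - v)" using r by (simp add: scaleR_diff_right)
  then have direction_k: "norm (u k - r *\<^sub>R v) \<le> \<eta> * r" using near(1) r by (simp add: r_def mult.commute)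
  define n where "n = nat \<lfloor>\<tau> / r\<rfloor>"
  have "\<tau> / r \<ge> 0" using \<tau> r by simp
  then have "real n \<le> \<tau> / r" "\<tau> / r < real n + 1" unfolding n_def by linarith+
  then have n: "real n * r \<le> \<tau>" "\<tau> - real n * r < r" using r by (simp_all add: field_simps)
  obtain z where z: "z \<in> S" "norm (z - (y + (real n * r) *\<^sub>R v)) \<le> 2 * \<eta> * (real n * r)"
    using approximate_translation_chain[OF approx_k[folded r_def] direction_k away _ n(1) _ \<eta>_small(1) y] r \<eta> by auto
  have error: "2 * \<eta> * (real n * r) \<le> 2 * \<eta> * \<tau>" using n \<eta> by simp
  have split: "z - (y + \<tau> *\<^sub>R v) = (z - (y + (real n * r) *\<^sub>R v)) - (\<tau> - real n * r) *\<^sub>R v"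
    by (simp add: algebra_simps)
  have "dist z (y + \<tau> *\<^sub>R v) \<le> norm (z - (y + (real n * r) *\<^sub>R v)) + (\<tau> - real n * r)"
    unfolding dist_norm split
    using norm_triangle_ineq4[of "z - (y + (real n * r) *\<^sub>R v)" "(\<tau> - real n * r) *\<^sub>R v"] n v by simp
  then have "dist z (y + \<tau> *\<^sub>R v) < \<epsilon>" using error z(2) n(2) r(2) \<eta>_small(2) by linarith
  then show "\<exists>z\<in>S. dist z (y + \<tau> *\<^sub>R v) < \<epsilon>" using z(1) by blast
qed

section \<open>The flow generated by an extra rotation\<close>

definition punctured_flow_invariant :: "complex \<Rightarrow> complex set \<Rightarrow> bool" where
  "punctured_flow_invariant v S \<longleftrightarrow> (\<forall>y\<in>S. \<forall>t. (\<forall>s\<in>{0..1}. y + of_real (s * t) * v \<noteq> 0) \<longrightarrow> y + of_real t * v \<in> S)"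

locale koenigs_extra_rotation = koenigs_invariant_set +
  fixes \<alpha> :: complex
  assumes \<alpha>: "cmod \<alpha> = 1" "\<alpha> \<noteq> 1" and X_rotate: "\<alpha> * x \<in> X \<longleftrightarrow> x \<in> X" and x0: "x0 \<noteq> 0"
begin

definition "c = (\<alpha> - 1) * x0"

lemma c_nonzero: "c \<noteq> 0" using \<alpha> x0 by (simp add: c_def)

lemma \<alpha>_nonzero: "\<alpha> \<noteq> 0" using \<alpha> by auto

lemma cmod_inverse_\<alpha>: "cmod (inverse \<alpha>) = 1" using \<alpha> by (simp add: norm_inverse)

lemma X_rotate_forward: "x \<in> X \<Longrightarrow> \<alpha> * x \<in> X" using X_rotate by blast

lemma X_rotate_backward: "x \<in> X \<Longrightarrow> inverse \<alpha> * x \<in> X"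
  using X_rotate[of "inverse \<alpha> * x"] \<alpha>_nonzero by (simp add: mult.assoc[symmetric])

lemma near_translation:
  assumes y: "y \<in> lift" "cmod y \<ge> R'" and \<sigma>: "\<sigma> \<in> {1, - 1}"
  shows "\<exists>y'\<in>lift. cmod (y' - (y + \<sigma> * c)) \<le> 3 * K / cmod y"
proof (cases "\<sigma> = 1")
  case True
  have "inverse \<alpha> * y \<in> lift" by (rule lift_rotate[OF cmod_inverse_\<alpha> X_rotate_backward y(1)])
  moreover have "cmod (inverse \<alpha> * y) = cmod y" using cmod_inverse_\<alpha> by (simp only: norm_mult mult_1)
  ultimately obtain y' where "y' \<in> lift" "cmod (y' - (\<alpha> * (inverse \<alpha> * y) + (\<alpha> - 1) * x0)) \<le> 3 * K / cmod y"
    using near_rotation[OF \<alpha>(1) X_rotate_forward, of "inverse \<alpha> * y"] y(2) by metis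
  then show ?thesis using True \<alpha>_nonzero by (auto simp: c_def mult.assoc[symmetric])
next
  case False
  then have \<sigma>: "\<sigma> = - 1" using \<sigma> by simp
  obtain y' where y': "y' \<in> lift" "cmod (y' - (inverse \<alpha> * y + (inverse \<alpha> - 1) * x0)) \<le> 3 * K / cmod y"
    using near_rotation[OF cmod_inverse_\<alpha> X_rotate_backward y] by blast
  have "\<alpha> * y' \<in> lift" by (rule lift_rotate[OF \<alpha>(1) X_rotate_forward y'(1)])
  moreover have "\<alpha> * (y' - (inverse \<alpha> * y + (inverse \<alpha> - 1) * x0)) =
      \<alpha> * y' - ((\<alpha> * inverse \<alpha>) * y + (\<alpha> * inverse \<alpha> - \<alpha>) * x0)"
    by (simp only: right_diff_distrib distrib_left left_diff_distrib mult.assoc mult_1 mult_1_right)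
  then have "\<alpha> * y' - (y + \<sigma> * c) = \<alpha> * (y' - (inverse \<alpha> * y + (inverse \<alpha> - 1) * x0))"
    using \<alpha>_nonzero \<sigma> by (simp add: c_def algebra_simps)
  then have "cmod (\<alpha> * y' - (y + \<sigma> * c)) \<le> 3 * K / cmod y" using y'(2) \<alpha>(1) by (simp add: norm_mult)
  ultimately show ?thesis by blast
qed

lemma near_translation_scaled:
  assumes y: "y \<in> lift" "cmod y \<ge> R' * cmod \<Lambda> ^ k" and \<sigma>: "\<sigma> \<in> {1, - 1}"
  shows "\<exists>y'\<in>lift. cmod (y' - (y + \<sigma> * (\<Lambda> ^ k * c))) \<le> 3 * K * cmod \<Lambda> ^ k * cmod \<Lambda> ^ k / cmod y"
proof -
  define u where "u = y / \<Lambda> ^ k"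
  have yu: "y = \<Lambda> ^ k * u" using \<Lambda> by (simp add: u_def)
  have "u \<in> lift" using y(1) lift_scale[of k u] unfolding yu[symmetric] by blast
  moreover have "cmod u \<ge> R'" unfolding u_def cmod_div_\<Lambda>_power using y(2) \<Lambda>_pos by (simp add: le_divide_eq)
  ultimately obtain y' where y': "y' \<in> lift" "cmod (y' - (u + \<sigma> * c)) \<le> 3 * K / cmod u"
    using near_translation[OF _ _ \<sigma>] by blast
  have "\<Lambda> ^ k * y' - (y + \<sigma> * (\<Lambda> ^ k * c)) = \<Lambda> ^ k * (y' - (u + \<sigma> * c))"
    by (simp add: yu algebra_simps)
  then have "cmod (\<Lambda> ^ k * y' - (y + \<sigma> * (\<Lambda> ^ k * c))) = cmod \<Lambda> ^ k * cmod (y' - (u + \<sigma> * c))"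
    by (simp add: norm_mult norm_power)
  also have "\<dots> \<le> cmod \<Lambda> ^ k * (3 * K / cmod u)" using y'(2) by (intro mult_left_mono) auto
  also have "\<dots> = 3 * K * cmod \<Lambda> ^ k * cmod \<Lambda> ^ k / cmod y"
    unfolding u_def cmod_div_\<Lambda>_power by (simp add: mult_ac)
  finally show ?thesis using y'(1) lift_scale[of k y'] by blast
qed

lemma lift_eventually_near_translation:
  assumes \<delta>: "\<delta> > 0" and \<epsilon>: "\<epsilon> > 0" and \<sigma>: "\<sigma> \<in> {1, - 1}"
  shows "\<forall>\<^sub>F k in sequentially. \<forall>z\<in>lift. cmod z \<ge> \<delta> \<longrightarrow>
    (\<exists>z'\<in>lift. cmod (z' - (z + \<sigma> * (\<Lambda> ^ k * c))) \<le> \<epsilon> * cmod (\<sigma> * (\<Lambda> ^ k * c)))"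
proof -
  have "\<delta> * (\<epsilon> * cmod c) > 0" using \<delta> \<epsilon> c_nonzero by simp
  from eventually_\<Lambda>_power_small[OF \<delta>, of R'] eventually_\<Lambda>_power_small[OF this, of "3 * K"]
  show ?thesis
  proof eventually_elim
    case (elim k)
    show ?case
    proof (intro ballI impI)
      fix z assume z: "z \<in> lift" "cmod z \<ge> \<delta>"
      then obtain z' where z': "z' \<in> lift"
        "cmod (z' - (z + \<sigma> * (\<Lambda> ^ k * c))) \<le> 3 * K * cmod \<Lambda> ^ k * cmod \<Lambda> ^ k / cmod z"
        using near_translation_scaled[OF z(1) _ \<sigma>, of k] elim(1) by auto
      have "3 * K * cmod \<Lambda> ^ k * cmod \<Lambda> ^ k / cmod z \<le> 3 * K * cmod \<Lambda> ^ k * cmod \<Lambda> ^ k / \<delta>"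
        using z(2) \<delta> K by (intro divide_left_mono mult_nonneg_nonneg mult_pos_pos) auto
      also have "\<dots> \<le> \<delta> * (\<epsilon> * cmod c) * cmod \<Lambda> ^ k / \<delta>"
        using elim(2) \<delta> by (intro divide_right_mono mult_right_mono) auto
      also have "\<dots> = \<epsilon> * cmod (\<sigma> * (\<Lambda> ^ k * c))" using \<delta> \<sigma> by (auto simp: norm_mult norm_power)
      finally show "\<exists>z'\<in>lift. cmod (z' - (z + \<sigma> * (\<Lambda> ^ k * c))) \<le> \<epsilon> * cmod (\<sigma> * (\<Lambda> ^ k * c))"
        using z' by (intro bexI[of _ z']) auto
    qed
  qed
qed

lemma lift_flow_invariant:
  obtains v where "cmod v = 1" "punctured_flow_invariant v lift"
proof -
  obtain v s where v: "cmod v = 1" and s: "strict_mono (s :: nat \<Rightarrow> nat)"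
    and direction: "(\<lambda>k. (\<Lambda> ^ s k * c) /\<^sub>R cmod (\<Lambda> ^ s k * c)) \<longlonglongrightarrow> v"
    using normalised_subsequence[of "\<lambda>k. \<Lambda> ^ k * c"] \<Lambda> c_nonzero by auto
  have flow: "y + \<tau> *\<^sub>R (\<sigma> * v) \<in> lift"
    if \<sigma>: "\<sigma> \<in> {1, - 1}" and y: "y \<in> lift" and \<tau>: "\<tau> \<ge> 0"
      and avoids: "\<And>t. 0 \<le> t \<Longrightarrow> t \<le> \<tau> \<Longrightarrow> y + t *\<^sub>R (\<sigma> * v) \<noteq> 0" for \<sigma> y \<tau>
  proof (rule closure_lift)
    show "y + \<tau> *\<^sub>R (\<sigma> * v) \<in> closure lift"
    proof (rule approximate_translations_imp_flow[of "\<lambda>k. \<sigma> * (\<Lambda> ^ s k * c)", OF _ _ _ _ y \<tau> avoids])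
      show "(\<lambda>k. \<sigma> * (\<Lambda> ^ s k * c)) \<longlonglongrightarrow> 0"
        using tendsto_mult_right_zero[OF LIMSEQ_subseq_LIMSEQ[OF \<Lambda>_power_tendsto_0 s]] by (simp add: o_def)
      show "\<sigma> * (\<Lambda> ^ s k * c) \<noteq> 0" for k using \<sigma> \<Lambda> c_nonzero by auto
      have "(\<lambda>k. \<sigma> * ((\<Lambda> ^ s k * c) /\<^sub>R cmod (\<Lambda> ^ s k * c))) \<longlonglongrightarrow> \<sigma> * v"
        by (intro tendsto_intros direction)
      then show "(\<lambda>k. (\<sigma> * (\<Lambda> ^ s k * c)) /\<^sub>R cmod (\<sigma> * (\<Lambda> ^ s k * c))) \<longlonglongrightarrow> \<sigma> * v"
        using \<sigma> by (auto simp: norm_mult)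
      show "\<forall>\<^sub>F k in sequentially. \<forall>z\<in>lift. cmod z \<ge> \<delta> \<longrightarrow>
          (\<exists>z'\<in>lift. cmod (z' - (z + \<sigma> * (\<Lambda> ^ s k * c))) \<le> \<epsilon> * cmod (\<sigma> * (\<Lambda> ^ s k * c)))"
        if "\<delta> > 0" "\<epsilon> > 0" for \<delta> \<epsilon>
        using eventually_subseq[OF s lift_eventually_near_translation[OF that \<sigma>]] .
    qed
  qed (use avoids[OF \<tau> order_refl] in simp)
  have "punctured_flow_invariant v lift"
    unfolding punctured_flow_invariant_def
  proof (intro ballI allI impI)
    fix y t assume y: "y \<in> lift" and avoids: "\<forall>s\<in>{0..1}. y + of_real (s * t) * v \<noteq> 0"
    define \<sigma> :: complex where "\<sigma> = (if t \<ge> 0 then 1 else - 1)"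
    have "y + \<bar>t\<bar> *\<^sub>R (\<sigma> * v) \<in> lift"
    proof (rule flow[OF _ y])
      fix r :: real assume r: "0 \<le> r" "r \<le> \<bar>t\<bar>"
      show "y + r *\<^sub>R (\<sigma> * v) \<noteq> 0"
        using bspec[OF avoids, of "r / \<bar>t\<bar>"] bspec[OF avoids, of 0] r
        by (cases "t = 0") (auto simp: \<sigma>_def scaleR_conv_of_real divide_le_eq split: if_splits)
    qed (auto simp: \<sigma>_def)
    then show "y + of_real t * v \<in> lift" by (simp add: \<sigma>_def scaleR_conv_of_real split: if_splits)
  qed
  then show ?thesis using v that by blast
qed

lemma lift_contains_ray:
  assumes v: "v \<noteq> 0" and inv: "punctured_flow_invariant v lift"
    and \<sigma>: "\<sigma> \<in> {1, - 1 :: complex}" and nonempty: "lift \<noteq> {}"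
  obtains y where "\<And>t. t \<ge> 0 \<Longrightarrow> y + of_real t * (\<sigma> * v) \<in> lift"
proof -
  have ray: "y + of_real t * (\<sigma> * v) \<in> lift"
    if y: "y \<in> lift" and off_ray: "\<And>t. t \<ge> 0 \<Longrightarrow> y \<noteq> - of_real t * (\<sigma> * v)" and t: "t \<ge> 0" for y t
  proof -
    define u where "u = (if \<sigma> = 1 then t else - t)"
    have u: "of_real (s * u) * v = of_real (s * t) * (\<sigma> * v)" for s using \<sigma> by (auto simp: u_def)
    have "y + of_real (s * u) * v \<noteq> 0" if "s \<in> {0..1}" for s
      using off_ray[of "s * t"] that t unfolding u by (auto simp: add_eq_0_iff2)
    then have "y + of_real u * v \<in> lift" using inv y unfolding punctured_flow_invariant_def by blast
    moreover have "of_real u * v = of_real t * (\<sigma> * v)" using u[of 1] by (simp only: mult_1)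
    ultimately show ?thesis by (simp only:)
  qed
  obtain y where y: "y \<in> lift" using nonempty by auto
  show ?thesis
  proof (cases "\<exists>t\<ge>0. y = - of_real t * (\<sigma> * v)")
    case False
    then show ?thesis using ray[OF y] that by blast
  next
    case True
    then obtain t where t: "t \<ge> 0" "y = - of_real t * (\<sigma> * v)" by blast
    have nonzero: "\<sigma> * v \<noteq> 0" "t \<noteq> 0" using \<sigma> v t(2) y zero_not_in_lift by auto
    have "\<alpha> * y \<noteq> - of_real t' * (\<sigma> * v)" if "t' \<ge> 0" for t'
    proof
      assume "\<alpha> * y = - of_real t' * (\<sigma> * v)"
      then have rotated: "\<alpha> * of_real t = of_real t'" using t(2) nonzero by simp
      then have "cmod (\<alpha> * of_real t) = cmod (of_real t')" by (rule arg_cong)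
      then have "t = t'" using \<alpha>(1) t(1) that by (simp add: norm_mult)
      then show False using rotated nonzero \<alpha>(2) by simp
    qed
    then show ?thesis using ray[OF lift_rotate[OF \<alpha>(1) X_rotate_forward y]] that by blast
  qed
qed

end

section \<open>Arcs in several directions\<close>

lemma continuous_root_at_top:
  fixes f :: "real \<Rightarrow> complex"
  assumes D: "D > 0" and cont: "continuous_on {b..} f" and \<nu>: "\<nu> \<noteq> 0" and lim: "(f \<longlongrightarrow> \<nu> ^ D) at_top"
  obtains T g where "T \<ge> b" "continuous_on {T..} g" "(g \<longlongrightarrow> \<nu>) at_top"
    "\<And>t. t \<ge> T \<Longrightarrow> g t \<noteq> 0 \<and> g t ^ D = f t"
proof -
  define w where "w = (\<lambda>t. f t / \<nu> ^ D)"
  define g where "g = (\<lambda>t. \<nu> * exp (Ln (w t) / of_nat D))"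
  have w_lim: "(w \<longlongrightarrow> 1) at_top" unfolding w_def using tendsto_divide[OF lim tendsto_const, of "\<nu> ^ D"] \<nu> by simp
  then have "\<forall>\<^sub>F t in at_top. dist (w t) 1 < 1" by (rule tendstoD) simp
  then obtain t0 where t0: "\<And>t. t \<ge> t0 \<Longrightarrow> dist (w t) 1 < 1" unfolding eventually_at_top_linorder by blast
  define T where "T = max t0 b"
  have w: "w t \<notin> \<real>\<^sub>\<le>\<^sub>0" "w t \<noteq> 0" if "t \<ge> T" for t
  proof -
    have "\<bar>Re (w t - 1)\<bar> < 1" using t0[of t] that abs_Re_le_cmod[of "w t - 1"] by (simp add: T_def dist_norm)
    then have "Re (w t) > 0" by simp
    then show "w t \<notin> \<real>\<^sub>\<le>\<^sub>0" "w t \<noteq> 0" by (auto simp: complex_nonpos_Reals_iff)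
  qed
  have "continuous_on {T..} w"
    unfolding w_def using \<nu> by (intro continuous_intros continuous_on_subset[OF cont]) (auto simp: T_def)
  then have "continuous_on {T..} g"
    unfolding g_def using w D by (intro continuous_intros continuous_on_Ln) auto
  moreover have "((\<lambda>t. Ln (w t)) \<longlongrightarrow> Ln 1) at_top" using w_lim by (intro tendsto_Ln) auto
  then have "(g \<longlongrightarrow> \<nu> * exp (Ln 1 / of_nat D)) at_top"
    unfolding g_def using D by (intro tendsto_mult tendsto_const tendsto_exp tendsto_divide) auto
  moreover have "g t \<noteq> 0 \<and> g t ^ D = f t" if "t \<ge> T" for t
  proof -
    have "exp (Ln (w t) / of_nat D) ^ D = w t" using D w[OF that] by (simp flip: exp_of_nat_mult)
    then show ?thesis using \<nu> by (simp add: g_def power_mult_distrib w_def)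
  qed
  ultimately show ?thesis using that[of T g] by (simp add: T_def)
qed

lemma root_branch_at_infinity:
  fixes x :: "real \<Rightarrow> complex"
  assumes D: "D > 0" and cont: "continuous_on {b..} x" and s: "s \<noteq> 0"
    and lim: "((\<lambda>t. x t / of_real t) \<longlongrightarrow> s) at_top" and \<nu>: "\<nu> ^ D = 1 / s"
  obtains T q where "T > 0" "T \<ge> b" "continuous_on {T..} q" "\<And>t. t \<ge> T \<Longrightarrow> q t \<noteq> 0 \<and> x t = 1 / q t ^ D"
    "(q \<longlongrightarrow> 0) at_top" "((\<lambda>t. q t / of_real (t powr (- 1 / D))) \<longlongrightarrow> \<nu>) at_top"
proof -
  have \<nu>_nonzero: "\<nu> \<noteq> 0" using \<nu> s D by (auto simp: power_0_left)
  have "continuous_on {max b 1..} (\<lambda>t. x t / of_real t)"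
    by (intro continuous_intros continuous_on_subset[OF cont]) auto
  moreover have "((\<lambda>t. x t / of_real t) \<longlongrightarrow> inverse \<nu> ^ D) at_top" using lim by (simp add: power_inverse \<nu>)
  ultimately obtain T g where T: "T \<ge> max b 1" and g: "continuous_on {T..} g" "(g \<longlongrightarrow> inverse \<nu>) at_top"
    "\<And>t. t \<ge> T \<Longrightarrow> g t \<noteq> 0 \<and> g t ^ D = x t / of_real t"
    using continuous_root_at_top[OF D, of "max b 1" "\<lambda>t. x t / of_real t" "inverse \<nu>"] \<nu>_nonzero by auto
  define r where "r = (\<lambda>t :: real. t powr (- 1 / D))"
  define q where "q = (\<lambda>t. of_real (r t) / g t)"
  have r: "r t > 0" "r t ^ D = 1 / t" if "t \<ge> T" for t
  proof -
    show "r t > 0" using that T by (simp add: r_def)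
    then have "r t ^ D = t powr (- 1 / D * D)" by (simp add: r_def powr_powr flip: powr_realpow)
    also have "\<dots> = 1 / t" using D that T by (simp add: powr_minus_divide)
    finally show "r t ^ D = 1 / t" .
  qed
  have "(r \<longlongrightarrow> 0) at_top" unfolding r_def using D by (intro tendsto_neg_powr filterlim_ident) auto
  then have "(q \<longlongrightarrow> of_real 0 / inverse \<nu>) at_top"
    unfolding q_def using \<nu>_nonzero by (intro tendsto_divide tendsto_of_real g(2)) auto
  moreover have "((\<lambda>t. q t / of_real (r t)) \<longlongrightarrow> \<nu>) at_top"
  proof (rule Lim_transform_eventually)
    show "((\<lambda>t. inverse (g t)) \<longlongrightarrow> \<nu>) at_top" using tendsto_inverse[OF g(2)] \<nu>_nonzero by simp
    show "\<forall>\<^sub>F t in at_top. inverse (g t) = q t / of_real (r t)"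
      using eventually_ge_at_top[of T] by eventually_elim (use r(1) in \<open>force simp: q_def divide_inverse\<close>)
  qed
  moreover have "continuous_on {T..} q"
    unfolding q_def r_def using T g by (intro continuous_intros) auto
  moreover have "q t \<noteq> 0 \<and> x t = 1 / q t ^ D" if "t \<ge> T" for t
    using r[OF that] g(3)[OF that] T that by (simp add: q_def power_divide flip: of_real_power)
  ultimately show ?thesis using T by (intro that[of T q]) (simp_all add: r_def)
qed

lemma curve_tangent_direction:
  fixes q :: "real \<Rightarrow> complex"
  assumes \<psi>: "(\<psi> has_field_derivative \<psi>') (at 0)" and v: "v \<noteq> 0"
    and q: "(q \<longlongrightarrow> 0) at_top" "\<forall>\<^sub>F t in at_top. q t \<noteq> 0"
    and r: "\<forall>\<^sub>F t in at_top. r t \<noteq> 0" and \<nu>: "((\<lambda>t. q t / of_real (r t)) \<longlongrightarrow> \<nu>) at_top"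
    and const: "\<forall>\<^sub>F t in at_top. Im (\<psi> (q t) / v) = b"
  shows "Im (\<psi>' * \<nu> / v) = 0"
proof -
  have q_at_0: "filterlim q (at 0) at_top" unfolding filterlim_at using q by (auto elim: eventually_mono)
  have "(\<psi> \<longlongrightarrow> \<psi> 0) (at 0)" using DERIV_isCont[OF \<psi>] by (simp add: isCont_def)
  from filterlim_compose[OF this q_at_0] have "((\<lambda>t. \<psi> (q t)) \<longlongrightarrow> \<psi> 0) at_top" .
  then have "((\<lambda>t. Im (\<psi> (q t) / v)) \<longlongrightarrow> Im (\<psi> 0 / v)) at_top" using v by (intro tendsto_intros)
  moreover have "((\<lambda>t. Im (\<psi> (q t) / v)) \<longlongrightarrow> b) at_top" using const by (rule tendsto_eventually)
  ultimately have b: "b = Im (\<psi> 0 / v)" using tendsto_unique trivial_limit_at_top_linorder by blast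
  have "((\<lambda>z. (\<psi> z - \<psi> 0) / (z - 0)) \<longlongrightarrow> \<psi>') (at 0)" using \<psi> by (simp add: has_field_derivative_iff)
  from filterlim_compose[OF this q_at_0] have "((\<lambda>t. (\<psi> (q t) - \<psi> 0) / q t) \<longlongrightarrow> \<psi>') at_top" by simp
  then have "((\<lambda>t. Im ((\<psi> (q t) - \<psi> 0) / q t * (q t / of_real (r t)) / v)) \<longlongrightarrow> Im (\<psi>' * \<nu> / v)) at_top"
    using v by (intro tendsto_intros \<nu>)
  moreover have "\<forall>\<^sub>F t in at_top. Im ((\<psi> (q t) - \<psi> 0) / q t * (q t / of_real (r t)) / v) = 0"
    using const q(2) r
  proof eventually_elim
    case (elim t)
    then have "(\<psi> (q t) - \<psi> 0) / q t * (q t / of_real (r t)) / v = (\<psi> (q t) - \<psi> 0) / v / of_real (r t)"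
      by simp
    also have "\<dots> = (\<psi> (q t) / v - \<psi> 0 / v) / of_real (r t)" by (simp only: diff_divide_distrib)
    finally show ?case using elim(1) b by (simp add: Im_divide_of_real)
  qed
  ultimately show ?thesis using tendsto_unique[OF trivial_limit_at_top_linorder _ tendsto_eventually] by blast
qed

context koenigs_extra_rotation
begin

lemma P_along_ray:
  assumes s: "cmod s = 1" and ray: "y = (\<lambda>t. y1 + of_real t * s)"
  shows "continuous_on {R + cmod y1 + 1..} (\<lambda>t. P (y t))" "((\<lambda>t. P (y t) / of_real t) \<longlongrightarrow> s) at_top"
    and "t \<ge> R + cmod y1 + 1 \<Longrightarrow> cmod (y t) > R"
proof -
  show large: "cmod (y t) > R" if "t \<ge> R + cmod y1 + 1" for t
  proof -
    have "cmod (of_real t * s) = \<bar>t\<bar>" using s by (simp add: norm_mult)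
    then show ?thesis using that norm_triangle_ineq2[of "of_real t * s" "- y1"] by (simp add: ray add.commute)
  qed
  have "continuous_on {y. cmod y > R} P" by (rule holomorphic_on_imp_continuous_on[OF P_holomorphic])
  then show "continuous_on {R + cmod y1 + 1..} (\<lambda>t. P (y t))"
    by (rule continuous_on_compose2) (use large in \<open>auto simp: ray intro!: continuous_intros\<close>)
  have "((\<lambda>t. P (y t) / of_real t - s) \<longlongrightarrow> 0) at_top"
  proof (rule Lim_null_comparison)
    show "\<forall>\<^sub>F t in at_top. norm (P (y t) / of_real t - s) \<le> (1 + cmod (y1 + x0)) / t"
      using eventually_ge_at_top[of "R + cmod y1 + 1"]
    proof eventually_elim
      case (elim t)
      have t: "t > 0" using elim R norm_ge_zero[of y1] by linarith
      have "P (y t) / of_real t - s = ((P (y t) - (y t + x0)) + (y1 + x0)) / of_real t"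
        using t by (simp add: ray field_simps)
      then have "norm (P (y t) / of_real t - s) = cmod ((P (y t) - (y t + x0)) + (y1 + x0)) / t"
        using t by (simp only: norm_divide norm_of_real abs_of_pos)
      also have "\<dots> \<le> (cmod (P (y t) - (y t + x0)) + cmod (y1 + x0)) / t"
        using t by (intro divide_right_mono norm_triangle_ineq) simp
      finally show ?case using P_near_1[OF large[OF elim]] t by (smt (verit) divide_right_mono)
    qed
    show "((\<lambda>t. (1 + cmod (y1 + x0)) / t) \<longlongrightarrow> 0) at_top"
      by (intro tendsto_divide_0[OF tendsto_const] filterlim_at_top_imp_at_infinity filterlim_ident)
  qed
  then show "((\<lambda>t. P (y t) / of_real t) \<longlongrightarrow> s) at_top" by (rule LIM_zero_cancel)
qed

lemma lift_flow_in_ball: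
  assumes inv: "punctured_flow_invariant v lift" and z: "z \<in> lift"
    and ball: "z \<in> ball \<xi> (cmod \<xi>)" "z + of_real t * v \<in> ball \<xi> (cmod \<xi>)"
  shows "z + of_real t * v \<in> lift"
proof -
  have "z + of_real (s * t) * v \<noteq> 0" if s: "s \<in> {0..1}" for s
  proof -
    have "(1 - s) *\<^sub>R z + s *\<^sub>R (z + of_real t * v) \<in> ball \<xi> (cmod \<xi>)"
      using s ball by (intro convexD[OF convex_ball]) auto
    moreover have "(1 - s) *\<^sub>R z + s *\<^sub>R (z + of_real t * v) = z + of_real (s * t) * v"
      by (simp add: scaleR_conv_of_real algebra_simps)
    ultimately show ?thesis by (auto simp: dist_norm)
  qed
  then show ?thesis using inv z unfolding punctured_flow_invariant_def by blast
qed

lemma connected_subset_lift_parallel: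
  assumes v: "v \<noteq> 0" and inv: "punctured_flow_invariant v lift"
    and S: "connected S" "S \<subseteq> lift" "S \<subseteq> ball \<xi> (cmod \<xi>)" and zw: "z \<in> S" "w \<in> S"
  shows "Im (z / v) = Im (w / v)"
  using lift_flow_in_ball[OF inv] by (rule connected_subset_parallel[OF open_ball v _ interior_lift S zw])

text \<open>The image of the ray under \<open>q \<mapsto> \<psi>(q)\<close>, \<open>P(y) = q\<^sup>-\<^sup>D\<close>, is an arc in the lift that ends at \<open>\<psi>(0)\<close> with
  tangent \<open>\<psi>'(0) \<nu>\<close>; it has to be parallel to the flow.\<close>

lemma arc_direction:
  assumes v: "v \<noteq> 0" and inv: "punctured_flow_invariant v lift"
    and D: "D > 0" and \<eta>: "\<eta> > 0" and \<psi>: "\<psi> holomorphic_on ball 0 \<eta>" "\<psi> 0 \<noteq> 0"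
    and \<psi>_lift: "\<And>q. q \<in> ball 0 \<eta> \<Longrightarrow> q \<noteq> 0 \<Longrightarrow> \<psi> q \<in> lift \<longleftrightarrow> 1 / q ^ D \<in> X"
    and s: "cmod s = 1" and ray: "\<And>t. t \<ge> 0 \<Longrightarrow> y1 + of_real t * s \<in> lift" and \<nu>: "\<nu> ^ D = 1 / s"
  shows "Im (deriv \<psi> 0 * \<nu> / v) = 0"
proof -
  define y where "y = (\<lambda>t. y1 + of_real t * s)"
  note P_y = P_along_ray[OF s y_def]
  have s_nonzero: "s \<noteq> 0" using s by auto
  obtain T q where T: "T > 0" "T \<ge> R + cmod y1 + 1" and q_cont: "continuous_on {T..} q"
    and q: "\<And>t. t \<ge> T \<Longrightarrow> q t \<noteq> 0 \<and> P (y t) = 1 / q t ^ D"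
    and q_lim: "(q \<longlongrightarrow> 0) at_top" "((\<lambda>t. q t / of_real (t powr (- 1 / D))) \<longlongrightarrow> \<nu>) at_top"
    using root_branch_at_infinity[OF D P_y(1) s_nonzero P_y(2) \<nu>] by blast
  have \<psi>_deriv: "(\<psi> has_field_derivative deriv \<psi> 0) (at 0)"
    using \<psi>(1) \<eta> by (intro holomorphic_derivI[of _ "ball 0 \<eta>"]) auto
  have "((\<lambda>t. \<psi> (q t)) \<longlongrightarrow> \<psi> 0) at_top" using isCont_tendsto_compose[OF DERIV_isCont[OF \<psi>_deriv] q_lim(1)] .
  then have "\<forall>\<^sub>F t in at_top. \<psi> (q t) \<in> ball (\<psi> 0) (cmod (\<psi> 0)) \<and> q t \<in> ball 0 \<eta>"
    using \<psi>(2) \<eta>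
    by (intro eventually_conj topological_tendstoD[OF _ open_ball] topological_tendstoD[OF q_lim(1) open_ball]) auto
  then obtain T' where T': "\<And>t. t \<ge> T' \<Longrightarrow> \<psi> (q t) \<in> ball (\<psi> 0) (cmod (\<psi> 0)) \<and> q t \<in> ball 0 \<eta>"
    unfolding eventually_at_top_linorder by blast
  define S where "S = {max T T'..}"
  have arc: "\<psi> (q t) \<in> lift" if "t \<in> S" for t
  proof -
    have t: "t \<ge> T" "t \<ge> T'" "t \<ge> 0" using that T by (auto simp: S_def)
    have "P (y t) \<in> X" using ray[OF t(3)] lift_iff_P[OF P_y(3)] t(1) T(2) by (simp add: y_def)
    then show ?thesis using q[OF t(1)] \<psi>_lift T'[OF t(2)] by auto
  qed
  have "continuous_on S (\<lambda>t. \<psi> (q t))"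
    using T' by (intro continuous_on_compose2[OF holomorphic_on_imp_continuous_on[OF \<psi>(1)]
          continuous_on_subset[OF q_cont]]) (auto simp: S_def)
  then have connected: "connected ((\<lambda>t. \<psi> (q t)) ` S)" unfolding S_def by (intro connected_continuous_image) auto
  have height_const: "Im (\<psi> (q t) / v) = Im (\<psi> (q (max T T')) / v)" if "t \<in> S" for t
  proof (rule connected_subset_lift_parallel[OF v inv connected])
    show "(\<lambda>t. \<psi> (q t)) ` S \<subseteq> ball (\<psi> 0) (cmod (\<psi> 0))" using T' unfolding S_def by force
  qed (use arc that in \<open>auto simp: S_def\<close>)
  have const: "\<forall>\<^sub>F t in at_top. Im (\<psi> (q t) / v) = Im (\<psi> (q (max T T')) / v)"
    using eventually_ge_at_top[of "max T T'"] by eventually_elim (rule height_const, simp add: S_def)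
  have q_nonzero: "\<forall>\<^sub>F t in at_top. q t \<noteq> 0" unfolding eventually_at_top_linorder using q by blast
  have "\<forall>\<^sub>F t in at_top. t powr (- 1 / D) \<noteq> 0" using eventually_gt_at_top[of 0] by eventually_elim simp
  from curve_tangent_direction[OF \<psi>_deriv v q_lim(1) q_nonzero this q_lim(2) const] show ?thesis .
qed

theorem no_branched_coordinate:
  assumes D: "D \<ge> 2" and \<eta>: "\<eta> > 0" and \<psi>: "\<psi> holomorphic_on ball 0 \<eta>" "\<psi> 0 \<noteq> 0" "deriv \<psi> 0 \<noteq> 0"
    and \<psi>_lift: "\<And>q. q \<in> ball 0 \<eta> \<Longrightarrow> q \<noteq> 0 \<Longrightarrow> \<psi> q \<in> lift \<longleftrightarrow> 1 / q ^ D \<in> X"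
    and nonempty: "lift \<noteq> {}"
  shows False
proof -
  obtain v where v: "cmod v = 1" and inv: "punctured_flow_invariant v lift" by (rule lift_flow_invariant)
  have v_nonzero: "v \<noteq> 0" using v by auto
  have D_pos: "D > 0" using D by simp
  obtain y where y: "\<And>t. t \<ge> 0 \<Longrightarrow> y + of_real t * v \<in> lift"
    using lift_contains_ray[OF v_nonzero inv _ nonempty, of 1] by auto
  obtain y' where y': "\<And>t. t \<ge> 0 \<Longrightarrow> y' + of_real t * (- v) \<in> lift"
    using lift_contains_ray[OF v_nonzero inv _ nonempty, of "- 1"] by auto
  obtain \<nu> where "1 / v = \<nu> ^ D" using exists_complex_root[of D "1 / v"] D_pos by blast
  then have \<nu>: "\<nu> ^ D = 1 / v" by simp
  define \<zeta> where "\<zeta> = cis (pi / D)"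
  have "\<zeta> ^ D = - 1" using D_pos by (simp add: \<zeta>_def Complex.DeMoivre)
  then have \<zeta>\<nu>: "(\<zeta> * \<nu>) ^ D = 1 / (- v)" by (simp add: power_mult_distrib \<nu>)
  define x where "x = deriv \<psi> 0 * \<nu> / v"
  have "Im x = 0"
    unfolding x_def by (rule arc_direction[OF v_nonzero inv D_pos \<eta> \<psi>(1,2) \<psi>_lift v y \<nu>])
  have "Im (deriv \<psi> 0 * (\<zeta> * \<nu>) / v) = 0"
    by (rule arc_direction[OF v_nonzero inv D_pos \<eta> \<psi>(1,2) \<psi>_lift _ y' \<zeta>\<nu>]) (simp_all add: v)
  then have "Im (\<zeta> * x) = 0" by (simp add: x_def mult_ac)
  then have "sin (pi / D) * Re x = 0" using \<open>Im x = 0\<close> by (simp add: \<zeta>_def)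
  moreover have "\<nu> \<noteq> 0" using \<nu> v_nonzero D_pos by (auto simp: power_0_left)
  then have "x \<noteq> 0" using \<psi>(3) v_nonzero by (simp add: x_def)
  then have "Re x \<noteq> 0" using \<open>Im x = 0\<close> by (auto simp: complex_eq_iff)
  moreover have "sin (pi / D) > 0"
  proof (rule sin_gt_zero)
    have "pi / D \<le> pi / 2" using D by (intro divide_left_mono) auto
    then show "pi / D < pi" using pi_gt_zero by linarith
  qed (use D_pos in simp)
  ultimately show False by simp
qed

end

section \<open>Extending the Koenigs coordinate\<close>

locale koenigs_domain = koenigs_coordinate +
  fixes S :: "complex set"
  assumes open_S: "open S" and M_holomorphic: "M holomorphic_on S"
begin

definition "regular k = {y. cmod y > R \<and> (\<forall>i<k. (M ^^ i) (P y) \<in> S)}"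

lemma regular_Suc: "regular (Suc k) = regular k \<inter> (\<lambda>y. (M ^^ k) (P y)) -` S"
  by (auto simp: regular_def less_Suc_eq)

lemma iterate_on_regular: "open (regular k) \<and> (\<lambda>y. (M ^^ k) (P y)) holomorphic_on regular k"
proof (induction k)
  case 0
  show ?case using open_norm_gt P_holomorphic by (simp add: regular_def)
next
  case (Suc k)
  then have "continuous_on (regular k) (\<lambda>y. (M ^^ k) (P y))" using holomorphic_on_imp_continuous_on by blast
  then have "open (regular (Suc k))" unfolding regular_Suc using Suc open_S continuous_open_preimage by blast
  moreover have "(\<lambda>y. (M ^^ k) (P y)) holomorphic_on regular (Suc k)"
    using Suc by (rule holomorphic_on_subset[OF conjunct2]) (auto simp: regular_Suc)
  from holomorphic_on_compose_gen[OF this M_holomorphic]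
  have "(\<lambda>y. (M ^^ Suc k) (P y)) holomorphic_on regular (Suc k)" by (auto simp: regular_Suc o_def)
  ultimately show ?case by blast
qed

text \<open>If no orbit leaves \<open>S\<close>, the functional equation extends \<open>P\<close> to the punctured plane.\<close>

definition "extension y = (let k = SOME k. cmod (y / \<Lambda> ^ k) > R in (M ^^ k) (P (y / \<Lambda> ^ k)))"

lemma iterate_P_div:
  assumes "cmod (y / \<Lambda> ^ k) > R"
  shows "(M ^^ (k + l)) (P (y / \<Lambda> ^ (k + l))) = (M ^^ k) (P (y / \<Lambda> ^ k))"
proof (induction l)
  case (Suc l)
  have "cmod (y / \<Lambda> ^ (k + l)) > R" using assms cmod_div_\<Lambda>_power_ge[of "y / \<Lambda> ^ k" l] by (simp add: power_add)
  then have "M (P (y / \<Lambda> ^ (k + Suc l))) = P (y / \<Lambda> ^ (k + l))" using P_conjugates_div by simp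
  then show ?case using Suc by (simp add: funpow_Suc_right del: funpow.simps)
qed simp

lemma extension_eq:
  assumes k: "cmod (y / \<Lambda> ^ k) > R"
  shows "extension y = (M ^^ k) (P (y / \<Lambda> ^ k))"
proof -
  define l where "l = (SOME l. cmod (y / \<Lambda> ^ l) > R)"
  have "cmod (y / \<Lambda> ^ l) > R" unfolding l_def using k by (rule someI)
  moreover have "extension y = (M ^^ l) (P (y / \<Lambda> ^ l))" by (simp add: extension_def l_def Let_def)
  ultimately show ?thesis using iterate_P_div[OF k, of l] iterate_P_div[of y l k] by (simp add: add.commute)
qed

lemma extension_conjugates:
  assumes "y \<noteq> 0"
  shows "extension (\<Lambda> * y) = M (extension y)"
proof -
  obtain k where k: "cmod (y / \<Lambda> ^ k) > R" using div_\<Lambda>_power_large[OF assms] by blast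
  moreover have "\<Lambda> * y / \<Lambda> ^ Suc k = y / \<Lambda> ^ k" using \<Lambda> by simp
  ultimately show ?thesis using extension_eq[OF k] extension_eq[of "\<Lambda> * y" "Suc k"] by (simp only: funpow.simps o_apply)
qed

lemma extension_holomorphic:
  assumes regular: "\<And>k. regular k = {y. cmod y > R}"
  shows "extension holomorphic_on UNIV - {0}"
proof -
  define W where "W k = {y. cmod (y / \<Lambda> ^ k) > R}" for k
  have "extension holomorphic_on W k" for k
  proof (rule holomorphic_transform)
    have "(\<lambda>y. y / \<Lambda> ^ k) holomorphic_on W k" using \<Lambda> by (intro holomorphic_intros) auto
    from holomorphic_on_compose_gen[OF this, of "\<lambda>y. (M ^^ k) (P y)" "regular k"] iterate_on_regular[of k]
    show "(\<lambda>y. (M ^^ k) (P (y / \<Lambda> ^ k))) holomorphic_on W k" by (auto simp: o_def regular W_def)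
  qed (simp add: W_def extension_eq)
  moreover have "open (W k)" for k
    unfolding W_def using \<Lambda> by (intro open_Collect_less continuous_intros) auto
  ultimately have "extension holomorphic_on (\<Union>k. W k)" by (intro holomorphic_on_UN_open) auto
  moreover have "(\<Union>k. W k) = UNIV - {0}" using div_\<Lambda>_power_large R by (auto simp: W_def)
  ultimately show ?thesis by simp
qed

lemma eventually_M_decreasing: "\<forall>\<^sub>F x in at_infinity. cmod (M x) < cmod x"
  unfolding eventually_at_infinity
proof (intro exI allI impI)
  define B where "B = Max {R, R / cmod \<Lambda>, 2 * (cmod x0 + 1) / (1 - cmod \<Lambda>)}"
  have B: "B \<ge> R" "B \<ge> R / cmod \<Lambda>" "B \<ge> 2 * (cmod x0 + 1) / (1 - cmod \<Lambda>)" by (simp_all add: B_def)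
  fix x assume x: "B + cmod x0 + 2 \<le> cmod x"
  then obtain y where y: "cmod y > R" "P y = x" using P_attains[of x] B(1) by auto
  have y_gt: "cmod y > B" using cmod_P_le[OF y(1)] x y(2) by simp
  have y_large: "R < cmod (\<Lambda> * y)" "2 * (cmod x0 + 1) < cmod y - cmod (\<Lambda> * y)"
    using \<Lambda> le_less_trans[OF B(2) y_gt] le_less_trans[OF B(3) y_gt]
    by (simp_all add: norm_mult divide_less_eq algebra_simps)
  have "M x = P (\<Lambda> * y)" using P_conjugates[OF y_large(1)] y(2) by simp
  then show "cmod (M x) < cmod x" using cmod_P_le[OF y_large(1)] cmod_P_ge[OF y(1)] y_large(2) y(2) by simp
qed

lemma filterlim_\<Lambda>_power:
  assumes "y \<noteq> 0"
  shows "filterlim (\<lambda>k. \<Lambda> ^ k * y) (at 0) sequentially"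
  unfolding filterlim_at using \<Lambda>_power_tendsto_0 \<Lambda> assms by (auto intro!: always_eventually)

lemma extension_no_pole: "\<not> is_pole extension 0"
proof
  assume "is_pole extension 0"
  then have "filterlim (\<lambda>k. extension (\<Lambda> ^ k * 1)) at_infinity sequentially"
    unfolding is_pole_def by (rule filterlim_compose) (intro filterlim_\<Lambda>_power, simp)
  then have orbit: "filterlim (\<lambda>k. extension (\<Lambda> ^ k)) at_infinity sequentially" by simp
  then have "\<forall>\<^sub>F k in sequentially. cmod (M (extension (\<Lambda> ^ k))) < cmod (extension (\<Lambda> ^ k))"
    using eventually_M_decreasing by (rule eventually_compose_filterlim[rotated])
  then obtain k where k: "\<And>l. l \<ge> k \<Longrightarrow> cmod (extension (\<Lambda> ^ Suc l)) < cmod (extension (\<Lambda> ^ l))"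
    using extension_conjugates \<Lambda> unfolding eventually_sequentially by auto
  have "cmod (extension (\<Lambda> ^ l)) \<le> cmod (extension (\<Lambda> ^ k))" if "l \<ge> k" for l
    using that
  proof (induction l rule: dec_induct)
    case (step l)
    then show ?case using k[of l] by linarith
  qed simp
  moreover obtain l where "l \<ge> k" "cmod (extension (\<Lambda> ^ l)) > cmod (extension (\<Lambda> ^ k))"
    using filterlim_at_infinity_imp_norm_at_top[OF orbit] unfolding filterlim_at_top_dense eventually_sequentially
    by (metis order_refl nle_le)
  ultimately show False by fastforce
qed

lemma extension_removable:
  assumes hol: "extension holomorphic_on UNIV - {0}" and lim: "(extension \<longlongrightarrow> l) (at 0)" and y: "y \<noteq> 0"
  shows "extension y = y + x0"
proof -
  define Q where "Q = (\<lambda>y. if y = 0 then l else extension y)"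
  have "Q holomorphic_on UNIV" unfolding Q_def by (rule removable_singularity[OF hol _ lim]) simp
  then have Q_hol: "(\<lambda>y. Q y - (y + x0)) holomorphic_on UNIV" by (intro holomorphic_intros)
  have "((\<lambda>y. Q y - (y + x0)) \<longlongrightarrow> 0) at_infinity"
  proof (rule Lim_null_comparison)
    have "norm (Q y - (y + x0)) \<le> K / cmod y" if "norm y \<ge> R + 1" for y
      using that R P_near[of y] extension_eq[of y 0] by (auto simp: Q_def)
    then show "\<forall>\<^sub>F y in at_infinity. norm (Q y - (y + x0)) \<le> K / cmod y" unfolding eventually_at_infinity by blast
    show "((\<lambda>y. K / cmod y) \<longlongrightarrow> 0) at_infinity"
      by (intro tendsto_divide_0[OF tendsto_const] filterlim_at_top_imp_at_infinity filterlim_norm_at_top)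
  qed
  from Liouville_weak_0[OF Q_hol this, of y] show ?thesis using y by (simp add: Q_def)
qed

lemma extension_attains:
  assumes hol: "extension holomorphic_on UNIV - {0}" and "a \<noteq> b"
  shows "\<exists>y. y \<noteq> 0 \<and> extension y \<in> {a, b}"
proof (rule ccontr)
  assume "\<not> ?thesis"
  then have omits: "extension y \<noteq> a \<and> extension y \<noteq> b" if "y \<noteq> 0" for y using that by blast
  have diverges: "\<not> (extension \<longlongrightarrow> l) (at 0)" for l
  proof
    assume "(extension \<longlongrightarrow> l) (at 0)"
    then have "extension (w - x0) = w" if "w \<noteq> x0" for w
      using extension_removable[OF hol, of l "w - x0"] that by simp
    then have "a = x0" "b = x0" using omits[of "a - x0"] omits[of "b - x0"] by auto
    then show False using assms(2) by simp
  qed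
  have not_convergent: "\<not> ((\<lambda>y. extension y - a) \<longlongrightarrow> l) (at 0)" for l
    using tendsto_add[OF _ tendsto_const[of a], of "\<lambda>y. extension y - a"] diverges by auto
  have "(\<lambda>y. extension y - a) holomorphic_on UNIV - {0}" by (intro holomorphic_intros hol)
  then obtain l where "((inverse \<circ> (\<lambda>y. extension y - a)) \<longlongrightarrow> l) (at 0)"
    using great_Picard[of UNIV 0 0 "b - a" "\<lambda>y. extension y - a"] assms(2) omits not_convergent by auto
  then have lim: "((\<lambda>y. inverse (extension y - a)) \<longlongrightarrow> l) (at 0)" by (simp add: o_def)
  show False
  proof (cases "l = 0")
    case True
    have "filterlim (\<lambda>y. inverse (extension y - a)) (at 0) (at 0)"
      unfolding filterlim_at using lim True omits by (auto simp: eventually_at_filter)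
    then have "filterlim (\<lambda>y. extension y - a) at_infinity (at 0)" by (simp only: filterlim_inverse_at_iff)
    from tendsto_add_filterlim_at_infinity'[OF this tendsto_const[of a]] show False
      using extension_no_pole by (simp add: is_pole_def)
  next
    case False
    from tendsto_inverse[OF lim this] show False using not_convergent by simp
  qed
qed

theorem orbit_leaves_or_hits:
  assumes "a \<noteq> b"
  shows "\<exists>y k. y \<in> regular k \<and> ((M ^^ k) (P y) \<notin> S \<or> (M ^^ k) (P y) \<in> {a, b})"
proof (rule ccontr)
  assume none: "\<not> ?thesis"
  have regular: "regular k = {y. cmod y > R}" for k
  proof (induction k)
    case (Suc k)
    then show ?case using none unfolding regular_Suc by blast
  qed (simp add: regular_def)
  obtain y where y: "y \<noteq> 0" "extension y \<in> {a, b}"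
    using extension_attains[OF extension_holomorphic[OF regular] assms] by blast
  obtain k where k: "cmod (y / \<Lambda> ^ k) > R" using div_\<Lambda>_power_large[OF y(1)] by blast
  then have "y / \<Lambda> ^ k \<in> regular k" by (simp only: regular mem_Collect_eq)
  then show False using none y(2) unfolding extension_eq[OF k] by blast
qed

end

section \<open>Multiple poles of the iterates\<close>

lemma holomorphic_zero_eq_power:
  assumes hol: "f holomorphic_on S" and S: "open S" "connected S" "\<xi> \<in> S"
    and zero: "f \<xi> = 0" and nonconst: "\<not> f constant_on S"
  obtains D \<phi> r where "D > 0" "r > 0" "ball \<xi> r \<subseteq> S" "\<phi> holomorphic_on ball \<xi> r" "\<phi> \<xi> = 0"
    "deriv \<phi> \<xi> \<noteq> 0" "\<And>w. w \<in> ball \<xi> r \<Longrightarrow> f w = \<phi> w ^ D"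
proof -
  obtain g r D where r: "0 < D" "0 < r" "ball \<xi> r \<subseteq> S" and g: "g holomorphic_on ball \<xi> r"
    "\<And>w. w \<in> ball \<xi> r \<Longrightarrow> f w = (w - \<xi>) ^ D * g w" "\<And>w. w \<in> ball \<xi> r \<Longrightarrow> g w \<noteq> 0"
    using holomorphic_factor_zero_nonconstant[OF hol S zero nonconst] by metis
  obtain l where l: "l holomorphic_on ball \<xi> r" "\<And>w. w \<in> ball \<xi> r \<Longrightarrow> g w = exp (l w)"
    using contractible_imp_holomorphic_log[OF g(1) convex_imp_contractible[OF convex_ball] g(3)] by blast
  define u where "u = (\<lambda>w. exp (l w / of_nat D))"
  define \<phi> where "\<phi> = (\<lambda>w. (w - \<xi>) * u w)"
  have u: "u holomorphic_on ball \<xi> r" unfolding u_def using r by (intro holomorphic_intros l(1)) simp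
  have "(u has_field_derivative deriv u \<xi>) (at \<xi>)" using r by (intro holomorphic_derivI[OF u]) auto
  then have "(\<phi> has_field_derivative u \<xi>) (at \<xi>)" unfolding \<phi>_def by (auto intro!: derivative_eq_intros)
  then have "deriv \<phi> \<xi> \<noteq> 0" by (simp add: DERIV_imp_deriv u_def)
  moreover have "\<phi> holomorphic_on ball \<xi> r" unfolding \<phi>_def by (intro holomorphic_intros u)
  moreover have "f w = \<phi> w ^ D" if "w \<in> ball \<xi> r" for w
  proof -
    have "u w ^ D = exp (of_nat D * (l w / of_nat D))" unfolding u_def by (rule exp_of_nat_mult[symmetric])
    then show ?thesis using g(2)[OF that] l(2)[OF that] r by (simp add: \<phi>_def power_mult_distrib)
  qed
  ultimately show ?thesis using that[of D r \<phi>] r by (simp add: \<phi>_def)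
qed

lemma holomorphic_local_inverse:
  assumes hol: "\<phi> holomorphic_on S" and S: "open S" "\<xi> \<in> S" and deriv: "deriv \<phi> \<xi> \<noteq> 0"
  obtains \<psi> \<eta> where "\<eta> > 0" "\<psi> holomorphic_on ball (\<phi> \<xi>) \<eta>" "\<psi> (\<phi> \<xi>) = \<xi>" "deriv \<psi> (\<phi> \<xi>) \<noteq> 0"
    "\<And>q. q \<in> ball (\<phi> \<xi>) \<eta> \<Longrightarrow> \<psi> q \<in> S \<and> \<phi> (\<psi> q) = q"
proof -
  obtain r where r: "r > 0" "ball \<xi> r \<subseteq> S" "open (\<phi> ` ball \<xi> r)" "inj_on \<phi> (ball \<xi> r)"
    using has_complex_derivative_locally_invertible[OF hol S(2,1) deriv] by blast
  have hol_r: "\<phi> holomorphic_on ball \<xi> r" by (rule holomorphic_on_subset[OF hol r(2)])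
  obtain \<psi> where \<psi>: "\<psi> holomorphic_on \<phi> ` ball \<xi> r"
      "\<And>z. z \<in> ball \<xi> r \<Longrightarrow> deriv \<phi> z * deriv \<psi> (\<phi> z) = 1" "\<And>z. z \<in> ball \<xi> r \<Longrightarrow> \<psi> (\<phi> z) = z"
    using holomorphic_has_inverse[OF hol_r open_ball r(4)] by blast
  have "\<phi> \<xi> \<in> \<phi> ` ball \<xi> r" using r(1) by simp
  then obtain \<eta> where \<eta>: "\<eta> > 0" "ball (\<phi> \<xi>) \<eta> \<subseteq> \<phi> ` ball \<xi> r" using r(3) open_contains_ball by blast
  show ?thesis
  proof
    show "\<psi> holomorphic_on ball (\<phi> \<xi>) \<eta>" by (rule holomorphic_on_subset[OF \<psi>(1) \<eta>(2)])
    show "\<psi> (\<phi> \<xi>) = \<xi>" "deriv \<psi> (\<phi> \<xi>) \<noteq> 0" using \<psi>(2,3)[of \<xi>] r(1) by auto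
    show "\<psi> q \<in> S \<and> \<phi> (\<psi> q) = q" if "q \<in> ball (\<phi> \<xi>) \<eta>" for q using that \<eta>(2) r(2) \<psi>(3) by fastforce
  qed (rule \<eta>(1))
qed

lemma multiple_zero_coordinate:
  assumes hol: "f holomorphic_on S" and S: "open S" "connected S" "\<xi> \<in> S"
    and zero: "f \<xi> = 0" "deriv f \<xi> = 0" and nonconst: "\<not> f constant_on S"
  obtains D \<psi> \<eta> where "D \<ge> 2" "\<eta> > 0" "\<psi> holomorphic_on ball 0 \<eta>" "\<psi> 0 = \<xi>" "deriv \<psi> 0 \<noteq> 0"
    "\<And>q. q \<in> ball 0 \<eta> \<Longrightarrow> \<psi> q \<in> S \<and> f (\<psi> q) = q ^ D"
proof -
  obtain D \<phi> r where D: "D > 0" and r: "r > 0" "ball \<xi> r \<subseteq> S"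
    and \<phi>: "\<phi> holomorphic_on ball \<xi> r" "\<phi> \<xi> = 0" "deriv \<phi> \<xi> \<noteq> 0" "\<And>w. w \<in> ball \<xi> r \<Longrightarrow> f w = \<phi> w ^ D"
    using holomorphic_zero_eq_power[OF hol S zero(1) nonconst] by metis
  have \<xi>: "\<xi> \<in> ball \<xi> r" using r by simp
  have "deriv f \<xi> = deriv (\<lambda>w. \<phi> w ^ D) \<xi>"
    using \<phi>(4) r by (intro deriv_cong_ev refl eventually_nhds_in_open[THEN eventually_mono, of "ball \<xi> r"]) auto
  then have "D \<noteq> 1" using \<phi>(3) zero(2) by auto
  then have D_ge_2: "D \<ge> 2" using D by simp
  obtain \<psi> \<eta> where \<psi>: "\<eta> > 0" "\<psi> holomorphic_on ball 0 \<eta>" "\<psi> 0 = \<xi>" "deriv \<psi> 0 \<noteq> 0"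
    "\<And>q. q \<in> ball 0 \<eta> \<Longrightarrow> \<psi> q \<in> ball \<xi> r \<and> \<phi> (\<psi> q) = q"
    using holomorphic_local_inverse[OF \<phi>(1) open_ball \<xi> \<phi>(3)] \<phi>(2) by metis
  moreover have "\<psi> q \<in> S \<and> f (\<psi> q) = q ^ D" if "q \<in> ball 0 \<eta>" for q
    using \<psi>(5)[OF that] \<phi>(4)[of "\<psi> q"] r(2) by auto
  ultimately show ?thesis using that[OF D_ge_2] by blast
qed

definition multiple_pole_coordinate ::
    "complex set \<Rightarrow> complex \<Rightarrow> complex set \<Rightarrow> (complex \<Rightarrow> complex) \<Rightarrow> bool" where
  "multiple_pole_coordinate X a V H \<longleftrightarrow> open V \<and> a \<in> V \<and> H holomorphic_on V \<and> H a = 0 \<and> deriv H a = 0 \<and>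
     (\<forall>x\<in>V. x \<in> X \<longleftrightarrow> H x = 0 \<or> 1 / H x \<in> X)"

locale koenigs_rotation_domain = koenigs_extra_rotation + koenigs_domain +
  assumes M_invariant: "x \<in> S \<Longrightarrow> M x \<in> X \<longleftrightarrow> x \<in> X"
begin

lemma lift_iff_regular: "y \<in> regular k \<Longrightarrow> y \<in> lift \<longleftrightarrow> (M ^^ k) (P y) \<in> X"
proof (induction k)
  case 0
  then show ?case using lift_iff_P[of y] by (simp add: regular_def)
next
  case (Suc k)
  then show ?case using M_invariant[of "(M ^^ k) (P y)"] by (simp add: regular_Suc)
qed

lemma no_multiple_zero:
  assumes W: "open W" "\<xi> \<in> W" "0 \<notin> W" and f: "f holomorphic_on W" "f \<xi> = 0" "deriv f \<xi> = 0"
    and lift: "\<And>y. y \<in> W \<Longrightarrow> y \<in> lift \<longleftrightarrow> f y = 0 \<or> 1 / f y \<in> X"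
  shows False
proof -
  obtain r where r: "r > 0" "ball \<xi> r \<subseteq> W" using W open_contains_ball by metis
  have hol: "f holomorphic_on ball \<xi> r" by (rule holomorphic_on_subset[OF f(1) r(2)])
  have \<xi>: "\<xi> \<in> ball \<xi> r" using r by simp
  have "\<not> f constant_on ball \<xi> r"
  proof
    assume "f constant_on ball \<xi> r"
    then have "f y = 0" if "y \<in> ball \<xi> r" for y using f(2) \<xi> that unfolding constant_on_def by metis
    then have "ball \<xi> r \<subseteq> lift" using lift r(2) by blast
    then have "ball \<xi> r \<subseteq> interior lift" by (rule interior_maximal) simp
    then show False using interior_lift \<xi> by blast
  qed
  then obtain D \<psi> \<eta> where D: "D \<ge> 2" "\<eta> > 0" "\<psi> holomorphic_on ball 0 \<eta>" "\<psi> 0 = \<xi>" "deriv \<psi> 0 \<noteq> 0"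
    and \<psi>: "\<And>q. q \<in> ball 0 \<eta> \<Longrightarrow> \<psi> q \<in> ball \<xi> r \<and> f (\<psi> q) = q ^ D"
    using multiple_zero_coordinate[OF hol open_ball connected_ball \<xi> f(2,3)] by metis
  show False
  proof (rule no_branched_coordinate[OF D(1,2,3) _ D(5)])
    show "\<psi> 0 \<noteq> 0" using D(4) W(2,3) by auto
    show "\<psi> q \<in> lift \<longleftrightarrow> 1 / q ^ D \<in> X" if "q \<in> ball 0 \<eta>" "q \<noteq> 0" for q
      using lift[of "\<psi> q"] \<psi>[OF that(1)] r(2) that(2) by auto
    show "lift \<noteq> {}" using lift[OF W(2)] f(2) by blast
  qed
qed

theorem no_multiple_pole_on_orbit:
  assumes \<xi>: "\<xi> \<in> regular k" and coordinate: "multiple_pole_coordinate X ((M ^^ k) (P \<xi>)) V H"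
  shows False
proof -
  define g where "g = (\<lambda>y. (M ^^ k) (P y))"
  define W where "W = regular k \<inter> g -` V"
  have V: "open V" "g \<xi> \<in> V" and H: "H holomorphic_on V" "H (g \<xi>) = 0" "deriv H (g \<xi>) = 0"
    "\<And>x. x \<in> V \<Longrightarrow> x \<in> X \<longleftrightarrow> H x = 0 \<or> 1 / H x \<in> X"
    using coordinate by (simp_all add: multiple_pole_coordinate_def g_def)
  have g: "open (regular k)" "g holomorphic_on regular k" using iterate_on_regular unfolding g_def by blast+
  have W: "open W" unfolding W_def
    using g V(1) holomorphic_on_imp_continuous_on continuous_open_preimage by blast
  have g_W: "g holomorphic_on W" using g(2) by (rule holomorphic_on_subset) (auto simp: W_def)
  have \<xi>_W: "\<xi> \<in> W" using \<xi> V(2) by (simp add: W_def)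
  show False
  proof (rule no_multiple_zero[of W \<xi> "\<lambda>y. H (g y)", OF W \<xi>_W])
    show "0 \<notin> W" using R by (simp add: W_def regular_def)
    show "(\<lambda>y. H (g y)) holomorphic_on W"
      using holomorphic_on_compose_gen[OF g_W H(1)] by (auto simp: W_def o_def)
    show "H (g \<xi>) = 0" by (rule H(2))
    have "(g has_field_derivative deriv g \<xi>) (at \<xi>)" by (rule holomorphic_derivI[OF g_W W \<xi>_W])
    moreover have "(H has_field_derivative 0) (at (g \<xi>))"
      using holomorphic_derivI[OF H(1) V] H(3) by simp
    ultimately show "deriv (\<lambda>y. H (g y)) \<xi> = 0" using DERIV_chain2 DERIV_imp_deriv by fastforce
    show "y \<in> lift \<longleftrightarrow> H (g y) = 0 \<or> 1 / H (g y) \<in> X" if "y \<in> W" for y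
      using lift_iff_regular[of y k] H(4)[of "g y"] that by (simp add: W_def g_def)
  qed
qed

end

section \<open>The relaxed Newton map of \<open>z\<^sup>m (z\<^sup>n - 1)\<close> modulo rotations\<close>

context newton_pmn
begin

text \<open>\<open>M\<close> is the map induced by \<open>N\<close> on the quotient of the plane by the rotations \<open>z \<mapsto> a z\<close>
  with \<open>a\<^sup>n = 1\<close>, in the coordinate \<open>x = z\<^sup>n\<close>.\<close>

definition "M x = x * (\<mu> + \<kappa> / (d * x - of_nat m)) ^ n"
definition "X = {z ^ n | z. z \<in> J}"
definition "\<Lambda> = \<mu> ^ n"
definition "x0 = of_nat n * \<mu> ^ (n - 1) * \<kappa> / (d * (1 - \<Lambda>))"
definition "nonpoles = {x. d * x \<noteq> of_nat m}"

lemma \<Lambda>: "\<Lambda> \<noteq> 0" "cmod \<Lambda> < 1"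
  using \<mu>_nonzero \<mu>_less_1 n_pos by (simp_all add: \<Lambda>_def norm_power power_less_one_iff)

lemma x0_nonzero: "x0 \<noteq> 0"
  using \<Lambda> \<mu>_nonzero \<kappa>_nonzero d_nonzero n_pos by (auto simp: x0_def)

lemma M_power: "M (z ^ n) = N z ^ n"
  by (simp add: M_def N_def power_mult_distrib)

lemma nth_root_exists:
  obtains z :: complex where "z ^ n = x"
  using exists_complex_root[of n x] n_pos by auto

lemma power_in_X: "z ^ n \<in> X \<longleftrightarrow> z \<in> J"
proof
  assume "z ^ n \<in> X"
  then obtain w where w: "z ^ n = w ^ n" "w \<in> J" by (auto simp: X_def)
  show "z \<in> J"
  proof (cases "w = 0")
    case True
    then show ?thesis using w n_pos by (auto simp: power_0_left)
  next
    case False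
    then have "(z / w) ^ n = 1" using w by (simp add: power_divide)
    then show ?thesis using J_rotate[of "z / w" w] w False by simp
  qed
qed (auto simp: X_def)

lemma M_in_X_iff:
  assumes "x \<in> nonpoles"
  shows "M x \<in> X \<longleftrightarrow> x \<in> X"
proof -
  obtain z where "z ^ n = x" by (rule nth_root_exists)
  then show ?thesis
    using assms N_in_J_iff[of z] power_in_X[of z] power_in_X[of "N z"] M_power[of z] by (simp add: nonpoles_def)
qed

lemma pole_in_X:
  assumes "x \<notin> nonpoles"
  shows "x \<in> X"
proof -
  obtain z where "z ^ n = x" by (rule nth_root_exists)
  then show ?thesis using assms pole_in_J[of z] power_in_X[of z] by (simp add: nonpoles_def)
qed

lemma interior_X: "interior X = {}"
proof (rule ccontr)
  assume "interior X \<noteq> {}"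
  then obtain x where x: "x \<in> interior X" by blast
  obtain z where z: "z ^ n = x" by (rule nth_root_exists)
  define V where "V = (\<lambda>z. z ^ n) -` interior X"
  have "open V" unfolding V_def by (intro open_vimage continuous_intros) auto
  moreover have "V \<subseteq> J" using power_in_X interior_subset by (auto simp: V_def)
  ultimately have "V \<subseteq> interior J" by (rule interior_maximal[rotated])
  then show False using x z interior_J by (auto simp: V_def)
qed

lemma closed_X: "closed X"
proof -
  have "(0 :: complex) ^ n \<noteq> 1 ^ n" using n_pos by (simp add: power_0_left)
  then have "\<not> (\<lambda>z :: complex. z ^ n) constant_on UNIV" unfolding constant_on_def by (metis UNIV_I)
  then have "open ((\<lambda>z. z ^ n) ` (- J))"
    using closed_J by (intro open_mapping_thm[of _ UNIV]) (auto intro!: holomorphic_intros)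
  moreover have "x \<in> (\<lambda>z. z ^ n) ` (- J) \<longleftrightarrow> x \<in> - X" for x
  proof -
    obtain z where "z ^ n = x" by (rule nth_root_exists)
    then show ?thesis using power_in_X by blast
  qed
  then have "(\<lambda>z. z ^ n) ` (- J) = - X" by blast
  ultimately show ?thesis unfolding closed_def by simp
qed

lemma open_nonpoles: "open nonpoles"
  unfolding nonpoles_def by (intro open_Collect_neq continuous_intros)

lemma M_holomorphic: "M holomorphic_on nonpoles"
  unfolding M_def by (intro holomorphic_intros) (auto simp: nonpoles_def)

lemma nonpoles_large:
  assumes "cmod x > 1"
  shows "x \<in> nonpoles"
proof -
  obtain z where z: "z ^ n = x" by (rule nth_root_exists)
  then have "cmod z ^ n > 1" using assms by (auto simp flip: norm_power)
  then have "cmod z \<ge> 1" using power_le_one[of "cmod z" n] by (intro leI notI) auto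
  then show ?thesis using nonpole_large[of z] z by (simp add: nonpoles_def)
qed

lemma M_asymptotic: "((\<lambda>x. M x - \<Lambda> * x) \<longlongrightarrow> (1 - \<Lambda>) * x0) at_infinity"
proof -
  define u where "u s = (\<mu> + \<kappa> * s / (d - of_nat m * s)) ^ n" for s
  have "((\<lambda>s. \<mu> + \<kappa> * s / (d - of_nat m * s)) has_field_derivative \<kappa> / d) (at 0)"
    using d_nonzero by (auto intro!: derivative_eq_intros)
  from DERIV_power[OF this, of n]
  have "(u has_field_derivative of_nat n * \<mu> ^ (n - 1) * \<kappa> / d) (at 0)"
    unfolding u_def by (simp add: mult_ac)
  then have "((\<lambda>s. (u s - u 0) / s) \<longlongrightarrow> of_nat n * \<mu> ^ (n - 1) * \<kappa> / d) (at 0)"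
    by (simp add: DERIV_def)
  moreover have "of_nat n * \<mu> ^ (n - 1) * \<kappa> / d = (1 - \<Lambda>) * x0" using \<Lambda> by (auto simp: x0_def)
  moreover have "\<forall>\<^sub>F s in at 0. (u s - u 0) / s = M (inverse s) - \<Lambda> * inverse s"
    unfolding eventually_at_filter
  proof (intro always_eventually allI impI)
    fix s :: complex assume "s \<noteq> 0"
    then have "d * inverse s - of_nat m = (d - of_nat m * s) / s" by (simp add: field_simps)
    then have "M (inverse s) = inverse s * u s" by (simp add: M_def u_def)
    then show "(u s - u 0) / s = M (inverse s) - \<Lambda> * inverse s"
      by (simp add: u_def \<Lambda>_def divide_inverse algebra_simps)
  qed
  ultimately show ?thesis unfolding lim_at_infinity_0 using Lim_transform_eventually by (fastforce simp: o_def)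
qed

subsection \<open>A multiple preimage of infinity\<close>

text \<open>If \<open>m > 0\<close>, then \<open>M\<close> has a pole of order \<open>n\<close> at \<open>m/d\<close>. If \<open>m = 0\<close>, then the pole 0 of \<open>M\<close> may be simple,
  but the critical point \<open>-\<kappa>/(d \<mu>)\<close> is mapped to it.\<close>

definition "branch_point = (if m = 0 then - \<kappa> / (d * \<mu>) else of_nat m / d)"

lemma
  assumes "m = 0"
  shows nonpoles_zero_exponent: "nonpoles = - {0}"
    and branch_point_zero_exponent: "branch_point = - \<kappa> / (d * \<mu>)"
    and M_zero_exponent: "x \<noteq> 0 \<Longrightarrow> M x = (\<mu> * x + \<kappa> / d) ^ n / x ^ (n - 1)"
proof -
  have m: "of_nat m = (0 :: complex)" using assms by simp
  show "nonpoles = - {0}" unfolding nonpoles_def m using d_nonzero by auto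
  show "branch_point = - \<kappa> / (d * \<mu>)" unfolding branch_point_def if_P[OF assms] ..
  assume x: "x \<noteq> 0"
  have "\<mu> + \<kappa> / (d * x - 0) = (\<mu> * x + \<kappa> / d) / x" using x by (simp add: add_divide_distrib)
  then have "M x = x * ((\<mu> * x + \<kappa> / d) / x) ^ n" unfolding M_def m by (simp only:)
  moreover have "x ^ n = x * x ^ (n - 1)" using n_pos by (simp flip: power_Suc)
  ultimately show "M x = (\<mu> * x + \<kappa> / d) ^ n / x ^ (n - 1)" using x by (simp only: power_divide) simp
qed

lemma M_eq_0_imp:
  assumes "m = 0" "x \<noteq> 0" "M x = 0"
  shows "x = branch_point"
proof -
  have "\<mu> * x + \<kappa> / d = 0" using M_zero_exponent assms by auto
  then have "\<mu> * x = - (\<kappa> / d)" by (simp only: eq_neg_iff_add_eq_0)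
  then have "x = - (\<kappa> / d) / \<mu>" using \<mu>_nonzero by (metis nonzero_mult_div_cancel_left)
  then show ?thesis unfolding branch_point_zero_exponent[OF assms(1)] by simp
qed

lemma branch_point_attained:
  assumes "m \<noteq> 0"
  shows "\<exists>x\<in>nonpoles. M x = branch_point"
proof -
  define p where "p = [:\<kappa> - of_nat m * \<mu>, of_nat m:] * monom 1 n - [:- of_nat m * \<mu>, of_nat m:]"
  have p: "poly p w = (of_nat m * (w - \<mu>) + \<kappa>) * w ^ n - of_nat m * (w - \<mu>)" for w
    by (simp add: p_def poly_monom algebra_simps)
  have "poly p \<mu> = \<kappa> * \<Lambda>" "poly p 1 = \<kappa>" unfolding p by (simp_all add: \<Lambda>_def)
  then have "poly p \<mu> \<noteq> poly p 1" using \<kappa>_nonzero \<Lambda>(2) by auto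
  then have "\<not> constant (poly p)" unfolding Fundamental_Theorem_Algebra.constant_def by blast
  then obtain w where w: "poly p w = 0" using fundamental_theorem_of_algebra by blast
  have w_\<mu>: "w - \<mu> \<noteq> 0" using w \<open>poly p \<mu> = \<kappa> * \<Lambda>\<close> \<kappa>_nonzero \<Lambda>(1) by auto
  define x where "x = (of_nat m + \<kappa> / (w - \<mu>)) / d"
  have x: "d * x - of_nat m = \<kappa> / (w - \<mu>)" using d_nonzero by (simp add: x_def)
  have x_quotient: "x = (of_nat m * (w - \<mu>) + \<kappa>) / (w - \<mu>) / d"
    unfolding x_def add_divide_distrib using w_\<mu> by simp
  have "M x = x * w ^ n" unfolding M_def x using \<kappa>_nonzero by simp
  also have "x * w ^ n = (of_nat m * (w - \<mu>) + \<kappa>) * w ^ n / (w - \<mu>) / d"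
    by (subst x_quotient) simp
  also have "\<dots> = branch_point" using w w_\<mu> assms by (simp add: p branch_point_def)
  finally show ?thesis using x w_\<mu> \<kappa>_nonzero by (intro bexI[of _ x]) (auto simp: nonpoles_def)
qed

lemma orbit_hits_branch_point:
  assumes "koenigs_domain M P \<Lambda> x0 R K nonpoles" and P_nonpole: "\<And>y. cmod y > R \<Longrightarrow> P y \<in> nonpoles"
  shows "\<exists>y k. y \<in> koenigs_domain.regular M P R nonpoles k \<and> (M ^^ k) (P y) = branch_point"
proof -
  interpret koenigs_domain M P \<Lambda> x0 R K nonpoles by fact
  show ?thesis
  proof (cases "m = 0")
    case True
    have "branch_point \<noteq> 0"
      using \<kappa>_nonzero \<mu>_nonzero d_nonzero unfolding branch_point_zero_exponent[OF True] by simp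
    then obtain y k where y: "y \<in> regular k"
      and "(M ^^ k) (P y) \<notin> nonpoles \<or> (M ^^ k) (P y) \<in> {branch_point, 0}"
      using orbit_leaves_or_hits by blast
    then consider "(M ^^ k) (P y) = branch_point" | "(M ^^ k) (P y) = 0"
      unfolding nonpoles_zero_exponent[OF True] by blast
    then show ?thesis
    proof cases
      case 2
      have "P y \<in> nonpoles" using y P_nonpole by (simp add: regular_def)
      then have "P y \<noteq> 0" unfolding nonpoles_zero_exponent[OF True] by simp
      then obtain j where j: "k = Suc j" using 2 by (cases k) auto
      have j_regular: "y \<in> regular j" "(M ^^ j) (P y) \<in> nonpoles" using y by (simp_all add: j regular_Suc)
      then have "(M ^^ j) (P y) \<noteq> 0" unfolding nonpoles_zero_exponent[OF True] by simp
      then have "(M ^^ j) (P y) = branch_point" using M_eq_0_imp[OF True] 2 by (simp add: j)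
      then show ?thesis using j_regular(1) by blast
    qed (use y in blast)
  next
    case False
    obtain x where x: "x \<in> nonpoles" "M x = branch_point" using branch_point_attained[OF False] by blast
    have "w \<notin> nonpoles \<longleftrightarrow> w = branch_point" for w
      using False d_nonzero by (auto simp: nonpoles_def branch_point_def field_simps)
    then obtain y k where y: "y \<in> regular k" and "(M ^^ k) (P y) = branch_point \<or> (M ^^ k) (P y) = x"
      using orbit_leaves_or_hits[of branch_point x] x(1) by blast
    moreover have "y \<in> regular (Suc k) \<and> (M ^^ Suc k) (P y) = branch_point" if "(M ^^ k) (P y) = x"
      using that x y by (simp add: regular_Suc)
    ultimately show ?thesis by blast
  qed
qed

lemma deriv_power_mult_eq_0:
  fixes f g :: "complex \<Rightarrow> complex"
  assumes hol: "f holomorphic_on S" "g holomorphic_on S" and S: "open S" "a \<in> S" and zero: "f a = 0" "k \<ge> 2"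
  shows "deriv (\<lambda>x. f x ^ k * g x) a = 0"
proof (rule DERIV_imp_deriv)
  have "(f has_field_derivative deriv f a) (at a)" "(g has_field_derivative deriv g a) (at a)"
    using holomorphic_derivI hol S by blast+
  then have "((\<lambda>x. f x ^ k * g x) has_field_derivative
      f a ^ k * deriv g a + of_nat k * f a ^ (k - 1) * deriv f a * g a) (at a)"
    by (auto intro!: derivative_eq_intros)
  then show "((\<lambda>x. f x ^ k * g x) has_field_derivative 0) (at a)" using zero by (simp add: power_0_left)
qed

lemma branch_coordinate_positive_exponent:
  assumes "m \<noteq> 0"
  shows "\<exists>V H. multiple_pole_coordinate X branch_point V H"
proof -
  define E where "E x = d * x - of_nat m" for x
  define V where "V = {x. x \<noteq> 0 \<and> \<mu> * E x + \<kappa> \<noteq> 0}"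
  define g where "g x = 1 / (x * (\<mu> * E x + \<kappa>) ^ n)" for x
  define H where "H x = E x ^ n * g x" for x
  have E: "E holomorphic_on V" unfolding E_def by (intro holomorphic_intros)
  have g: "g holomorphic_on V" unfolding g_def by (intro holomorphic_intros E) (auto simp: V_def)
  have V: "open V" unfolding V_def E_def by (intro open_Collect_conj open_Collect_neq continuous_intros)
  have E_branch: "E branch_point = 0" using assms d_nonzero by (simp add: E_def branch_point_def)
  have branch_V: "branch_point \<in> V"
    using assms d_nonzero E_branch \<kappa>_nonzero by (simp add: V_def branch_point_def)
  have "multiple_pole_coordinate X branch_point V H"
    unfolding multiple_pole_coordinate_def
  proof (intro conjI ballI)
    show "H holomorphic_on V" unfolding H_def by (intro holomorphic_intros E g)
    show "H branch_point = 0" using E_branch n_pos by (simp add: H_def power_0_left)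
    show "deriv H branch_point = 0" unfolding H_def by (rule deriv_power_mult_eq_0[OF E g V branch_V E_branch n])
    fix x assume x: "x \<in> V"
    show "x \<in> X \<longleftrightarrow> H x = 0 \<or> 1 / H x \<in> X"
    proof (cases "E x = 0")
      case True
      then show ?thesis using pole_in_X[of x] n_pos by (simp add: nonpoles_def E_def H_def power_0_left)
    next
      case False
      then have "\<mu> + \<kappa> / E x = (\<mu> * E x + \<kappa>) / E x" by (simp add: add_divide_distrib)
      then have "M x = 1 / H x" by (simp add: M_def H_def g_def power_divide flip: E_def)
      moreover have "H x \<noteq> 0" using x False by (simp add: H_def g_def V_def)
      ultimately show ?thesis using M_in_X_iff[of x] False by (simp add: nonpoles_def E_def)
    qed
  qed (rule V branch_V)+
  then show ?thesis by blast
qed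

lemma in_X_iff_zero_exponent:
  assumes m: "m = 0" and x: "x \<noteq> 0" "\<mu> * M x + \<kappa> / d \<noteq> 0" and H: "H = M x ^ (n - 1) / (\<mu> * M x + \<kappa> / d) ^ n"
  shows "x \<in> X \<longleftrightarrow> H = 0 \<or> 1 / H \<in> X"
proof (cases "M x = 0")
  case True
  have "M x \<in> X \<longleftrightarrow> x \<in> X" "M x \<in> X"
    using M_in_X_iff[of x] pole_in_X[of "M x"] x True by (simp_all add: nonpoles_zero_exponent[OF m])
  then show ?thesis using H True n by (simp add: power_0_left)
next
  case False
  then have "M (M x) = 1 / H" using M_zero_exponent[OF m False] by (simp add: H)
  moreover have "H \<noteq> 0" using False x(2) by (simp add: H)
  ultimately show ?thesis
    using M_in_X_iff[of x] M_in_X_iff[of "M x"] x(1) False by (simp add: nonpoles_zero_exponent[OF m])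
qed

lemma branch_coordinate_zero_exponent:
  assumes m: "m = 0"
  shows "\<exists>V H. multiple_pole_coordinate X branch_point V H"
proof -
  define L where "L x = \<mu> * x + \<kappa> / d" for x
  define V where "V = (- {0}) \<inter> (\<lambda>x. L (M x)) -` (- {0})"
  define g where "g x = 1 / (x ^ ((n - 1) * (n - 1)) * L (M x) ^ n)" for x
  define H where "H x = L x ^ (n * (n - 1)) * g x" for x
  note nonpoles = nonpoles_zero_exponent[OF m]
  have M_L: "M x = L x ^ n / x ^ (n - 1)" if "x \<noteq> 0" for x using M_zero_exponent[OF m that] by (simp add: L_def)
  have L: "L holomorphic_on S" for S unfolding L_def by (intro holomorphic_intros)
  have "M holomorphic_on - {0}" using M_holomorphic nonpoles by simp
  then have LM: "(\<lambda>x. L (M x)) holomorphic_on - {0}" unfolding L_def by (intro holomorphic_intros)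
  then have V: "open V" unfolding V_def
    by (intro continuous_open_preimage holomorphic_on_imp_continuous_on) auto
  have g: "g holomorphic_on V"
    unfolding g_def by (intro holomorphic_intros holomorphic_on_subset[OF LM]) (auto simp: V_def)
  have branch: "branch_point \<noteq> 0" "L branch_point = 0"
    using \<kappa>_nonzero d_nonzero \<mu>_nonzero by (simp_all add: branch_point_zero_exponent[OF m] L_def)
  have "L 0 \<noteq> 0" using \<kappa>_nonzero d_nonzero by (simp add: L_def)
  then have branch_V: "branch_point \<in> V" using branch M_L n_pos by (simp add: V_def power_0_left)
  have "2 * 1 \<le> n * (n - 1)" using n by (intro mult_le_mono) auto
  then have exponent: "n * (n - 1) \<ge> 2" by simp
  have "multiple_pole_coordinate X branch_point V H"
    unfolding multiple_pole_coordinate_def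
  proof (intro conjI ballI)
    show "H holomorphic_on V" unfolding H_def by (intro holomorphic_intros L g)
    show "H branch_point = 0" using branch(2) exponent unfolding H_def by (simp only: power_0_left) auto
    show "deriv H branch_point = 0"
      unfolding H_def by (rule deriv_power_mult_eq_0[OF L g V branch_V branch(2) exponent])
    fix x assume "x \<in> V"
    then have x: "x \<noteq> 0" "L (M x) \<noteq> 0" by (auto simp: V_def)
    have "H x = M x ^ (n - 1) / L (M x) ^ n"
      using M_L[OF x(1)] by (simp add: H_def g_def power_divide flip: power_mult)
    then show "x \<in> X \<longleftrightarrow> H x = 0 \<or> 1 / H x \<in> X" using x unfolding L_def by (intro in_X_iff_zero_exponent[OF m])
  qed (rule V branch_V)+
  then show ?thesis by blast
qed

subsection \<open>The symmetry group\<close>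

lemma rotation_symmetry:
  assumes a: "cmod a = 1" and symmetry: "\<And>z. a * z \<in> J \<longleftrightarrow> z \<in> J"
  shows "a ^ n = 1"
proof (rule ccontr)
  assume "a ^ n \<noteq> 1"
  have X_rotate: "a ^ n * x \<in> X \<longleftrightarrow> x \<in> X" for x
  proof -
    obtain z where "z ^ n = x" by (rule nth_root_exists)
    then show ?thesis using power_in_X[of z] power_in_X[of "a * z"] symmetry[of z] by (simp add: power_mult_distrib)
  qed
  have "M holomorphic_on {x. cmod x > 1}" using nonpoles_large by (intro holomorphic_on_subset[OF M_holomorphic]) auto
  then obtain P R K where R_large: "R \<ge> cmod x0 + 2" and koenigs: "koenigs_coordinate M P \<Lambda> x0 R K"
    using koenigs_at_infinity[OF \<Lambda> _ M_asymptotic] by metis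
  interpret koenigs_coordinate M P \<Lambda> x0 R K by (rule koenigs)
  have P_nonpole: "P y \<in> nonpoles" if "cmod y > R" for y
    using cmod_P_ge[OF that] R_large that by (intro nonpoles_large) linarith
  interpret koenigs_rotation_domain M P \<Lambda> x0 R K X "a ^ n" nonpoles
    using a \<open>a ^ n \<noteq> 1\<close> X_rotate x0_nonzero P_nonpole M_in_X_iff closed_X interior_X open_nonpoles M_holomorphic
    by unfold_locales (auto simp: norm_power)
  obtain \<xi> k where \<xi>: "\<xi> \<in> regular k" "(M ^^ k) (P \<xi>) = branch_point"
    using orbit_hits_branch_point[OF koenigs_domain_axioms P_nonpole] by blast
  obtain V H where "multiple_pole_coordinate X branch_point V H"
    using branch_coordinate_positive_exponent branch_coordinate_zero_exponent by blast
  then show False using no_multiple_pole_on_orbit[OF \<xi>(1)] \<xi>(2) by simp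
qed

theorem sym_group_newton:
  assumes "\<not> is_line (julia F)"
  shows "sym_group (julia F) = rotations n"
proof (rule sym_group_julia_eq_rotations[OF n_pos J_rotate])
  fix a b assume a: "cmod a = 1" and symmetry: "\<And>z. a * z + b \<in> J \<longleftrightarrow> z \<in> J"
  have "b = 0" by (rule symmetry_fixes_zero[OF assms a symmetry])
  then show "b = 0 \<and> a ^ n = 1" using symmetry rotation_symmetry[OF a] by simp
qed

end

theorem theoremD:
  fixes m n :: nat and h :: complex
  assumes "n \<ge> 2"
    and "cmod (h - 1) < 1"
    and "\<not> is_line (julia (relaxed_newton h (pmn m n)))"
  shows "sym_group (julia (poly_sphere (pmn m n))) = sym_group (julia (relaxed_newton h (pmn m n)))"
proof -
  interpret newton_pmn m n h using assms(1,2) by unfold_locales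
  show ?thesis using sym_group_pmn sym_group_newton[OF assms(3)] by simp
qed

end
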